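(* Let $\Omega\subset\mathbb{R}^N$ be a bounded Lipschitz domain satisfying the exterior cone condition. Let $0<t<s<1$, $2<\frac Ns<p<\infty$, $1< p'=\frac{p}{p-1}<2$ and $\frac1{p'}<t<1$. Let $Z_{ad}\subset L^p(\Omega)$ be nonempty, closed and convex, $u_b\in C(\overline\Omega)$, $\mathcal{K}:=\{w\in C_0(\Omega): w(x)\le u_b(x)\ \forall x\in\overline\Omega\}$, and let $J:L^2(\Omega)\times L^p(\Omega)\to\mathbb{R}$ be continuously Fréchet differentiable, with partial derivatives $J_u(u,z)\in L^2(\Omega)$, $J_z(u,z)\in L^{p'}(\Omega)$ (Riesz identification). Assume there is $\widehat z\in Z_{ad}$ whose state $\widehat u\in U$ (i.e. $(-\Delta)_D^s\widehat u=\widehat z$) satisfies $\widehat u(x)<u_b(x)$ for all $x\in\overline\Omega$. Let $(\bar u,\bar z)$ be a solution of $$\min J(u,z)\quad\text{over } (u,z)\in U\times L^p(\Omega)\ \text{ subject to } (-\Delta)_D^s u=z\text{ in }\Omega,\ u|_\Omega\in\mathcal{K},\ z\in Z_{ad},$$ and let $\bar\mu\in\mathcal M(\Omega)=(C_0(\Omega))^\star$ and $\bar\xi\in L^{p'}(\Omega)$ be multipliers satisfying the optimality system $$\langle\bar\xi,(-\Delta)_D^s v\rangle_{L^{p'}(\Omega),L^p(\Omega)}=(J_u(\bar u,\bar z),v)_{L^2(\Omega)}+\int_\Omega v\,d\bar\mu\quad\forall v\in U,$$ $$\langle\bar\xi+J_z(\bar u,\bar z),z-\bar z\rangle_{L^{p'}(\Omega),L^p(\Omega)}\ge0\quad\forall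 z\in Z_{ad},$$ $$\bar\mu\ge0,\qquad \bar u\le u_b\ \text{in }\Omega,\qquad \int_\Omega(u_b-\bar u)\,d\bar\mu=0 .$$ Then $\bar\xi\in\widetilde W_0^{t,p'}(\Omega)$.
   Context: All functions are real valued. $C_0(\Omega)$ is the space of continuous functions on $\overline\Omega$ vanishing on $\partial\Omega$, with the sup norm (elements are extended by zero to $\mathbb{R}^N$); $\mathcal M(\Omega)=(C_0(\Omega))^\star$ is the space of (finite signed) Radon measures on $\Omega$, with pairing $\int_\Omega v\,d\mu$. For $0<\sigma<1$ and $1\le q<\infty$, $W^{\sigma,q}(\mathbb{R}^N)$ is the space of $u\in L^q(\mathbb{R}^N)$ with $\int_{\mathbb{R}^N}\int_{\mathbb{R}^N}\frac{|u(x)-u(y)|^q}{|x-y|^{N+\sigma q}}\,dx\,dy<\infty$, and $\widetilde W_0^{\sigma,q}(\Omega):=\{u\in W^{\sigma,q}(\mathbb{R}^N):u=0\text{ on }\mathbb{R}^N\setminus\Omega\}$; $\bar\xi\in\widetilde W_0^{t,p'}(\Omega)$ means that the extension of $\bar\xi$ by zero belongs to this space. Let $C_{N,s}:=\frac{s2^{2s}\Gamma(\frac{2s+N}{2})}{\pi^{N/2}\Gamma(1-s)}$. $(-\Delta)^s_D$ denotes the fractional Laplacian with zero exterior condition: for $u\in\widetilde W_0^{s,2}(\Omega)$ and $g\in L^p(\Omega)$, $(-\Delta)_D^su=g$ in $\Omega$ means $\frac{C_{N,s}}{2}\int_{\mathbb{R}^N}\int_{\mathbb{R}^N}\frac{(u(x)-u(y))(v(x)-v(y))}{|x-y|^{N+2s}}\,dx\,dy=\int_\Omega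 gv\,dx$ for all $v\in\widetilde W_0^{s,2}(\Omega)$. The state space is $$U:=\{u\in\widetilde W_0^{s,2}(\Omega)\cap C_0(\Omega): (-\Delta)_D^s(u|_\Omega)\in L^p(\Omega)\}.$$ *)

theory Defs
  imports "HOL-Analysis.Analysis"
begin

text \<open>
  Elements of a Lebesgue or Sobolev space are represented by functions on the whole space;
  all notions below depend on them only up to equality almost everywhere. For a space over
  \<open>\<Omega>\<close> (measure \<open>lebesgue_on \<Omega>\<close>) the values outside \<open>\<Omega>\<close> are irrelevant.
\<close>

section \<open>Domains\<close>

text \<open>
  Near each boundary point, \<open>\<Omega>\<close> is the strict epigraph of a Lipschitz function over the
  hyperplane orthogonal to some unit vector \<open>e\<close>; the choice of \<open>e\<close> replaces the usual
  rotation of the coordinate system.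
\<close>

definition lipschitz_boundary :: "'a::euclidean_space set \<Rightarrow> bool" where
  "lipschitz_boundary \<Omega> \<longleftrightarrow>
     (\<forall>x\<in>frontier \<Omega>. \<exists>e r L \<phi>. norm e = 1 \<and> r > 0 \<and> L-lipschitz_on {y. y \<bullet> e = 0} \<phi> \<and>
        (\<forall>y\<in>ball x r. y \<in> \<Omega> \<longleftrightarrow> \<phi> (y - (y \<bullet> e) *\<^sub>R e) < y \<bullet> e))"

definition bounded_lipschitz_domain :: "'a::euclidean_space set \<Rightarrow> bool" where
  "bounded_lipschitz_domain \<Omega> \<longleftrightarrow>
     open \<Omega> \<and> connected \<Omega> \<and> \<Omega> \<noteq> {} \<and> bounded \<Omega> \<and> lipschitz_boundary \<Omega>"

text \<open>The finite closed right circular cone with vertex \<open>x\<close>, axis \<open>e\<close>, half-opening angle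
  \<open>\<theta>\<close> and height \<open>h\<close>.\<close>

definition finite_cone :: "'a::euclidean_space \<Rightarrow> 'a \<Rightarrow> real \<Rightarrow> real \<Rightarrow> 'a set" where
  "finite_cone x e \<theta> h = {y. cos \<theta> * norm (y - x) \<le> (y - x) \<bullet> e \<and> (y - x) \<bullet> e \<le> h}"

definition exterior_cone_condition :: "'a::euclidean_space set \<Rightarrow> bool" where
  "exterior_cone_condition \<Omega> \<longleftrightarrow>
     (\<forall>x\<in>frontier \<Omega>. \<exists>e \<theta> h. norm e = 1 \<and> 0 < \<theta> \<and> \<theta> < pi / 2 \<and> 0 < h \<and>
        closure \<Omega> \<inter> finite_cone x e \<theta> h = {x})"

section \<open>Lebesgue spaces\<close>

definition Lp :: "'a measure \<Rightarrow> real \<Rightarrow> ('a \<Rightarrow> real) set" where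
  "Lp M q = {f \<in> borel_measurable M. integrable M (\<lambda>x. \<bar>f x\<bar> powr q)}"

definition Lp_norm :: "'a measure \<Rightarrow> real \<Rightarrow> ('a \<Rightarrow> real) \<Rightarrow> real" where
  "Lp_norm M q f = (\<integral>x. \<bar>f x\<bar> powr q \<partial>M) powr (1 / q)"

definition Lp_closed :: "'a measure \<Rightarrow> real \<Rightarrow> ('a \<Rightarrow> real) set \<Rightarrow> bool" where
  "Lp_closed M q Z \<longleftrightarrow>
     (\<forall>zs z. (\<forall>n::nat. zs n \<in> Z) \<longrightarrow> z \<in> Lp M q \<longrightarrow>
        (\<lambda>n. Lp_norm M q (\<lambda>x. zs n x - z x)) \<longlonglongrightarrow> 0 \<longrightarrow> z \<in> Z)"

text \<open>The library constant \<open>convex\<close> is not available, since function spaces are not an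
  instance of \<open>real_vector\<close>.\<close>

definition fun_convex :: "('a \<Rightarrow> real) set \<Rightarrow> bool" where
  "fun_convex Z \<longleftrightarrow>
     (\<forall>f\<in>Z. \<forall>g\<in>Z. \<forall>c. 0 \<le> c \<longrightarrow> c \<le> 1 \<longrightarrow> (\<lambda>x. (1 - c) * f x + c * g x) \<in> Z)"

section \<open>Continuous functions and signed measures\<close>

text \<open>Elements of \<open>C0 \<Omega>\<close> carry their extension by zero; for open \<open>\<Omega>\<close> the second condition
  includes vanishing on the boundary.\<close>

definition C0 :: "'a::euclidean_space set \<Rightarrow> ('a \<Rightarrow> real) set" where
  "C0 \<Omega> = {u. continuous_on (closure \<Omega>) u \<and> (\<forall>x. x \<notin> \<Omega> \<longrightarrow> u x = 0)}"

definition admissible_states :: "'a::euclidean_space set \<Rightarrow> ('a \<Rightarrow> real) \<Rightarrow> ('a \<Rightarrow> real) set" where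
  "admissible_states \<Omega> ub = {w \<in> C0 \<Omega>. \<forall>x\<in>closure \<Omega>. w x \<le> ub x}"

text \<open>
  Finite signed Borel measures on \<open>\<Omega>\<close>, as countably additive real-valued set functions.
  For open \<open>\<Omega>\<close> these are exactly the finite signed Radon measures, because every finite
  Borel measure on an open subset of a Euclidean space is regular. The value on the empty
  set is zero because a constant sequence is summable only if it vanishes.
\<close>

definition signed_measures :: "'a::euclidean_space set \<Rightarrow> ('a set \<Rightarrow> real) set" where
  "signed_measures \<Omega> = {\<nu>. \<forall>A::nat \<Rightarrow> 'a set.
     range A \<subseteq> sets (restrict_space borel \<Omega>) \<longrightarrow> disjoint_family A \<longrightarrow>
     (\<lambda>n. \<nu> (A n)) sums \<nu> (\<Union>n. A n)}"

definition nonneg_measure :: "'a::euclidean_space set \<Rightarrow> ('a set \<Rightarrow> real) \<Rightarrow> bool" where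
  "nonneg_measure \<Omega> \<nu> \<longleftrightarrow> (\<forall>A\<in>sets (restrict_space borel \<Omega>). 0 \<le> \<nu> A)"

text \<open>The positive part in the Jordan decomposition of \<open>\<nu>\<close>; the negative part is the positive
  part of \<open>- \<nu>\<close>.\<close>

definition positive_part :: "'a::euclidean_space set \<Rightarrow> ('a set \<Rightarrow> real) \<Rightarrow> 'a measure" where
  "positive_part \<Omega> \<nu> = measure_of \<Omega> (sets (restrict_space borel \<Omega>))
     (\<lambda>A. SUP B\<in>{B \<in> sets (restrict_space borel \<Omega>). B \<subseteq> A}. ennreal (\<nu> B))"

definition signed_integral ::
    "'a::euclidean_space set \<Rightarrow> ('a set \<Rightarrow> real) \<Rightarrow> ('a \<Rightarrow> real) \<Rightarrow> real" where
  "signed_integral \<Omega> \<nu> v =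
     (\<integral>x. v x \<partial>positive_part \<Omega> \<nu>) - (\<integral>x. v x \<partial>positive_part \<Omega> (\<lambda>A. - \<nu> A))"

section \<open>Fractional Sobolev spaces and the fractional Laplacian\<close>

definition frac_sobolev :: "real \<Rightarrow> real \<Rightarrow> ('a::euclidean_space \<Rightarrow> real) set" where
  "frac_sobolev \<sigma> q = {u \<in> Lp lebesgue q.
     (\<integral>\<^sup>+x. \<integral>\<^sup>+y. ennreal (\<bar>u x - u y\<bar> powr q / norm (x - y) powr (real DIM('a) + \<sigma> * q))
        \<partial>lebesgue \<partial>lebesgue) < \<infinity>}"

definition frac_sobolev_0 ::
    "'a::euclidean_space set \<Rightarrow> real \<Rightarrow> real \<Rightarrow> ('a \<Rightarrow> real) set" where
  "frac_sobolev_0 \<Omega> \<sigma> q =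
     {u \<in> frac_sobolev \<sigma> q. AE x in lebesgue. x \<notin> \<Omega> \<longrightarrow> u x = 0}"

definition frac_const :: "real \<Rightarrow> real \<Rightarrow> real" where
  "frac_const N s =
     s * 2 powr (2 * s) * Gamma ((2 * s + N) / 2) / (pi powr (N / 2) * Gamma (1 - s))"

text \<open>\<open>is_frac_laplacian \<Omega> s p u g\<close> means that \<open>u\<close> solves \<open>(-\<Delta>)\<^sup>s u = g\<close> in \<open>\<Omega>\<close> weakly,
  with zero exterior condition.\<close>

definition is_frac_laplacian ::
    "'a::euclidean_space set \<Rightarrow> real \<Rightarrow> real \<Rightarrow> ('a \<Rightarrow> real) \<Rightarrow> ('a \<Rightarrow> real) \<Rightarrow> bool" where
  "is_frac_laplacian \<Omega> s p u g \<longleftrightarrow>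
     u \<in> frac_sobolev_0 \<Omega> s 2 \<and> g \<in> Lp (lebesgue_on \<Omega>) p \<and>
     (\<forall>v\<in>frac_sobolev_0 \<Omega> s 2.
        frac_const (real DIM('a)) s / 2 *
          (\<integral>x. \<integral>y. (u x - u y) * (v x - v y) / norm (x - y) powr (real DIM('a) + 2 * s)
             \<partial>lebesgue \<partial>lebesgue)
        = (\<integral>x. g x * v x \<partial>lebesgue_on \<Omega>))"

definition state_space ::
    "'a::euclidean_space set \<Rightarrow> real \<Rightarrow> real \<Rightarrow> ('a \<Rightarrow> real) set" where
  "state_space \<Omega> s p =
     {u \<in> frac_sobolev_0 \<Omega> s 2 \<inter> C0 \<Omega>. \<exists>g\<in>Lp (lebesgue_on \<Omega>) p. is_frac_laplacian \<Omega> s p u g}"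

section \<open>The cost functional\<close>

text \<open>The product space \<open>L\<^sup>2(\<Omega>) \<times> L\<^sup>p(\<Omega>)\<close> carries the sum norm.\<close>

definition pair_norm ::
    "'a::euclidean_space set \<Rightarrow> real \<Rightarrow> ('a \<Rightarrow> real) \<Rightarrow> ('a \<Rightarrow> real) \<Rightarrow> real" where
  "pair_norm \<Omega> p h k = Lp_norm (lebesgue_on \<Omega>) 2 h + Lp_norm (lebesgue_on \<Omega>) p k"

definition bounded_linear_pair ::
    "'a::euclidean_space set \<Rightarrow> real \<Rightarrow> (('a \<Rightarrow> real) \<Rightarrow> ('a \<Rightarrow> real) \<Rightarrow> real) \<Rightarrow> bool" where
  "bounded_linear_pair \<Omega> p T \<longleftrightarrow>
     (\<forall>h\<in>Lp (lebesgue_on \<Omega>) 2. \<forall>h'\<in>Lp (lebesgue_on \<Omega>) 2.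
      \<forall>k\<in>Lp (lebesgue_on \<Omega>) p. \<forall>k'\<in>Lp (lebesgue_on \<Omega>) p.
        T (\<lambda>x. h x + h' x) (\<lambda>x. k x + k' x) = T h k + T h' k') \<and>
     (\<forall>c. \<forall>h\<in>Lp (lebesgue_on \<Omega>) 2. \<forall>k\<in>Lp (lebesgue_on \<Omega>) p.
        T (\<lambda>x. c * h x) (\<lambda>x. c * k x) = c * T h k) \<and>
     (\<exists>B. \<forall>h\<in>Lp (lebesgue_on \<Omega>) 2. \<forall>k\<in>Lp (lebesgue_on \<Omega>) p.
        \<bar>T h k\<bar> \<le> B * pair_norm \<Omega> p h k)"

definition frechet_derivative_at ::
    "'a::euclidean_space set \<Rightarrow> real \<Rightarrow> (('a \<Rightarrow> real) \<Rightarrow> ('a \<Rightarrow> real) \<Rightarrow> real) \<Rightarrow>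
     ('a \<Rightarrow> real) \<Rightarrow> ('a \<Rightarrow> real) \<Rightarrow> (('a \<Rightarrow> real) \<Rightarrow> ('a \<Rightarrow> real) \<Rightarrow> real) \<Rightarrow> bool" where
  "frechet_derivative_at \<Omega> p J u z T \<longleftrightarrow>
     bounded_linear_pair \<Omega> p T \<and>
     (\<forall>\<epsilon>>0. \<exists>\<delta>>0. \<forall>h\<in>Lp (lebesgue_on \<Omega>) 2. \<forall>k\<in>Lp (lebesgue_on \<Omega>) p.
        pair_norm \<Omega> p h k < \<delta> \<longrightarrow>
        \<bar>J (\<lambda>x. u x + h x) (\<lambda>x. z x + k x) - J u z - T h k\<bar> \<le> \<epsilon> * pair_norm \<Omega> p h k)"

text \<open>
  \<open>J\<close> is continuously Frechet differentiable on \<open>L\<^sup>2(\<Omega>) \<times> L\<^sup>p(\<Omega>)\<close>, its derivative \<open>D\<close> being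
  continuous in the operator norm, and \<open>Ju\<close>, \<open>Jz\<close> are the Riesz representatives of the
  partial derivatives. The first conjunct says that \<open>J\<close> is well defined on equivalence
  classes.
\<close>

definition C1_functional ::
    "'a::euclidean_space set \<Rightarrow> real \<Rightarrow> (('a \<Rightarrow> real) \<Rightarrow> ('a \<Rightarrow> real) \<Rightarrow> real) \<Rightarrow>
     (('a \<Rightarrow> real) \<Rightarrow> ('a \<Rightarrow> real) \<Rightarrow> 'a \<Rightarrow> real) \<Rightarrow>
     (('a \<Rightarrow> real) \<Rightarrow> ('a \<Rightarrow> real) \<Rightarrow> 'a \<Rightarrow> real) \<Rightarrow> bool" where
  "C1_functional \<Omega> p J Ju Jz \<longleftrightarrow>
     (\<forall>u\<in>Lp (lebesgue_on \<Omega>) 2. \<forall>u'\<in>Lp (lebesgue_on \<Omega>) 2.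
      \<forall>z\<in>Lp (lebesgue_on \<Omega>) p. \<forall>z'\<in>Lp (lebesgue_on \<Omega>) p.
        (AE x in lebesgue_on \<Omega>. u x = u' x) \<longrightarrow> (AE x in lebesgue_on \<Omega>. z x = z' x) \<longrightarrow>
        J u z = J u' z') \<and>
     (\<exists>D.
        (\<forall>u\<in>Lp (lebesgue_on \<Omega>) 2. \<forall>z\<in>Lp (lebesgue_on \<Omega>) p.
           frechet_derivative_at \<Omega> p J u z (D u z)) \<and>
        (\<forall>u\<in>Lp (lebesgue_on \<Omega>) 2. \<forall>z\<in>Lp (lebesgue_on \<Omega>) p. \<forall>\<epsilon>>0. \<exists>\<delta>>0.
           \<forall>u'\<in>Lp (lebesgue_on \<Omega>) 2. \<forall>z'\<in>Lp (lebesgue_on \<Omega>) p.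
             pair_norm \<Omega> p (\<lambda>x. u' x - u x) (\<lambda>x. z' x - z x) < \<delta> \<longrightarrow>
             (\<forall>h\<in>Lp (lebesgue_on \<Omega>) 2. \<forall>k\<in>Lp (lebesgue_on \<Omega>) p.
                \<bar>D u' z' h k - D u z h k\<bar> \<le> \<epsilon> * pair_norm \<Omega> p h k)) \<and>
        (\<forall>u\<in>Lp (lebesgue_on \<Omega>) 2. \<forall>z\<in>Lp (lebesgue_on \<Omega>) p.
           Ju u z \<in> Lp (lebesgue_on \<Omega>) 2 \<and> Jz u z \<in> Lp (lebesgue_on \<Omega>) (p / (p - 1)) \<and>
           (\<forall>h\<in>Lp (lebesgue_on \<Omega>) 2. D u z h (\<lambda>x. 0) = (\<integral>x. Ju u z x * h x \<partial>lebesgue_on \<Omega>)) \<and>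
           (\<forall>k\<in>Lp (lebesgue_on \<Omega>) p. D u z (\<lambda>x. 0) k = (\<integral>x. Jz u z x * k x \<partial>lebesgue_on \<Omega>))))"

end

theory Submission
  imports Defs
begin

text \<open>
  Let \<open>S g\<close> denote the solution of the Dirichlet problem with datum \<open>g\<close>. For bounded \<open>g\<close> the state
  \<open>S g\<close> is continuous up to the boundary: an explicit barrier, superharmonic up to an error that the
  exterior cone outweighs, controls it near the boundary, and comparing \<open>S g\<close> with its translates
  transports this modulus of continuity to the interior. Hence \<open>S g\<close> is an admissible test function
  in the adjoint equation, and \<open>\<integral> \<xi> g\<close> is bounded by a constant times the sup norm of \<open>S g\<close>.

  If \<open>g\<close> is the fractional divergence of order \<open>t\<close> of a function \<open>F\<close> of pairs of points, Stampacchia's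
  truncation method bounds the sup norm of \<open>S g\<close> by the \<open>L\<^sup>p\<close> norm of \<open>F\<close>, since \<open>t < s\<close> and
  \<open>p > N / s\<close>. The usual Sobolev embedding is replaced by the fractional Faber-Krahn inequality, which
  has an elementary proof. Choosing for \<open>F\<close> the extremal function of the \<open>W\<^sup>t\<^sup>,\<^sup>p\<^sup>'\<close> seminorm of \<open>\<xi>\<close>
  (truncated away from the diagonal) bounds that seminorm.
\<close>

section \<open>Kernel integrals\<close>

text \<open>The adjoint equation may be tested only with states in \<open>state_space\<close>, so a
  bound for \<xi> against g requires the state of g to be continuous and to vanish on the boundary.
  Continuity is proved for bounded g, which is why the extremal function F is truncated: truncation
  makes its divergence bounded. The final estimate must not depend on the truncation, hence the
  passage from the sup norm of g to the L^p norm of F. Truncating a state at level k leaves a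
  function living on the set where the state exceeds k, and the argument turns on powers of the
  measure of that set: Faber-Krahn contributes 2s/N, Hoelder 2(1/2 - 1/p), and the sum exceeds 1
  exactly when p > N/s. The gap s - t leaves, after Hoelder's inequality, a kernel |h|^(b-N) with b
  > 0; its integrability is the price of the divergence form. At a boundary point the cone may be
  arbitrarily thin, so no fixed rate of decay can be expected; the barrier is a regularised |x -
  x0|^(2a) with a as small as the cone demands.\<close>

lemma nn_integral_lborel_affine:
  fixes f :: "'a::euclidean_space \<Rightarrow> ennreal"
  assumes [measurable]: "f \<in> borel_measurable borel" and c: "c \<noteq> 0"
  shows "(\<integral>\<^sup>+x. f x \<partial>lborel) = ennreal (\<bar>c\<bar> ^ DIM('a)) * (\<integral>\<^sup>+x. f (t + c *\<^sub>R x) \<partial>lborel)"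
  by (subst lborel_affine[OF c, of t]) (simp add: nn_integral_density nn_integral_distr nn_integral_cmult)

lemma nn_integral_lborel_reflect:
  fixes f :: "'a::euclidean_space \<Rightarrow> ennreal"
  assumes [measurable]: "f \<in> borel_measurable borel"
  shows "(\<integral>\<^sup>+x. f (a - x) \<partial>lborel) = (\<integral>\<^sup>+x. f x \<partial>lborel)"
  using nn_integral_lborel_affine[OF assms, of "-1" a] by simp

lemma lborel_distr_shift:
  fixes c :: "'a::euclidean_space"
  shows "distr lborel borel (\<lambda>x. x + c) = lborel"
proof -
  have "(\<lambda>x. x + c) = (+) c" by (auto simp: add.commute)
  thus ?thesis using lborel_distr_plus[of c] by simp
qed

lemma AE_lborel_shift:
  fixes h :: "'a::euclidean_space"
  assumes "AE x in lborel. P x"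
  shows "AE x in lborel. P (x + h)"
proof -
  have "AE x in distr lborel borel (\<lambda>x. x + h). P x" unfolding lborel_distr_shift by (rule assms)
  thus ?thesis by (rule AE_distrD[rotated]) simp
qed

lemma integral_lborel_shift:
  fixes f :: "'a::euclidean_space \<Rightarrow> real"
  assumes [measurable]: "f \<in> borel_measurable borel"
  shows "(\<integral>x. f (x + h) \<partial>lborel) = (\<integral>x. f x \<partial>lborel)"
    and "integrable lborel (\<lambda>x. f (x + h)) \<longleftrightarrow> integrable lborel f"
  using integral_distr[of "\<lambda>x. x + h" lborel borel f] integrable_distr_eq[of "\<lambda>x. x + h" lborel borel f]
  by (simp_all add: lborel_distr_shift)

lemma shell_integral:
  fixes b c :: real
  assumes c: "c > 0"
  shows "(\<integral>\<^sup>+h. indicator {h. c < norm h \<and> norm h \<le> 2 * c} h * ennreal (norm h powr (b - DIM('a))) \<partial>(lborel :: 'a::euclidean_space measure))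
    = ennreal (c powr b) * (\<integral>\<^sup>+h. indicator {h. 1 < norm h \<and> norm h \<le> 2} h * ennreal (norm h powr (b - DIM('a))) \<partial>(lborel :: 'a measure))"
proof -
  have "(\<integral>\<^sup>+h. indicator {h. c < norm h \<and> norm h \<le> 2 * c} h * ennreal (norm h powr (b - DIM('a))) \<partial>(lborel :: 'a measure))
    = ennreal (c ^ DIM('a)) * (\<integral>\<^sup>+h. indicator {h. c < norm h \<and> norm h \<le> 2 * c} (c *\<^sub>R h) * ennreal (norm (c *\<^sub>R h) powr (b - DIM('a))) \<partial>(lborel :: 'a measure))"
    using nn_integral_lborel_affine[of "\<lambda>h::'a. indicator {h. c < norm h \<and> norm h \<le> 2 * c} h * ennreal (norm h powr (b - DIM('a)))" c 0] c
    by simp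
  also have "(\<integral>\<^sup>+h. indicator {h. c < norm h \<and> norm h \<le> 2 * c} (c *\<^sub>R h) * ennreal (norm (c *\<^sub>R h) powr (b - DIM('a))) \<partial>(lborel :: 'a measure))
    = (\<integral>\<^sup>+h. ennreal (c powr (b - DIM('a))) * (indicator {h. 1 < norm h \<and> norm h \<le> 2} h * ennreal (norm h powr (b - DIM('a)))) \<partial>(lborel :: 'a measure))"
    by (intro nn_integral_cong) (use c in \<open>auto simp: indicator_def powr_mult ennreal_mult\<close>)
  also have "\<dots> = ennreal (c powr (b - DIM('a))) * (\<integral>\<^sup>+h. (indicator {h. 1 < norm h \<and> norm h \<le> 2} h * ennreal (norm h powr (b - DIM('a)))) \<partial>(lborel :: 'a measure))"
    by (rule nn_integral_cmult) simp
  also have "ennreal (c ^ DIM('a)) * \<dots> = (ennreal (c ^ DIM('a)) * ennreal (c powr (b - DIM('a)))) * (\<integral>\<^sup>+h. (indicator {h. 1 < norm h \<and> norm h \<le> 2} h * ennreal (norm h powr (b - DIM('a)))) \<partial>(lborel :: 'a measure))"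
    by (simp add: mult.assoc)
  also have "ennreal (c ^ DIM('a)) * ennreal (c powr (b - DIM('a))) = ennreal (c powr b)"
    using c by (simp add: ennreal_mult[symmetric] powr_realpow[symmetric] powr_add[symmetric])
  finally show ?thesis .
qed

lemma unit_shell_finite:
  fixes b :: real
  shows
  "(\<integral>\<^sup>+h. indicator {h. 1 < norm h \<and> norm h \<le> 2} h * ennreal (norm h powr (b - DIM('a))) \<partial>(lborel :: 'a::euclidean_space measure)) < \<infinity>"
proof -
  let ?M = "2 powr \<bar>b - DIM('a)\<bar>"
  have bound: "r powr (b - DIM('a)) \<le> ?M" if "1 < r" "r \<le> 2" for r :: real
  proof -
    have "r powr (b - DIM('a)) \<le> r powr \<bar>b - DIM('a)\<bar>" using that by (intro powr_mono) auto
    also have "\<dots> \<le> ?M" using that by (intro powr_mono2) auto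
    finally show ?thesis .
  qed
  have "(\<integral>\<^sup>+h. indicator {h. 1 < norm h \<and> norm h \<le> 2} h * ennreal (norm h powr (b - DIM('a))) \<partial>(lborel :: 'a measure))
     \<le> (\<integral>\<^sup>+h. ennreal ?M * indicator (cball 0 2) h \<partial>(lborel :: 'a measure))"
    by (intro nn_integral_mono) (auto simp: indicator_def intro!: ennreal_leI bound)
  also have "\<dots> = ennreal ?M * emeasure lborel (cball (0::'a) 2)"
    by (subst nn_integral_cmult_indicator) auto
  also have "\<dots> < \<infinity>" using emeasure_lborel_cball_finite[of "0::'a" 2] by (simp add: ennreal_mult_less_top)
  finally show ?thesis .
qed

text \<open>By scaling, each shell contributes a multiple \<open>c n powr b\<close> of the unit
  shell, so finiteness reduces to a numerical series. The shells may overlap.\<close>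

lemma shells_summable:
  fixes c :: "nat \<Rightarrow> real"
  assumes c: "\<And>n. c n > 0" and s: "summable (\<lambda>n. c n powr b)" 
    and S: "\<And>h::'a::euclidean_space. h \<in> S \<Longrightarrow> \<exists>n. c n < norm h \<and> norm h \<le> 2 * c n" and [measurable]: "S \<in> sets borel"
  shows "(\<integral>\<^sup>+h. indicator S h * ennreal (norm h powr (b - DIM('a))) \<partial>(lborel :: 'a measure)) < \<infinity>"
proof -
  let ?I = "(\<integral>\<^sup>+h. indicator {h. 1 < norm h \<and> norm h \<le> 2} h * ennreal (norm h powr (b - DIM('a))) \<partial>(lborel :: 'a measure))"
  let ?g = "\<lambda>n h. indicator {h. c n < norm h \<and> norm h \<le> 2 * c n} h * ennreal (norm h powr (b - DIM('a)))"
  have "(\<integral>\<^sup>+h. indicator S h * ennreal (norm h powr (b - DIM('a))) \<partial>(lborel :: 'a measure))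
    \<le> (\<integral>\<^sup>+h. (\<Sum>n. ?g n h) \<partial>(lborel :: 'a measure))"
  proof (intro nn_integral_mono)
    fix h :: 'a
    show "indicator S h * ennreal (norm h powr (b - DIM('a))) \<le> (\<Sum>n. ?g n h)"
    proof (cases "h \<in> S")
      case True
      then obtain n where n: "c n < norm h" "norm h \<le> 2 * c n" using S by blast
      define g where "g m = ?g m h" for m
      have "indicator S h * ennreal (norm h powr (b - DIM('a))) = g n" using n True by (simp add: g_def)
      also have "\<dots> = (\<Sum>m\<in>{n}. g m)" by simp
      also have "\<dots> \<le> (\<Sum>n. g n)" by (intro sum_le_suminf) auto
      also have "\<dots> = (\<Sum>n. ?g n h)" by (simp add: g_def)
      finally show ?thesis .
    qed auto
  qed
  also have "\<dots> = (\<Sum>n. \<integral>\<^sup>+h. ?g n h \<partial>(lborel :: 'a measure))"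
    by (rule nn_integral_suminf) simp
  also have "\<dots> = (\<Sum>n. ennreal (c n powr b) * ?I)"
    using shell_integral[where 'a='a, OF c] by simp
  also have "\<dots> = (\<Sum>n. ennreal (c n powr b)) * ?I" by simp
  also have "(\<Sum>n. ennreal (c n powr b)) = ennreal (\<Sum>n. c n powr b)"
    using s by (intro suminf_ennreal2) auto
  also have "\<dots> * ?I < \<infinity>" using unit_shell_finite[where 'a='a, of b] by (simp add: ennreal_mult_less_top)
  finally show ?thesis .
qed

lemma powr_dyadic: "(2 powr (- real n - j)) powr a = 2 powr (- j * a) * (2 powr (-a)) ^ n"
proof -
  have "(2 powr (-a)) ^ n = 2 powr (- a * real n)" by (simp add: powr_realpow[symmetric] powr_powr)
  moreover have "(- real n - j) * a = - j * a + - a * real n" by algebra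
  ultimately show ?thesis by (simp only: powr_powr powr_add)
qed

lemma near_kernel_finite:
  fixes a :: real
  assumes a: "a > 0"
  shows "(\<integral>\<^sup>+h. indicator (cball 0 1) h * ennreal (norm h powr (a - DIM('a))) \<partial>(lborel :: 'a::euclidean_space measure)) < \<infinity>"
proof -
  \<comment> \<open>The origin contributes nothing because \<open>0 powr x = 0\<close>; every other
    point of the ball lies in a dyadic shell.\<close>
  have eq: "(\<integral>\<^sup>+h. indicator (cball 0 1) h * ennreal (norm h powr (a - DIM('a))) \<partial>(lborel :: 'a::euclidean_space measure))
    = (\<integral>\<^sup>+h. indicator (cball 0 1 - {0}) h * ennreal (norm h powr (a - DIM('a))) \<partial>(lborel :: 'a::euclidean_space measure))"
    by (intro nn_integral_cong) (auto simp: indicator_def)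
  show ?thesis unfolding eq
  proof (rule shells_summable[where c="\<lambda>n. 2 powr (- real n - 1)"])
    show "summable (\<lambda>n. (2 powr (- real n - 1)) powr a)"
      unfolding powr_dyadic using a by (intro summable_mult summable_geometric) (simp add: powr_less_one)
    fix h :: 'a assume "h \<in> cball 0 1 - {0}"
    hence h: "0 < norm h" "norm h \<le> 1" by auto
    define n where "n = nat \<lfloor>- log 2 (norm h)\<rfloor>"
    have "log 2 (norm h) \<le> 0" using h by (simp add: log_le_zero_cancel_iff)
    hence n: "real n \<le> - log 2 (norm h)" "- log 2 (norm h) < real n + 1" unfolding n_def by linarith+
    have "2 powr (- real n - 1) < 2 powr (log 2 (norm h))" using n by (intro powr_less_mono) auto
    moreover have "2 powr (log 2 (norm h)) \<le> 2 powr (- real n)" using n by (intro powr_mono) auto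
    moreover have "2 * 2 powr (- real n - 1) = 2 powr (- real n)" by (simp add: powr_diff)
    moreover have "2 powr (log 2 (norm h)) = norm h" using h by (subst powr_log_cancel) auto
    ultimately show "\<exists>n. 2 powr (- real n - 1) < norm h \<and> norm h \<le> 2 * 2 powr (- real n - 1)"
      using h by (intro exI[of _ n]) simp
  qed auto
qed

lemma far_kernel_finite:
  fixes a :: real
  assumes a: "a > 0"
  shows "(\<integral>\<^sup>+h. indicator (- ball 0 1) h * ennreal (norm h powr (- a - DIM('a))) \<partial>(lborel :: 'a::euclidean_space measure)) < \<infinity>"
proof (rule shells_summable[where c="\<lambda>n. 2 powr (real n - 1)"])
  have "(2 powr (real n - 1)) powr - a = 2 powr a * (2 powr (-a)) ^ n" for n
  proof -
    have "(2 powr (-a)) ^ n = 2 powr (- a * real n)" by (simp add: powr_realpow[symmetric] powr_powr)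
    moreover have "(real n - 1) * - a = a + - a * real n" by algebra
    ultimately show ?thesis by (simp only: powr_powr powr_add)
  qed
  thus "summable (\<lambda>n. (2 powr (real n - 1)) powr - a)"
    using a by (auto intro!: summable_mult summable_geometric simp: powr_less_one)
  fix h :: 'a assume "h \<in> - ball 0 1"
  hence h: "1 \<le> norm h" by auto
  define n where "n = nat \<lceil>log 2 (norm h)\<rceil>"
  have "0 \<le> log 2 (norm h)" using h by (subst zero_le_log_cancel_iff) auto
  hence n: "real n \<ge> log 2 (norm h)" "log 2 (norm h) > real n - 1" unfolding n_def by linarith+
  have "2 powr (real n - 1) < 2 powr (log 2 (norm h))" using n by (intro powr_less_mono) auto
  moreover have "2 powr (log 2 (norm h)) \<le> 2 powr (real n)" using n by (intro powr_mono) auto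
  moreover have "2 * 2 powr (real n - 1) = 2 powr (real n)" by (simp add: powr_diff)
  moreover have "2 powr (log 2 (norm h)) = norm h" using h by (subst powr_log_cancel) auto
  ultimately show "\<exists>n. 2 powr (real n - 1) < norm h \<and> norm h \<le> 2 * 2 powr (real n - 1)"
    using h by (intro exI[of _ n]) simp
qed auto

section \<open>Square integrable functions\<close>

lemma L2_mult_integrable:
  fixes f g :: "'b \<Rightarrow> real"
  assumes [measurable]: "f \<in> borel_measurable M" "g \<in> borel_measurable M"
    and "integrable M (\<lambda>x. (f x)\<^sup>2)" "integrable M (\<lambda>x. (g x)\<^sup>2)"
  shows "integrable M (\<lambda>x. f x * g x)"
proof (rule Bochner_Integration.integrable_bound)
  show "integrable M (\<lambda>x. (f x)\<^sup>2 + (g x)\<^sup>2)" using assms by auto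
  show "AE x in M. norm (f x * g x) \<le> norm ((f x)\<^sup>2 + (g x)\<^sup>2)"
  proof (intro AE_I2)
    fix x
    have "\<bar>f x * g x\<bar> \<le> (f x)\<^sup>2 + (g x)\<^sup>2"
    proof -
      have "2 * \<bar>f x * g x\<bar> \<le> (f x)\<^sup>2 + (g x)\<^sup>2"
        using sum_squares_bound[of "\<bar>f x\<bar>" "\<bar>g x\<bar>"] by (simp add: abs_mult mult.assoc)
      thus ?thesis using abs_ge_zero[of "f x * g x"] by linarith
    qed
    thus "norm (f x * g x) \<le> norm ((f x)\<^sup>2 + (g x)\<^sup>2)" by simp
  qed
qed simp

lemma L2_add_integrable:
  fixes f g :: "'b \<Rightarrow> real"
  assumes [measurable]: "f \<in> borel_measurable M" "g \<in> borel_measurable M"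
    and "integrable M (\<lambda>x. (f x)\<^sup>2)" "integrable M (\<lambda>x. (g x)\<^sup>2)"
  shows "integrable M (\<lambda>x. (a * f x + b * g x)\<^sup>2)"
proof -
  have "integrable M (\<lambda>x. a\<^sup>2 * (f x)\<^sup>2 + b\<^sup>2 * (g x)\<^sup>2 + 2 * a * b * (f x * g x))"
    using assms L2_mult_integrable[OF assms] by auto
  thus ?thesis by (simp add: power2_eq_square algebra_simps)
qed

text \<open>The discriminant argument in isolation: it yields Cauchy-Schwarz, and later it turns
  near-minimality of the energy functional into a bound for its first variation.\<close>

lemma quadratic_discriminant:
  fixes a b c :: real
  assumes "\<And>t. 0 \<le> a - 2 * t * b + t\<^sup>2 * c" "0 \<le> a" "0 \<le> c"
  shows "\<bar>b\<bar> \<le> sqrt a * sqrt c"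
proof (cases "c = 0")
  case True
  \<comment> \<open>With \<open>c = 0\<close> the hypothesis is affine in t, and the chosen t would
    give it the value -1.\<close>
  have "b = 0"
  proof (rule ccontr)
    assume "b \<noteq> 0"
    with assms(1)[of "(a + 1) / (2 * b)"] True show False by simp
  qed
  thus ?thesis using assms by simp
next
  case False
  with assms have c: "c > 0" by simp
  have "0 \<le> a - b\<^sup>2 / c" using assms(1)[of "b / c"] c by (simp add: power2_eq_square field_simps)
  hence "b\<^sup>2 \<le> a * c" using c by (simp add: field_simps)
  hence "sqrt (b\<^sup>2) \<le> sqrt (a * c)" by (rule real_sqrt_le_mono)
  thus ?thesis by (simp add: real_sqrt_mult)
qed

lemma L2_Cauchy_Schwarz:
  fixes f g :: "'b \<Rightarrow> real"
  assumes [measurable]: "f \<in> borel_measurable M" "g \<in> borel_measurable M"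
    and i: "integrable M (\<lambda>x. (f x)\<^sup>2)" "integrable M (\<lambda>x. (g x)\<^sup>2)"
  shows "\<bar>\<integral>x. f x * g x \<partial>M\<bar> \<le> sqrt (\<integral>x. (f x)\<^sup>2 \<partial>M) * sqrt (\<integral>x. (g x)\<^sup>2 \<partial>M)"
proof (rule quadratic_discriminant)
  fix t
  have "0 \<le> (\<integral>x. (f x - t * g x)\<^sup>2 \<partial>M)" by (intro integral_nonneg_AE) auto
  also have "\<dots> = (\<integral>x. (f x)\<^sup>2 - 2 * t * (f x * g x) + t\<^sup>2 * (g x)\<^sup>2 \<partial>M)"
    by (simp add: power2_eq_square algebra_simps)
  also have "\<dots> = (\<integral>x. (f x)\<^sup>2 \<partial>M) - 2 * t * (\<integral>x. f x * g x \<partial>M) + t\<^sup>2 * (\<integral>x. (g x)\<^sup>2 \<partial>M)"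
    using i L2_mult_integrable[OF assms] by simp
  finally show "0 \<le> (\<integral>x. (f x)\<^sup>2 \<partial>M) - 2 * t * (\<integral>x. f x * g x \<partial>M) + t\<^sup>2 * (\<integral>x. (g x)\<^sup>2 \<partial>M)" .
qed auto

section \<open>The energy space\<close>

text \<open>The Gagliardo weight is split evenly over the two factors, so that the energy becomes an
  L^2 inner product on pairs of points. On the diagonal the value is 0.\<close>

definition gag :: "real \<Rightarrow> ('a::euclidean_space \<Rightarrow> real) \<Rightarrow> 'a \<times> 'a \<Rightarrow> real" where
  "gag s u = (\<lambda>(x, y). (u x - u y) / norm (x - y) powr (real DIM('a) / 2 + s))"

text \<open>The bilinear form of the fractional Laplacian without the factor
  \<open>frac_const N s / 2\<close>, which is restored only when weak solutions are translated
  back.\<close>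

definition energy :: "real \<Rightarrow> ('a::euclidean_space \<Rightarrow> real) \<Rightarrow> ('a \<Rightarrow> real) \<Rightarrow> real" where
  "energy s u v = (\<integral>z. gag s u z * gag s v z \<partial>(lborel \<Otimes>\<^sub>M lborel))"

text \<open>Borel representatives allow Fubini for \<open>lborel\<close>. Square integrability is
  not demanded, since \<open>faber_krahn\<close> supplies it on sets of finite measure;
  \<open>\<Omega> = UNIV\<close> makes room for differences of translates.\<close>

definition energy_space :: "'a::euclidean_space set \<Rightarrow> real \<Rightarrow> ('a \<Rightarrow> real) set" where
  "energy_space \<Omega> s = {u \<in> borel_measurable borel. (AE x in lborel. x \<notin> \<Omega> \<longrightarrow> u x = 0) \<and>
     integrable (lborel \<Otimes>\<^sub>M lborel) (\<lambda>z. (gag s u z)\<^sup>2)}"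

lemma measurable_gag[measurable]:
  assumes [measurable]: "u \<in> borel_measurable borel"
  shows "gag s u \<in> borel_measurable (lborel \<Otimes>\<^sub>M lborel)"
  unfolding gag_def by measurable

lemma gag_lincomb: "gag s (\<lambda>x. a * u x + b * v x) z = a * gag s u z + b * gag s v z"
  by (cases z) (simp add: gag_def add_divide_distrib[symmetric] algebra_simps)

lemma gag_mult:
  fixes x :: "'a::euclidean_space"
  shows "gag s u (x, y) * gag s v (x, y) = (u x - u y) * (v x - v y) / norm (x - y) powr (real DIM('a) + 2 * s)"
proof -
  have "norm (x - y) powr (real DIM('a) + 2 * s) = norm (x - y) powr (real DIM('a)/2 + s) * norm (x - y) powr (real DIM('a)/2 + s)"
    by (simp only: powr_add[symmetric]) simp
  thus ?thesis by (simp add: gag_def)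
qed

lemma energy_spaceD:
  assumes "u \<in> energy_space \<Omega> s"
  shows "u \<in> borel_measurable borel" "AE x in lborel. x \<notin> \<Omega> \<longrightarrow> u x = 0"
    "integrable (lborel \<Otimes>\<^sub>M lborel) (\<lambda>z. (gag s u z)\<^sup>2)"
  using assms by (auto simp: energy_space_def)

lemma energy_space_integrable:
  assumes "u \<in> energy_space \<Omega> s" "v \<in> energy_space \<Omega>' s"
  shows "integrable (lborel \<Otimes>\<^sub>M lborel) (\<lambda>z. gag s u z * gag s v z)"
  using assms by (intro L2_mult_integrable measurable_gag) (auto dest: energy_spaceD)

lemma energy_space_lincomb:
  assumes u: "u \<in> energy_space \<Omega> s" and v: "v \<in> energy_space \<Omega> s"
  shows "(\<lambda>x. a * u x + b * v x) \<in> energy_space \<Omega> s"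
proof -
  note [measurable] = energy_spaceD(1)[OF u] energy_spaceD(1)[OF v]
  have "integrable (lborel \<Otimes>\<^sub>M lborel) (\<lambda>z. (a * gag s u z + b * gag s v z)\<^sup>2)"
    using u v by (intro L2_add_integrable) (auto dest: energy_spaceD)
  moreover have "AE x in lborel. x \<notin> \<Omega> \<longrightarrow> a * u x + b * v x = 0"
    using energy_spaceD(2)[OF u] energy_spaceD(2)[OF v] by eventually_elim auto
  ultimately show ?thesis by (simp add: energy_space_def gag_lincomb)
qed

lemma energy_commute: "energy s u v = energy s v u"
  by (simp add: energy_def mult.commute)

lemma energy_nonneg: "0 \<le> energy s u u"
  unfolding energy_def by (intro integral_nonneg_AE) auto

lemma energy_lincomb:
  assumes "u \<in> energy_space \<Omega> s" "v \<in> energy_space \<Omega>' s" "w \<in> energy_space \<Omega>'' s"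
  shows "energy s (\<lambda>x. a * u x + b * v x) w = a * energy s u w + b * energy s v w"
proof -
  have "energy s (\<lambda>x. a * u x + b * v x) w
     = (\<integral>z. a * (gag s u z * gag s w z) + b * (gag s v z * gag s w z) \<partial>(lborel \<Otimes>\<^sub>M lborel))"
    by (simp add: energy_def gag_lincomb algebra_simps)
  also have "\<dots> = a * energy s u w + b * energy s v w"
    using energy_space_integrable[OF assms(1,3)] energy_space_integrable[OF assms(2,3)] by (simp add: energy_def)
  finally show ?thesis .
qed

lemma energy_Cauchy_Schwarz:
  assumes "u \<in> energy_space \<Omega> s" "v \<in> energy_space \<Omega>' s"
  shows "\<bar>energy s u v\<bar> \<le> sqrt (energy s u u) * sqrt (energy s v v)"
proof -
  note [measurable] = energy_spaceD(1)[OF assms(1)] energy_spaceD(1)[OF assms(2)]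
  show ?thesis
    using L2_Cauchy_Schwarz[of "gag s u" "lborel \<Otimes>\<^sub>M lborel" "gag s v"]
      energy_spaceD(3)[OF assms(1)] energy_spaceD(3)[OF assms(2)]
    by (simp add: energy_def power2_eq_square)
qed

text \<open>A contraction of u has a smaller Gagliardo integrand. The sets outside which u and v
  vanish may differ, as happens for truncations at a positive level.\<close>

lemma energy_space_bound:
  assumes u: "u \<in> energy_space \<Omega>' s" and v[measurable]: "v \<in> borel_measurable borel"
    and "AE x in lborel. x \<notin> \<Omega> \<longrightarrow> v x = 0" and le: "\<And>x y. \<bar>v x - v y\<bar> \<le> \<bar>u x - u y\<bar>"
  shows "v \<in> energy_space \<Omega> s"
proof -
  note [measurable] = energy_spaceD(1)[OF u]
  have "integrable (lborel \<Otimes>\<^sub>M lborel) (\<lambda>z. (gag s v z)\<^sup>2)"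
  proof (rule Bochner_Integration.integrable_bound[OF energy_spaceD(3)[OF u]])
    show "AE z in lborel \<Otimes>\<^sub>M lborel. norm ((gag s v z)\<^sup>2) \<le> norm ((gag s u z)\<^sup>2)"
    proof (intro AE_I2)
      fix z :: "'a \<times> 'a"
      have "\<bar>gag s v z\<bar> \<le> \<bar>gag s u z\<bar>"
        by (cases z) (simp add: gag_def abs_divide divide_right_mono le)
      thus "norm ((gag s v z)\<^sup>2) \<le> norm ((gag s u z)\<^sup>2)" by (simp add: abs_le_square_iff)
    qed
  qed simp
  thus ?thesis using assms by (simp add: energy_space_def)
qed

text \<open>The positive part is monotone and 1-Lipschitz, so its increment has the sign of
  \<open>a - b\<close> and is no larger in absolute value.\<close>

lemma pos_part_square_le:
  fixes a b :: real
  shows "(max 0 a - max 0 b)\<^sup>2 \<le> (a - b) * (max 0 a - max 0 b)"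
proof (cases "a \<le> 0"; cases "b \<le> 0")
  assume "a \<le> 0" "\<not> b \<le> 0"
  thus ?thesis using mult_right_mono[of b "b - a" b] by (simp add: max_def power2_eq_square algebra_simps)
next
  assume "\<not> a \<le> 0" "b \<le> 0"
  thus ?thesis using mult_right_mono[of a "a - b" a] by (simp add: max_def power2_eq_square algebra_simps)
qed (auto simp: max_def power2_eq_square)

lemma gag_trunc_le:
  "(gag s (\<lambda>x. max 0 (w x - k)) z)\<^sup>2 \<le> gag s w z * gag s (\<lambda>x. max 0 (w x - k)) z"
proof (cases z)
  case (Pair x y)
  have "(max 0 (w x - k) - max 0 (w y - k))\<^sup>2 \<le> (w x - w y) * (max 0 (w x - k) - max 0 (w y - k))"
    using pos_part_square_le[of "w x - k" "w y - k"] by simp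
  thus ?thesis unfolding Pair power2_eq_square[of "gag s _ _"] gag_mult
    by (intro divide_right_mono) (simp_all add: power2_eq_square)
qed

lemma energy_trunc_le:
  assumes "w \<in> energy_space \<Omega> s" "(\<lambda>x. max 0 (w x - k)) \<in> energy_space \<Omega>' s"
  shows "energy s (\<lambda>x. max 0 (w x - k)) (\<lambda>x. max 0 (w x - k)) \<le> energy s w (\<lambda>x. max 0 (w x - k))"
  unfolding energy_def
  using gag_trunc_le[of s w k]
  by (intro integral_mono energy_space_integrable[OF assms(1,2)] energy_space_integrable[OF assms(2,2)])
     (simp add: power2_eq_square)

section \<open>A Faber-Krahn inequality\<close>

text \<open>A ball about x with twice the measure of A has at least the measure of A outside A, and
  on that ball the kernel is at least its value at the radius. No position of x relative to A is
  assumed.\<close>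

lemma exterior_kernel_lower_bound:
  fixes A :: "'a::euclidean_space set" and s :: real
  defines "N \<equiv> real DIM('a)"
  assumes [measurable]: "A \<in> sets borel" and fin: "emeasure lborel A < \<infinity>" and pos: "measure lborel A > 0" and s: "s > 0"
  defines "V \<equiv> measure lborel (ball (0::'a) 1)"
  shows "ennreal ((2 / V) powr (- 1 - 2 * s / N) * measure lborel A powr (- (2 * s / N)))
    \<le> (\<integral>\<^sup>+y. indicator (- A) y * ennreal (1 / norm (x - y) powr (N + 2 * s)) \<partial>lborel)"
proof -
  have N: "N > 0" by (simp add: N_def)
  have V: "V > 0" unfolding V_def by (intro content_ball_pos) simp
  define a where "a = measure lborel A"
  have a: "a > 0" using pos by (simp add: a_def)
  \<comment> \<open>The radius at which a ball has measure \<open>2 * a\<close>.\<close>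
  define r where "r = (2 * a / V) powr (1 / N)"
  have r: "r > 0" using a V by (simp add: r_def)
  have "r ^ DIM('a) = r powr N" using r by (simp add: N_def powr_realpow)
  hence rN: "r ^ DIM('a) = 2 * a / V" using a V N by (simp add: r_def powr_powr)
  have mb: "measure lborel (ball x r) = 2 * a"
    using content_ball_conv_unit_ball[of r x] r rN V by (simp add: V_def)
  \<comment> \<open>The centre is removed because there the quotient \<open>1 / 0\<close> has the
    value 0, which spoils the lower bound of the kernel.\<close>
  let ?S = "ball x r - {x} - A"
  have "emeasure lborel (ball x r) \<le> emeasure lborel (?S \<union> {x} \<union> A)" by (intro emeasure_mono) auto
  also have "\<dots> \<le> emeasure lborel ?S + emeasure lborel {x} + emeasure lborel A"
    by (intro order_trans[OF emeasure_subadditive] add_mono) auto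
  also have "\<dots> = emeasure lborel ?S + ennreal a"
    using fin by (simp add: a_def emeasure_eq_ennreal_measure)
  finally have 1: "ennreal (2 * a) \<le> emeasure lborel ?S + ennreal a"
    using mb emeasure_lborel_ball_finite[of x r] by (simp add: emeasure_eq_ennreal_measure)
  have 2: "ennreal a \<le> emeasure lborel ?S"
  proof -
    have "emeasure lborel ?S \<le> emeasure lborel (ball x r)" by (intro emeasure_mono) auto
    hence "emeasure lborel ?S < \<infinity>" using emeasure_lborel_ball_finite[of x r] by (auto simp: top.not_eq_extremum)
    hence e: "emeasure lborel ?S = ennreal (measure lborel ?S)" by (simp add: emeasure_eq_ennreal_measure)
    have "ennreal (2 * a) \<le> ennreal (measure lborel ?S + a)" using 1 a unfolding e by (simp add: ennreal_plus)
    hence "2 * a \<le> measure lborel ?S + a" using a by (subst (asm) ennreal_le_iff) auto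
    thus ?thesis unfolding e by (intro ennreal_leI) simp
  qed
  have "(2 / V) powr (- 1 - 2 * s / N) * a powr (- (2 * s / N)) = a * r powr (- (N + 2 * s))"
  proof -
    have "r powr (- (N + 2 * s)) = (2 * a / V) powr (- 1 - 2 * s / N)"
      using N by (simp add: r_def powr_powr field_simps)
    also have "\<dots> = (2 / V) powr (- 1 - 2 * s / N) * a powr (- 1 - 2 * s / N)"
      using a V by (simp add: powr_mult[symmetric])
    finally have "a * r powr (- (N + 2 * s)) = (2 / V) powr (- 1 - 2 * s / N) * (a powr 1 * a powr (- 1 - 2 * s / N))"
      using a by simp
    also have "a powr 1 * a powr (- 1 - 2 * s / N) = a powr (- (2 * s / N))"
      by (simp only: powr_add[symmetric]) simp
    finally show ?thesis by simp
  qed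
  hence "ennreal ((2 / V) powr (- 1 - 2 * s / N) * a powr (- (2 * s / N))) = ennreal (r powr (- (N + 2 * s))) * ennreal a"
    using a by (simp add: ennreal_mult'[symmetric] mult.commute)
  also have "\<dots> \<le> ennreal (r powr (- (N + 2 * s))) * emeasure lborel ?S"
    using 2 by (rule mult_left_mono) simp
  also have "\<dots> = (\<integral>\<^sup>+y. ennreal (r powr (- (N + 2 * s))) * indicator ?S y \<partial>lborel)"
    by (subst nn_integral_cmult_indicator) auto
  also have "\<dots> \<le> (\<integral>\<^sup>+y. indicator (- A) y * ennreal (1 / norm (x - y) powr (N + 2 * s)) \<partial>lborel)"
  proof (intro nn_integral_mono)
    fix y
    have "r powr (- (N + 2 * s)) \<le> 1 / norm (x - y) powr (N + 2 * s)" if "y \<in> ?S"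
    proof -
      have "r powr (- (N + 2 * s)) \<le> norm (x - y) powr (- (N + 2 * s))"
        using that N s by (intro powr_mono2') (auto simp: dist_norm)
      thus ?thesis by (simp only: powr_minus_divide)
    qed
    thus "ennreal (r powr (- (N + 2 * s))) * indicator ?S y \<le> indicator (- A) y * ennreal (1 / norm (x - y) powr (N + 2 * s))"
      by (auto simp: indicator_def intro!: ennreal_leI)
  qed
  finally show ?thesis by (simp add: a_def)
qed

text \<open>The reciprocal of the dimensional constant in
  \<open>exterior_kernel_lower_bound\<close>.\<close>

definition faber_krahn_const :: "'a::euclidean_space itself \<Rightarrow> real \<Rightarrow> real" where
  "faber_krahn_const _ s = (2 / measure lborel (ball (0::'a) 1)) powr (1 + 2 * s / real DIM('a))"

lemma faber_krahn_const_pos: "faber_krahn_const TYPE('a::euclidean_space) s > 0"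
  using content_ball_pos[of 1 "0::'a"] by (simp add: faber_krahn_const_def)

text \<open>For y outside A the Gagliardo integrand equals \<open>(u x)\<^sup>2\<close> times the
  kernel, because u vanishes at y. Integrating over these y alone already produces the kernel
  integral bounded from below above. The same inequality between extended integrals gives the square
  integrability.\<close>

lemma faber_krahn:
  fixes u :: "'a::euclidean_space \<Rightarrow> real"
  assumes u: "u \<in> energy_space \<Omega> s" and s: "s > 0"
    and A[measurable]: "A \<in> sets borel" and fin: "emeasure lborel A < \<infinity>"
    and z: "AE x in lborel. x \<notin> A \<longrightarrow> u x = 0"
  shows "integrable lborel (\<lambda>x. (u x)\<^sup>2)"
    and "(\<integral>x. (u x)\<^sup>2 \<partial>lborel) \<le> faber_krahn_const TYPE('a) s * measure lborel A powr (2 * s / real DIM('a)) * energy s u u"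
proof -
  note [measurable] = energy_spaceD(1)[OF u]
  have "integrable lborel (\<lambda>x. (u x)\<^sup>2) \<and> (\<integral>x. (u x)\<^sup>2 \<partial>lborel) \<le> faber_krahn_const TYPE('a) s * measure lborel A powr (2 * s / real DIM('a)) * energy s u u"
  proof (cases "measure lborel A = 0")
    \<comment> \<open>The kernel estimate needs positive measure; on a null set u vanishes almost
      everywhere.\<close>
    case True
    hence "emeasure lborel A = 0" using fin by (simp add: emeasure_eq_ennreal_measure)
    hence "AE x in lborel. x \<notin> A" by (intro AE_not_in) (auto simp: null_sets_def)
    hence "AE x in lborel. (u x)\<^sup>2 = 0" using z by eventually_elim auto
    hence "integrable lborel (\<lambda>x. (u x)\<^sup>2) \<longleftrightarrow> integrable lborel (\<lambda>x::'a. 0 :: real)" 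
      "(\<integral>x. (u x)\<^sup>2 \<partial>lborel) = (\<integral>x. 0 \<partial>(lborel :: 'a measure))"
      by (intro integrable_cong_AE integral_cong_AE; simp)+
    thus ?thesis using True by simp
  next
    case False
    hence pos: "measure lborel A > 0" by (simp add: zero_less_measure_iff)
    define c where "c = inverse (faber_krahn_const TYPE('a) s * measure lborel A powr (2 * s / real DIM('a)))"
    have c: "c > 0" using faber_krahn_const_pos[where 'a='a, of s] pos by (simp add: c_def)
    have c_eq: "(2 / measure lborel (ball (0::'a) 1)) powr (- 1 - 2 * s / real DIM('a)) * measure lborel A powr (- (2 * s / real DIM('a))) = c"
      by (simp add: c_def faber_krahn_const_def powr_minus[symmetric] algebra_simps)
    have "ennreal c * (\<integral>\<^sup>+x. ennreal ((u x)\<^sup>2) \<partial>lborel) = (\<integral>\<^sup>+x. ennreal ((u x)\<^sup>2) * ennreal c \<partial>lborel)"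
      by (subst nn_integral_cmult[symmetric]) (auto simp: mult.commute)
    also have "\<dots> \<le> (\<integral>\<^sup>+x. ennreal ((u x)\<^sup>2) * (\<integral>\<^sup>+y. indicator (- A) y * ennreal (1 / norm (x - y) powr (real DIM('a) + 2 * s)) \<partial>lborel) \<partial>lborel)"
      using exterior_kernel_lower_bound[OF A fin pos s] unfolding c_eq
      by (intro nn_integral_mono mult_left_mono) auto
    also have "\<dots> = (\<integral>\<^sup>+x. (\<integral>\<^sup>+y. ennreal ((u x)\<^sup>2) * (indicator (- A) y * ennreal (1 / norm (x - y) powr (real DIM('a) + 2 * s))) \<partial>lborel) \<partial>lborel)"
      by (subst nn_integral_cmult) auto
    also have "\<dots> \<le> (\<integral>\<^sup>+x. (\<integral>\<^sup>+y. ennreal ((gag s u (x, y))\<^sup>2) \<partial>lborel) \<partial>lborel)"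
    proof (rule nn_integral_mono, rule nn_integral_mono_AE)
      fix x
      show "AE y in lborel. ennreal ((u x)\<^sup>2) * (indicator (- A) y * ennreal (1 / norm (x - y) powr (real DIM('a) + 2 * s))) \<le> ennreal ((gag s u (x, y))\<^sup>2)"
        using z by eventually_elim (auto simp: indicator_def power2_eq_square gag_mult ennreal_mult'[symmetric])
    qed
    also have "\<dots> = (\<integral>\<^sup>+z. ennreal ((gag s u z)\<^sup>2) \<partial>(lborel \<Otimes>\<^sub>M lborel))"
      by (subst lborel.nn_integral_fst[symmetric]) auto
    also have "\<dots> = ennreal (energy s u u)"
      unfolding energy_def using energy_spaceD(3)[OF u] by (subst nn_integral_eq_integral) (auto simp: power2_eq_square)
    finally have *: "ennreal c * (\<integral>\<^sup>+x. ennreal ((u x)\<^sup>2) \<partial>lborel) \<le> ennreal (energy s u u)" .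
    hence "ennreal c * (\<integral>\<^sup>+x. ennreal ((u x)\<^sup>2) \<partial>lborel) < \<infinity>" by (rule order_le_less_trans) simp
    hence f: "(\<integral>\<^sup>+x. ennreal ((u x)\<^sup>2) \<partial>lborel) < \<infinity>" using c by (auto simp: ennreal_mult_less_top)
    hence int: "integrable lborel (\<lambda>x. (u x)\<^sup>2)" by (intro integrableI_nonneg) auto
    have "ennreal (c * (\<integral>x. (u x)\<^sup>2 \<partial>lborel)) \<le> ennreal (energy s u u)"
      using * c int by (simp add: nn_integral_eq_integral ennreal_mult')
    hence "c * (\<integral>x. (u x)\<^sup>2 \<partial>lborel) \<le> energy s u u" by (simp add: energy_nonneg)
    hence "(\<integral>x. (u x)\<^sup>2 \<partial>lborel) \<le> inverse c * energy s u u" using c by (simp add: field_simps)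
    thus ?thesis using int by (simp add: c_def)
  qed
  thus "integrable lborel (\<lambda>x. (u x)\<^sup>2)"
    and "(\<integral>x. (u x)\<^sup>2 \<partial>lborel) \<le> faber_krahn_const TYPE('a) s * measure lborel A powr (2 * s / real DIM('a)) * energy s u u" by auto
qed

section \<open>Stampacchia truncation\<close>

text \<open>Along the levels \<open>k0 + d * (1 - (1/2)^n)\<close> the values of a decay
  geometrically: the superlinear exponent \<beta> outweighs the factor 4 that each halving of the
  gap costs. All levels stay below \<open>k0 + d\<close>, where a must therefore vanish.\<close>

lemma stampacchia_iteration:
  fixes a :: "real \<Rightarrow> real"
  assumes nonneg: "\<And>k. 0 \<le> a k" and mono: "\<And>h k. k0 \<le> k \<Longrightarrow> k \<le> h \<Longrightarrow> a h \<le> a k"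
    and step: "\<And>h k. k0 \<le> k \<Longrightarrow> k < h \<Longrightarrow> (h - k)\<^sup>2 * a h \<le> M * a k powr \<beta>"
    and M: "M > 0" and \<beta>: "\<beta> > 1"
  shows "a (k0 + sqrt M * a k0 powr ((\<beta> - 1) / 2) * 2 powr (\<beta> / (\<beta> - 1))) = 0"
proof (cases "a k0 = 0")
  case True thus ?thesis by simp
next
  case False
  define a0 where "a0 = a k0"
  have a0: "a0 > 0" using False nonneg[of k0] by (simp add: a0_def)
  \<comment> \<open>The ratio \<open>q\<close> solves \<open>q powr (\<beta> - 1) = 1/4\<close>,
    which cancels the loss from halving the gap; \<open>d\<close> then solves
    \<open>d\<^sup>2 * q = 4 * M * a0 powr (\<beta> - 1)\<close>, which closes the
    induction.\<close>
  define d where "d = sqrt M * a0 powr ((\<beta> - 1) / 2) * 2 powr (\<beta> / (\<beta> - 1))"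
  have d: "d > 0" using M a0 by (simp add: d_def)
  define q where "q = 2 powr (- 2 / (\<beta> - 1))"
  have q: "q > 0" "q < 1" using \<beta> by (auto simp: q_def powr_less_one divide_neg_pos)
  have q1: "q powr (\<beta> - 1) = 1 / 4" 
  proof -
    have "- 2 / c * c = - 2" if "c \<noteq> 0" for c :: real using that by simp
    from this[of "\<beta> - 1"] have "- 2 / (\<beta> - 1) * (\<beta> - 1) = - 2" using \<beta> by simp
    thus ?thesis unfolding q_def powr_powr by (simp only:) (simp add: powr_minus)
  qed
  have d2: "d\<^sup>2 * q = 4 * M * a0 powr (\<beta> - 1)"
  proof -
    have "(2 powr (\<beta> / (\<beta> - 1)))\<^sup>2 * q = 2 powr (2 * (\<beta> / (\<beta> - 1)) + (- 2 / (\<beta> - 1)))"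
      unfolding q_def powr_add by (simp add: powr_power mult.commute)
    also have "2 * (\<beta> / (\<beta> - 1)) + (- 2 / (\<beta> - 1)) = 2"
    proof -
      have "2 * (\<beta> / (\<beta> - 1)) + (- 2 / (\<beta> - 1)) = 2 * ((\<beta> - 1) / (\<beta> - 1))"
        by (simp only: diff_divide_distrib) simp
      thus ?thesis using \<beta> by simp
    qed
    finally have "(2 powr (\<beta> / (\<beta> - 1)))\<^sup>2 * q = 4" by simp
    moreover have "(a0 powr ((\<beta> - 1) / 2))\<^sup>2 = a0 powr (\<beta> - 1)"
      by (simp only: power2_eq_square powr_add[symmetric] field_sum_of_halves)
    ultimately show ?thesis using M by (simp add: d_def power_mult_distrib)
  qed
  define kn where "kn n = k0 + d * (1 - (1/2)^n)" for n :: nat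
  have kn0: "k0 \<le> kn n" for n using d by (simp add: kn_def power_le_one)
  have main: "a (kn n) \<le> a0 * q ^ n" for n
  proof (induction n)
    case 0 thus ?case by (simp add: kn_def a0_def)
  next
    case (Suc n)
    have diff: "kn (Suc n) - kn n = d * (1/2) ^ Suc n" by (simp add: kn_def algebra_simps)
    have "(d * (1/2) ^ Suc n)\<^sup>2 * a (kn (Suc n)) \<le> M * a (kn n) powr \<beta>"
    proof -
      have "0 < d * (1/2) ^ Suc n" using d by simp
      hence "kn n < kn (Suc n)" using diff by linarith
      from step[OF kn0 this] show ?thesis unfolding diff .
    qed
    also have "\<dots> \<le> M * (a0 * q ^ n) powr \<beta>"
      using Suc M \<beta> nonneg by (intro mult_left_mono powr_mono2) auto
    also have "(a0 * q ^ n) powr \<beta> = (a0 * q ^ n) * (a0 powr (\<beta> - 1) * (q powr (\<beta> - 1)) ^ n)"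
    proof -
      have "(a0 * q ^ n) powr \<beta> = (a0 * q ^ n) powr (1 + (\<beta> - 1))" by simp
      also have "\<dots> = (a0 * q ^ n) * (a0 * q ^ n) powr (\<beta> - 1)" unfolding powr_add using a0 q by simp
      also have "(a0 * q ^ n) powr (\<beta> - 1) = a0 powr (\<beta> - 1) * (q powr (\<beta> - 1)) ^ n"
        using a0 q by (simp add: powr_mult powr_realpow[symmetric] powr_powr mult.commute)
      finally show ?thesis .
    qed
    also have "M * \<dots> = (a0 * q ^ n) * (d\<^sup>2 * q / 4) * (1/4) ^ n" unfolding q1 d2 using M by simp
    finally have "(d * (1/2) ^ Suc n)\<^sup>2 * a (kn (Suc n)) \<le> (a0 * q ^ n) * (d\<^sup>2 * q / 4) * (1/4) ^ n" .
    moreover have "(d * (1/2) ^ Suc n)\<^sup>2 = d\<^sup>2 * (1/4) ^ Suc n"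
    proof -
      have "((1/2::real) ^ Suc n)\<^sup>2 = ((1/2)\<^sup>2) ^ Suc n" by (simp only: power_mult[symmetric] mult.commute)
      thus ?thesis by (simp add: power_mult_distrib power2_eq_square)
    qed
    ultimately have "(d\<^sup>2 * (1/4) ^ Suc n) * a (kn (Suc n)) \<le> (a0 * q ^ n) * (d\<^sup>2 * q / 4) * (1/4) ^ n" by (simp only:)
    also have "\<dots> = (d\<^sup>2 * (1/4) ^ Suc n) * (a0 * q ^ Suc n)" by simp
    finally have "(d\<^sup>2 * (1/4) ^ Suc n) * a (kn (Suc n)) \<le> (d\<^sup>2 * (1/4) ^ Suc n) * (a0 * q ^ Suc n)" .
    thus ?case using d by (subst (asm) mult_le_cancel_left_pos) auto
  qed
  have "a (k0 + d) \<le> a0 * q ^ n" for n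
    using mono[of "kn n" "k0 + d"] kn0[of n] main[of n] d by (force simp: kn_def)
  moreover have "(\<lambda>n. a0 * q ^ n) \<longlonglongrightarrow> a0 * 0"
    using q by (intro tendsto_intros LIMSEQ_power_zero) auto
  ultimately have "a (k0 + d) \<le> 0" by (intro LIMSEQ_le_const) auto
  thus ?thesis using nonneg[of "k0 + d"] by (simp add: d_def a0_def)
qed

text \<open>Dividing the energy hypothesis by the root of the energy bounds the energy of the
  truncation by \<open>B\<^sup>2\<close> times the power 2\<gamma> of the superlevel measure;
  Faber-Krahn adds the power 2s/N. The total exceeds 1 by the assumption on \<gamma>.
  \<open>D\<close> depends neither on w nor on the level or B.\<close>

lemma stampacchia_bound:
  fixes \<Omega> :: "'a::euclidean_space set" and s \<gamma> :: real
  assumes [measurable]: "\<Omega> \<in> sets borel" and fin: "emeasure lborel \<Omega> < \<infinity>" and s: "s > 0"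
    and \<gamma>: "\<gamma> > 1/2 - s / real DIM('a)"
  obtains D where "D > 0" "\<And>w k0 B. w \<in> borel_measurable borel \<Longrightarrow> B > 0 \<Longrightarrow> AE x in lborel. x \<notin> \<Omega> \<longrightarrow> w x \<le> k0 \<Longrightarrow>
     (\<And>k. k \<ge> k0 \<Longrightarrow> (\<lambda>x. max 0 (w x - k)) \<in> energy_space \<Omega> s) \<Longrightarrow>
     (\<And>k. k \<ge> k0 \<Longrightarrow> energy s (\<lambda>x. max 0 (w x - k)) (\<lambda>x. max 0 (w x - k))
         \<le> B * measure lborel {x \<in> \<Omega>. w x > k} powr \<gamma> * sqrt (energy s (\<lambda>x. max 0 (w x - k)) (\<lambda>x. max 0 (w x - k)))) \<Longrightarrow>
     AE x in lborel. w x \<le> k0 + D * B"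
proof -
  define N where "N = real DIM('a)"
  define \<beta> where "\<beta> = 2 * \<gamma> + 2 * s / N"
  have N: "N > 0" by (simp add: N_def)
  have \<beta>: "\<beta> > 1" using \<gamma> unfolding \<beta>_def N_def by argo
  let ?V = "measure lborel \<Omega>"
  \<comment> \<open>Adding 1 to the measure keeps \<open>D\<close> positive even if \<Omega> is a
    null set.\<close>
  define D where "D = sqrt (faber_krahn_const TYPE('a) s) * (?V + 1) powr ((\<beta> - 1) / 2) * 2 powr (\<beta> / (\<beta> - 1))"
  have "?V + 1 > 0" using measure_nonneg[of lborel \<Omega>] by linarith
  hence "(?V + 1) powr ((\<beta> - 1) / 2) > 0" by simp
  hence D: "D > 0" using faber_krahn_const_pos[where 'a='a, of s] unfolding D_def by (intro mult_pos_pos) simp_all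
  show thesis
  proof (rule that[OF D])
    fix w k0 B
    assume w[measurable]: "w \<in> borel_measurable borel" and B: "B > 0" and off: "AE x in lborel. x \<notin> \<Omega> \<longrightarrow> w x \<le> k0"
      and mem: "\<And>k. k \<ge> k0 \<Longrightarrow> (\<lambda>x. max 0 (w x - k)) \<in> energy_space \<Omega> s"
      and en: "\<And>k. k \<ge> k0 \<Longrightarrow> energy s (\<lambda>x. max 0 (w x - k)) (\<lambda>x. max 0 (w x - k))
         \<le> B * measure lborel {x \<in> \<Omega>. w x > k} powr \<gamma> * sqrt (energy s (\<lambda>x. max 0 (w x - k)) (\<lambda>x. max 0 (w x - k)))"
    define A where "A k = {x \<in> \<Omega>. w x > k}" for k
    have [measurable]: "A k \<in> sets borel" for k unfolding A_def by measurable
    define a where "a k = measure lborel (A k)" for k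
    have Afin: "emeasure lborel (A k) < \<infinity>" for k
      using fin emeasure_mono[of "A k" \<Omega> lborel] by (auto simp: A_def intro: order_le_less_trans)
    have amono: "a h \<le> a k" if "A h \<subseteq> A k" for h k
      unfolding a_def using Afin that by (intro measure_mono_fmeasurable) (auto simp: fmeasurable_def)
    have aV: "a k \<le> ?V" for k
      unfolding a_def using fin by (intro measure_mono_fmeasurable) (auto simp: fmeasurable_def A_def)
    define M where "M = faber_krahn_const TYPE('a) s * B\<^sup>2"
    have M: "M > 0" using faber_krahn_const_pos[where 'a='a, of s] B by (simp add: M_def)
    have step: "(h - k)\<^sup>2 * a h \<le> M * a k powr \<beta>" if k: "k0 \<le> k" "k < h" for h k
    proof -
      let ?\<phi> = "\<lambda>x. max 0 (w x - k)"
      let ?E = "energy s ?\<phi> ?\<phi>"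
      have phi0: "AE x in lborel. x \<notin> A k \<longrightarrow> ?\<phi> x = 0"
        using off by eventually_elim (use k in \<open>auto simp: A_def\<close>)
      note fk = faber_krahn[OF mem[OF k(1)] s _ Afin phi0]
      have Ebound: "?E \<le> B\<^sup>2 * a k powr (2 * \<gamma>)"
      proof (cases "?E = 0")
        case False
        hence "?E > 0" using energy_nonneg[of s ?\<phi>] by linarith
        hence "sqrt ?E * sqrt ?E \<le> (B * a k powr \<gamma>) * sqrt ?E" and p: "sqrt ?E > 0"
          using en[OF k(1)] by (auto simp: a_def A_def)
        hence "sqrt ?E \<le> B * a k powr \<gamma>" by (subst (asm) mult_le_cancel_right_pos)
        hence "(sqrt ?E)\<^sup>2 \<le> (B * a k powr \<gamma>)\<^sup>2" using p by (intro power_mono) auto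
        thus ?thesis using \<open>?E > 0\<close>
          by (simp only: power_mult_distrib mult_2 powr_add power2_eq_square[of "_ powr _"]) simp
      qed (simp add: B)
      \<comment> \<open>Chebyshev: on \<open>A h\<close> the truncation at level k is at least
        \<open>h - k\<close>.\<close>
      have "(h - k)\<^sup>2 * a h = (\<integral>x. (h - k)\<^sup>2 * indicator (A h) x \<partial>lborel)"
        using Afin[of h] by (simp add: a_def)
      also have "\<dots> \<le> (\<integral>x. (?\<phi> x)\<^sup>2 \<partial>lborel)"
      proof (rule integral_mono)
        show "integrable lborel (\<lambda>x. (h - k)\<^sup>2 * indicat_real (A h) x)" using Afin[of h] by simp
        show "integrable lborel (\<lambda>x. (?\<phi> x)\<^sup>2)" by (rule fk(1)) simp
        fix x show "(h - k)\<^sup>2 * indicat_real (A h) x \<le> (?\<phi> x)\<^sup>2"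
          using k by (auto simp: indicator_def A_def max_def intro!: power_mono)
      qed
      also have "\<dots> \<le> faber_krahn_const TYPE('a) s * a k powr (2 * s / N) * ?E"
        using fk(2) by (simp add: a_def N_def)
      also have "\<dots> \<le> faber_krahn_const TYPE('a) s * a k powr (2 * s / N) * (B\<^sup>2 * a k powr (2 * \<gamma>))"
        using faber_krahn_const_pos[where 'a='a, of s] Ebound by (intro mult_left_mono) auto
      also have "\<dots> = M * a k powr \<beta>" by (simp add: M_def \<beta>_def powr_add)
      finally show ?thesis .
    qed
    have a0: "a (k0 + sqrt M * a k0 powr ((\<beta> - 1) / 2) * 2 powr (\<beta> / (\<beta> - 1))) = 0" (is "a ?k = 0")
      by (rule stampacchia_iteration[OF _ _ step M \<beta>]) (auto simp: a_def[symmetric] intro!: amono, auto simp: a_def A_def)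
    have "?k \<le> k0 + D * B"
    proof -
      have "sqrt M = sqrt (faber_krahn_const TYPE('a) s) * B" using B by (simp add: M_def real_sqrt_mult)
      moreover have "a k0 powr ((\<beta> - 1) / 2) \<le> (?V + 1) powr ((\<beta> - 1) / 2)"
        using \<beta> aV[of k0] by (intro powr_mono2) (auto simp: a_def)
      ultimately show ?thesis using B faber_krahn_const_pos[where 'a='a, of s]
        by (simp add: D_def mult_right_mono mult_left_mono)
    qed
    moreover have "k0 \<le> ?k" using M by simp
    moreover have "AE x in lborel. x \<notin> A ?k"
      using a0 Afin[of ?k] by (intro AE_not_in) (auto simp: a_def null_sets_def emeasure_eq_ennreal_measure)
    ultimately show "AE x in lborel. w x \<le> k0 + D * B"
      using off by (auto simp: A_def elim!: eventually_elim2)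
  qed
qed

section \<open>Modification on null sets\<close>

lemma AE_lborel_pair:
  assumes "AE x in (lborel :: 'a::euclidean_space measure). P x"
  shows "AE z in lborel \<Otimes>\<^sub>M (lborel :: 'b::euclidean_space measure). P (fst z)"
    and "AE z in (lborel :: 'b measure) \<Otimes>\<^sub>M lborel. P (snd z)"
proof -
  from assms obtain N where N: "N \<in> null_sets (lborel :: 'a measure)" "{x. \<not> P x} \<subseteq> N"
    by (auto simp: eventually_ae_filter)
  have [measurable]: "N \<in> sets borel" using N by auto
  have "N \<times> UNIV \<in> null_sets (lborel \<Otimes>\<^sub>M (lborel :: 'b measure))"
    using N by (auto simp: null_sets_def lborel.emeasure_pair_measure_Times)
  moreover have "{z \<in> space (lborel \<Otimes>\<^sub>M (lborel :: 'b measure)). \<not> P (fst z)} \<subseteq> N \<times> UNIV" using N by auto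
  ultimately show "AE z in lborel \<Otimes>\<^sub>M (lborel :: 'b measure). P (fst z)" by (rule AE_I')
  have "UNIV \<times> N \<in> null_sets ((lborel :: 'b measure) \<Otimes>\<^sub>M lborel)"
    using N by (auto simp: null_sets_def lborel.emeasure_pair_measure_Times)
  moreover have "{z \<in> space ((lborel :: 'b measure) \<Otimes>\<^sub>M lborel). \<not> P (snd z)} \<subseteq> UNIV \<times> N" using N by auto
  ultimately show "AE z in (lborel :: 'b measure) \<Otimes>\<^sub>M lborel. P (snd z)" by (rule AE_I')
qed

lemma gag_cong_AE:
  assumes "AE x in lborel. u x = v x"
  shows "AE z in lborel \<Otimes>\<^sub>M lborel. gag s u z = gag s v z"
  using AE_lborel_pair(1)[OF assms, where 'b='a] AE_lborel_pair(2)[OF assms, where 'b='a]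
  by eventually_elim (auto simp: gag_def split: prod.split)

lemma energy_space_cong:
  assumes u: "u \<in> energy_space \<Omega> s" and [measurable]: "v \<in> borel_measurable borel"
    and ae: "AE x in lborel. u x = v x"
  shows "v \<in> energy_space \<Omega> s"
proof -
  note [measurable] = energy_spaceD(1)[OF u]
  have "AE x in lborel. x \<notin> \<Omega> \<longrightarrow> v x = 0" using ae energy_spaceD(2)[OF u] by eventually_elim auto
  moreover have "integrable (lborel \<Otimes>\<^sub>M lborel) (\<lambda>z. (gag s v z)\<^sup>2)"
    using energy_spaceD(3)[OF u]
    by (rule integrable_cong_AE_imp) (use gag_cong_AE[OF ae, of s] in \<open>auto elim!: eventually_mono\<close>)
  ultimately show ?thesis by (simp add: energy_space_def)
qed

lemma energy_cong:
  assumes [measurable]: "u \<in> borel_measurable borel" "u' \<in> borel_measurable borel"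
    "v \<in> borel_measurable borel" "v' \<in> borel_measurable borel"
    and ae: "AE x in lborel. u x = u' x" "AE x in lborel. v x = v' x"
  shows "energy s u v = energy s u' v'"
  unfolding energy_def
  using gag_cong_AE[OF ae(1), of s] gag_cong_AE[OF ae(2), of s]
  by (intro integral_cong_AE) (auto elim!: eventually_elim2)

section \<open>Existence of weak solutions\<close>

text \<open>The increments have a summable series of L^1 norms, so the telescoping series converges
  absolutely at almost every point.\<close>

lemma sums_AE_convergent:
  fixes u :: "nat \<Rightarrow> 'b \<Rightarrow> real"
  assumes [measurable]: "\<And>n. u n \<in> borel_measurable M"
    and bound: "\<And>n. (\<integral>\<^sup>+x. ennreal \<bar>u (Suc n) x - u n x\<bar> \<partial>M) \<le> ennreal (c n)" and c: "\<And>n. 0 \<le> c n" "summable c"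
  shows "AE x in M. convergent (\<lambda>n. u n x)"
proof -
  have "(\<integral>\<^sup>+x. (\<Sum>n. ennreal \<bar>u (Suc n) x - u n x\<bar>) \<partial>M) = (\<Sum>n. \<integral>\<^sup>+x. ennreal \<bar>u (Suc n) x - u n x\<bar> \<partial>M)"
    by (rule nn_integral_suminf) simp
  also have "\<dots> \<le> (\<Sum>n. ennreal (c n))" by (intro suminf_le bound) auto
  also have "\<dots> = ennreal (\<Sum>n. c n)" using c by (intro suminf_ennreal2) auto
  finally have "(\<integral>\<^sup>+x. (\<Sum>n. ennreal \<bar>u (Suc n) x - u n x\<bar>) \<partial>M) \<noteq> \<infinity>" by (auto simp: top_unique)
  hence "AE x in M. (\<Sum>n. ennreal \<bar>u (Suc n) x - u n x\<bar>) \<noteq> \<infinity>"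
    by (intro nn_integral_PInf_AE) auto
  thus ?thesis
  proof eventually_elim
    fix x assume "(\<Sum>n. ennreal \<bar>u (Suc n) x - u n x\<bar>) \<noteq> \<infinity>"
    hence "summable (\<lambda>n. \<bar>u (Suc n) x - u n x\<bar>)" by (intro summable_suminf_not_top) auto
    hence "summable (\<lambda>n. u (Suc n) x - u n x)" by (rule summable_rabs_cancel)
    hence "convergent (\<lambda>n. \<Sum>i<n. u (Suc i) x - u i x)" by (simp add: summable_iff_convergent)
    hence "convergent (\<lambda>n. u n x - u 0 x)" using sum_lessThan_telescope[of "\<lambda>i. u i x"] by simp
    hence "convergent (\<lambda>n. (u n x - u 0 x) + u 0 x)" by (intro convergent_add convergent_const)
    thus "convergent (\<lambda>n. u n x)" by simp
  qed
qed

text \<open>Faber-Krahn and the finite measure of \<Omega> convert the decay (1/4)^n of energies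
  into the decay (1/2)^n of L^1 norms, which gives an almost everywhere limit without passing to a
  subsequence. Fatou's lemma, with m fixed, then yields both membership and the rate.\<close>

lemma energy_space_complete:
  fixes u :: "nat \<Rightarrow> 'a::euclidean_space \<Rightarrow> real"
  assumes [measurable]: "\<Omega> \<in> sets borel" and fin: "emeasure lborel \<Omega> < \<infinity>" and s: "s > 0"
    and u: "\<And>n. u n \<in> energy_space \<Omega> s"
    and cauchy: "\<And>m n. m \<le> n \<Longrightarrow> energy s (\<lambda>x. u n x - u m x) (\<lambda>x. u n x - u m x) \<le> C\<^sup>2 * (1/4) ^ m" and C: "C \<ge> 0"
  obtains v where "v \<in> energy_space \<Omega> s"
    "\<And>m. energy s (\<lambda>x. v x - u m x) (\<lambda>x. v x - u m x) \<le> C\<^sup>2 * (1/4) ^ m"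
proof -
  note [measurable] = energy_spaceD(1)[OF u]
  have d: "(\<lambda>x. u n x - u m x) \<in> energy_space \<Omega> s" for n m
    using energy_space_lincomb[OF u[of n] u[of m], of 1 "-1"] by simp
  define K where "K = faber_krahn_const TYPE('a) s * measure lborel \<Omega> powr (2 * s / real DIM('a))"
  have K: "K \<ge> 0" using faber_krahn_const_pos[where 'a='a, of s] by (simp add: K_def)
  have L1: "(\<integral>\<^sup>+x. ennreal \<bar>u (Suc n) x - u n x\<bar> \<partial>lborel) \<le> ennreal (sqrt (measure lborel \<Omega>) * (sqrt K * C) * (1/2) ^ n)" for n
  proof -
    let ?d = "\<lambda>x. u (Suc n) x - u n x"
    have fk: "integrable lborel (\<lambda>x. (?d x)\<^sup>2)" "(\<integral>x. (?d x)\<^sup>2 \<partial>lborel) \<le> K * energy s ?d ?d"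
      using faber_krahn[OF d s _ fin energy_spaceD(2)[OF d]] by (simp_all add: K_def)
    have i: "integrable lborel (\<lambda>x. (indicat_real \<Omega> x)\<^sup>2)" 
    proof -
      have "(\<lambda>x. (indicat_real \<Omega> x)\<^sup>2) = indicat_real \<Omega>" by (auto simp: indicator_def)
      thus ?thesis using fin by simp
    qed
    have i2: "integrable lborel (\<lambda>x. (\<bar>?d x\<bar>)\<^sup>2)" using fk by simp
    have "(\<integral>\<^sup>+x. ennreal \<bar>?d x\<bar> \<partial>lborel) = (\<integral>\<^sup>+x. ennreal (indicat_real \<Omega> x * \<bar>?d x\<bar>) \<partial>lborel)"
      using energy_spaceD(2)[OF d[of "Suc n" n]] by (intro nn_integral_cong_AE) (auto elim!: eventually_mono simp: indicator_def)
    also have "\<dots> = ennreal (\<integral>x. indicat_real \<Omega> x * \<bar>?d x\<bar> \<partial>lborel)"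
      using L2_mult_integrable[OF _ _ i i2] by (intro nn_integral_eq_integral) auto
    also have "(\<integral>x. indicat_real \<Omega> x * \<bar>?d x\<bar> \<partial>lborel) \<le> sqrt (measure lborel \<Omega>) * sqrt (\<integral>x. (?d x)\<^sup>2 \<partial>lborel)"
    proof -
      have "(\<integral>x. (indicat_real \<Omega> x)\<^sup>2 \<partial>lborel) = (\<integral>x. indicat_real \<Omega> x \<partial>lborel)"
        by (intro Bochner_Integration.integral_cong) (auto simp: indicator_def)
      thus ?thesis using L2_Cauchy_Schwarz[OF _ _ i i2] by simp
    qed
    also have "sqrt (\<integral>x. (?d x)\<^sup>2 \<partial>lborel) \<le> sqrt (K * (C\<^sup>2 * (1/4) ^ n))"
      using fk(2) cauchy[of n "Suc n"] K by (intro real_sqrt_le_mono) (auto intro: order_trans mult_left_mono)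
    also have "\<dots> = sqrt K * C * (1/2) ^ n"
    proof -
      have "sqrt ((1/4::real) ^ n) = (1/2) ^ n"
        by (rule real_sqrt_unique) (simp_all add: power_mult[symmetric] mult.commute power2_eq_square power_mult_distrib[symmetric])
      thus ?thesis using C by (simp add: real_sqrt_mult)
    qed
    finally show ?thesis by (simp add: ennreal_leI mult_left_mono mult.assoc)
  qed
  have conv: "AE x in lborel. convergent (\<lambda>n. u n x)"
  proof (rule sums_AE_convergent[where c="\<lambda>n. sqrt (measure lborel \<Omega>) * (sqrt K * C) * (1/2) ^ n"])
    show "summable (\<lambda>n. sqrt (measure lborel \<Omega>) * (sqrt K * C) * (1/2) ^ n)"
      by (intro summable_mult summable_geometric) simp
  qed (use K C L1 in auto)
  define v where "v x = lim (\<lambda>n. u n x)" for x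
  have [measurable]: "v \<in> borel_measurable borel" unfolding v_def by measurable
  have lim: "AE x in lborel. (\<lambda>n. u n x) \<longlonglongrightarrow> v x"
    using conv by eventually_elim (simp add: v_def convergent_LIMSEQ_iff)
  have glim: "AE z in lborel \<Otimes>\<^sub>M lborel. (\<lambda>n. gag s (\<lambda>x. u n x - u m x) z) \<longlonglongrightarrow> gag s (\<lambda>x. v x - u m x) z" for m
    using AE_lborel_pair(1)[OF lim, where 'b='a] AE_lborel_pair(2)[OF lim, where 'b='a]
  proof eventually_elim
    case (elim z)
    obtain x y where z: "z = (x, y)" by (cases z)
    have "(\<lambda>n. ((u n x - u m x) - (u n y - u m y)) * c) \<longlonglongrightarrow> ((v x - u m x) - (v y - u m y)) * c" for c
      using elim unfolding z by (intro tendsto_mult tendsto_diff tendsto_const) simp_all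
    from this[of "inverse (norm (x - y) powr (real DIM('a) / 2 + s))"]
    show ?case unfolding gag_def z divide_inverse prod.case .
  qed
  have fatou: "(\<integral>\<^sup>+z. ennreal ((gag s (\<lambda>x. v x - u m x) z)\<^sup>2) \<partial>(lborel \<Otimes>\<^sub>M lborel)) \<le> ennreal (C\<^sup>2 * (1/4) ^ m)" for m
  proof -
    have "(\<integral>\<^sup>+z. ennreal ((gag s (\<lambda>x. v x - u m x) z)\<^sup>2) \<partial>(lborel \<Otimes>\<^sub>M lborel))
       = (\<integral>\<^sup>+z. liminf (\<lambda>n. ennreal ((gag s (\<lambda>x. u n x - u m x) z)\<^sup>2)) \<partial>(lborel \<Otimes>\<^sub>M lborel))"
    proof (intro nn_integral_cong_AE, use glim[of m] in eventually_elim)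
      fix z assume "(\<lambda>n. gag s (\<lambda>x. u n x - u m x) z) \<longlonglongrightarrow> gag s (\<lambda>x. v x - u m x) z"
      hence "(\<lambda>n. ennreal ((gag s (\<lambda>x. u n x - u m x) z)\<^sup>2)) \<longlonglongrightarrow> ennreal ((gag s (\<lambda>x. v x - u m x) z)\<^sup>2)"
        by (intro tendsto_ennrealI tendsto_intros)
      thus "ennreal ((gag s (\<lambda>x. v x - u m x) z)\<^sup>2) = liminf (\<lambda>n. ennreal ((gag s (\<lambda>x. u n x - u m x) z)\<^sup>2))"
        by (intro lim_imp_Liminf[symmetric]) simp_all
    qed
    also have "\<dots> \<le> liminf (\<lambda>n. \<integral>\<^sup>+z. ennreal ((gag s (\<lambda>x. u n x - u m x) z)\<^sup>2) \<partial>(lborel \<Otimes>\<^sub>M lborel))"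
      by (rule nn_integral_liminf) simp
    also have "\<dots> \<le> ennreal (C\<^sup>2 * (1/4) ^ m)"
    proof (rule Liminf_le)
      show "\<forall>\<^sub>F n in sequentially. (\<integral>\<^sup>+z. ennreal ((gag s (\<lambda>x. u n x - u m x) z)\<^sup>2) \<partial>(lborel \<Otimes>\<^sub>M lborel)) \<le> ennreal (C\<^sup>2 * (1/4) ^ m)"
        using eventually_ge_at_top[of m]
      proof eventually_elim
        case (elim n)
        have "(\<integral>\<^sup>+z. ennreal ((gag s (\<lambda>x. u n x - u m x) z)\<^sup>2) \<partial>(lborel \<Otimes>\<^sub>M lborel)) = ennreal (energy s (\<lambda>x. u n x - u m x) (\<lambda>x. u n x - u m x))"
          using energy_spaceD(3)[OF d[of n m]] by (subst nn_integral_eq_integral) (auto simp: energy_def power2_eq_square)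
        thus ?case using cauchy[OF elim] by (simp add: ennreal_leI)
      qed
    qed simp
    finally show ?thesis .
  qed
  have dv: "(\<lambda>x. v x - u m x) \<in> energy_space \<Omega> s" for m
  proof -
    have "AE x in lborel. \<forall>n. x \<notin> \<Omega> \<longrightarrow> u n x = 0" 
      using energy_spaceD(2)[OF u] by (subst AE_all_countable) blast
    hence "AE x in lborel. x \<notin> \<Omega> \<longrightarrow> v x - u m x = 0"
      by eventually_elim (auto simp: v_def)
    moreover have "integrable (lborel \<Otimes>\<^sub>M lborel) (\<lambda>z. (gag s (\<lambda>x. v x - u m x) z)\<^sup>2)"
      using fatou[of m] by (intro integrableI_nonneg) (auto simp: top.not_eq_extremum[symmetric] top_unique intro: le_less_trans)
    ultimately show ?thesis by (simp add: energy_space_def)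
  qed
  show thesis
  proof (rule that)
    show "v \<in> energy_space \<Omega> s" using energy_space_lincomb[OF dv[of 0] u[of 0], of 1 1] by simp
    fix m
    have "(\<integral>\<^sup>+z. ennreal ((gag s (\<lambda>x. v x - u m x) z)\<^sup>2) \<partial>(lborel \<Otimes>\<^sub>M lborel)) = ennreal (energy s (\<lambda>x. v x - u m x) (\<lambda>x. v x - u m x))"
      using energy_spaceD(3)[OF dv[of m]] by (subst nn_integral_eq_integral) (auto simp: energy_def power2_eq_square)
    thus "energy s (\<lambda>x. v x - u m x) (\<lambda>x. v x - u m x) \<le> C\<^sup>2 * (1/4) ^ m" using fatou[of m] C by simp
  qed
qed

lemma energy_quadratic:
  assumes u: "u \<in> energy_space \<Omega> s" and v: "v \<in> energy_space \<Omega> s"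
  shows "energy s (\<lambda>x. a * u x + b * v x) (\<lambda>x. a * u x + b * v x)
    = a\<^sup>2 * energy s u u + 2 * a * b * energy s u v + b\<^sup>2 * energy s v v"
proof -
  note l = energy_space_lincomb[OF u v, of a b]
  have "energy s (\<lambda>x. a * u x + b * v x) (\<lambda>x. a * u x + b * v x) = a * energy s u (\<lambda>x. a * u x + b * v x) + b * energy s v (\<lambda>x. a * u x + b * v x)"
    by (rule energy_lincomb[OF u v l])
  also have "energy s u (\<lambda>x. a * u x + b * v x) = a * energy s u u + b * energy s v u"
    by (subst energy_commute, rule energy_lincomb[OF u v u])
  also have "energy s v (\<lambda>x. a * u x + b * v x) = a * energy s u v + b * energy s v v"
    by (subst energy_commute, rule energy_lincomb[OF u v v])
  finally show ?thesis by (simp add: energy_commute[of s v u] power2_eq_square algebra_simps)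
qed

text \<open>The direct method: a minimising sequence of \<open>energy s u u - 2 * L u\<close> with
  error (1/4)^n is Cauchy in energy by the parallelogram identity, and its limit satisfies the Euler
  equation.\<close>

lemma weak_solution_exists:
  fixes \<Omega> :: "'a::euclidean_space set" and L :: "('a \<Rightarrow> real) \<Rightarrow> real"
  assumes [measurable]: "\<Omega> \<in> sets borel" and fin: "emeasure lborel \<Omega> < \<infinity>" and s: "s > 0"
    and lin: "\<And>u v a b. u \<in> energy_space \<Omega> s \<Longrightarrow> v \<in> energy_space \<Omega> s \<Longrightarrow> L (\<lambda>x. a * u x + b * v x) = a * L u + b * L v"
    and bnd: "\<And>u. u \<in> energy_space \<Omega> s \<Longrightarrow> \<bar>L u\<bar> \<le> B * sqrt (energy s u u)"
  obtains v where "v \<in> energy_space \<Omega> s" "\<And>\<phi>. \<phi> \<in> energy_space \<Omega> s \<Longrightarrow> energy s v \<phi> = L \<phi>"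
proof -
  let ?H = "energy_space \<Omega> s"
  define I where "I u = energy s u u - 2 * L u" for u
  have lower: "- B\<^sup>2 \<le> I u" if "u \<in> ?H" for u
  proof -
    have "2 * L u \<le> 2 * (B * sqrt (energy s u u))" using bnd[OF that] by linarith
    also have "\<dots> \<le> B\<^sup>2 + (sqrt (energy s u u))\<^sup>2" using sum_squares_bound[of B "sqrt (energy s u u)"] by simp
    finally show ?thesis using energy_nonneg[of s u] by (simp add: I_def)
  qed
  have zero: "(\<lambda>x. 0) \<in> ?H" by (simp add: energy_space_def gag_def case_prod_beta)
  define m where "m = Inf (I ` ?H)"
  have bdd: "bdd_below (I ` ?H)" using lower by (intro bdd_belowI[of _ "- B\<^sup>2"]) auto
  have m_le: "m \<le> I u" if "u \<in> ?H" for u unfolding m_def using bdd that by (intro cInf_lower) auto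
  have "\<exists>u\<in>?H. I u < m + (1/4) ^ n" for n :: nat
  proof -
    have "\<exists>y\<in>I ` ?H. y < m + (1/4) ^ n"
      unfolding m_def using zero bdd by (intro cInf_lessD) auto
    thus ?thesis by auto
  qed
  then obtain u where u: "\<And>n. u n \<in> ?H" and Iu: "\<And>n. I (u n) < m + (1/4) ^ n" by metis
  have expand: "I (\<lambda>x. 1 * a x + t * b x) = I a + 2 * t * (energy s a b - L b) + t\<^sup>2 * energy s b b"
    if "a \<in> ?H" "b \<in> ?H" for a b t
    using energy_quadratic[OF that, of 1 t] lin[OF that, of 1 t] by (simp add: I_def algebra_simps)
  have cau: "energy s (\<lambda>x. u n x - u k x) (\<lambda>x. u n x - u k x) \<le> 2\<^sup>2 * (1/4) ^ k" if "k \<le> n" for k n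
  proof -
    \<comment> \<open>The midpoint has value at least \<open>m\<close>; the parallelogram identity
      then bounds the energy of the difference by the two errors.\<close>
    define w where "w = (\<lambda>x. (1/2) * u n x + (1/2) * u k x)"
    have h: "w \<in> ?H" unfolding w_def by (rule energy_space_lincomb[OF u u])
    have e1: "I w = (1/4) * energy s (u n) (u n) + (1/2) * energy s (u n) (u k) + (1/4) * energy s (u k) (u k) - L (u n) - L (u k)"
      using energy_quadratic[OF u u, of "1/2" n "1/2" k] lin[OF u u, of "1/2" n "1/2" k] by (simp add: I_def w_def power2_eq_square)
    have e2: "energy s (\<lambda>x. u n x - u k x) (\<lambda>x. u n x - u k x) = energy s (u n) (u n) - 2 * energy s (u n) (u k) + energy s (u k) (u k)"
      using energy_quadratic[OF u u, of 1 n "-1" k] by simp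
    have "energy s (\<lambda>x. u n x - u k x) (\<lambda>x. u n x - u k x) = 2 * I (u n) + 2 * I (u k) - 4 * I w"
      unfolding e1 e2 by (simp add: I_def algebra_simps)
    also have "\<dots> \<le> 2 * (m + (1/4)^n) + 2 * (m + (1/4)^k) - 4 * m"
    proof -
      have "2 * a + 2 * b - 4 * c \<le> 2 * (m + d) + 2 * (m + e) - 4 * m" if "a < m + d" "b < m + e" "m \<le> c" for a b c d e :: real
      proof -
        have "2 * a \<le> 2 * (m + d)" "2 * b \<le> 2 * (m + e)" "4 * m \<le> 4 * c" using that by auto
        thus ?thesis by (intro diff_mono add_mono)
      qed
      from this[OF Iu Iu m_le[OF h]] show ?thesis .
    qed
    also have "\<dots> = 2 * (1/4)^n + 2 * (1/4)^k" by simp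
    also have "(1/4::real)^n \<le> (1/4)^k" using that by (intro power_decreasing) auto
    finally show ?thesis by simp
  qed
  obtain v where v: "v \<in> ?H" and ev: "\<And>m. energy s (\<lambda>x. v x - u m x) (\<lambda>x. v x - u m x) \<le> 2\<^sup>2 * (1/4) ^ m"
    using energy_space_complete[OF assms(1) fin s u cau] by auto
  show thesis
  proof (rule that[OF v])
    fix \<phi> assume \<phi>: "\<phi> \<in> ?H"
    have half: "sqrt ((1/4::real) ^ n) = (1/2) ^ n" for n
      by (rule real_sqrt_unique) (simp_all add: power_mult[symmetric] mult.commute power2_eq_square power_mult_distrib[symmetric])
    have "\<bar>energy s v \<phi> - L \<phi>\<bar> \<le> 3 * sqrt (energy s \<phi> \<phi>) * (1/2) ^ n" for n
    proof -
      have d: "(\<lambda>x. v x - u n x) \<in> ?H" using energy_space_lincomb[OF v u[of n], of 1 "-1"] by simp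
      \<comment> \<open>Moving from \<open>u n\<close> by any multiple of \<phi> lowers the
        functional by at most (1/4)^n, so a quadratic in t is nonnegative. The factor 3 below is 1
        from this defect plus 2 from the distance between v and \<open>u n\<close>.\<close>
      have "\<bar>energy s (u n) \<phi> - L \<phi>\<bar> \<le> sqrt ((1/4) ^ n) * sqrt (energy s \<phi> \<phi>)"
      proof (rule quadratic_discriminant)
        fix t
        have "m \<le> I (\<lambda>x. 1 * u n x + (-t) * \<phi> x)" by (rule m_le[OF energy_space_lincomb[OF u \<phi>]])
        thus "0 \<le> (1/4) ^ n - 2 * t * (energy s (u n) \<phi> - L \<phi>) + t\<^sup>2 * energy s \<phi> \<phi>"
          using Iu[of n] unfolding expand[OF u \<phi>] by simp
      qed (auto simp: energy_nonneg)
      moreover have "\<bar>energy s (\<lambda>x. v x - u n x) \<phi>\<bar> \<le> sqrt (2\<^sup>2 * (1/4) ^ n) * sqrt (energy s \<phi> \<phi>)"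
        using energy_Cauchy_Schwarz[OF d \<phi>] ev[of n]
        by (elim order_trans) (intro mult_right_mono real_sqrt_le_mono, auto simp: energy_nonneg)
      moreover have "energy s v \<phi> = energy s (\<lambda>x. v x - u n x) \<phi> + energy s (u n) \<phi>"
        using energy_lincomb[OF d u[of n] \<phi>, of 1 1] by simp
      moreover have "\<bar>a + b - c\<bar> \<le> 3 * e * r" if "\<bar>b - c\<bar> \<le> r * e" "\<bar>a\<bar> \<le> 2 * r * e" for a b c e r :: real
        using that by (simp add: algebra_simps abs_le_iff)
      ultimately show ?thesis by (simp only: half real_sqrt_mult real_sqrt_abs abs_numeral)
    qed
    moreover have "(\<lambda>n. 3 * sqrt (energy s \<phi> \<phi>) * (1/2) ^ n) \<longlonglongrightarrow> 3 * sqrt (energy s \<phi> \<phi>) * 0"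
      by (intro tendsto_intros LIMSEQ_power_zero) auto
    ultimately have "\<bar>energy s v \<phi> - L \<phi>\<bar> \<le> 3 * sqrt (energy s \<phi> \<phi>) * 0" by (intro LIMSEQ_le_const) auto
    thus "energy s v \<phi> = L \<phi>" by simp
  qed
qed

section \<open>Hoelder's inequality\<close>

lemma Hoelder_inequality:
  fixes f g :: "'b \<Rightarrow> real"
  assumes [measurable]: "f \<in> borel_measurable M" "g \<in> borel_measurable M"
    and nn: "\<And>x. 0 \<le> f x" "\<And>x. 0 \<le> g x" and pq: "p > 1" "q > 1" "1 / p + 1 / q = 1"
    and f: "integrable M (\<lambda>x. f x powr p)" and g: "integrable M (\<lambda>x. g x powr q)"
  shows "integrable M (\<lambda>x. f x * g x)"
    and "(\<integral>x. f x * g x \<partial>M) \<le> (\<integral>x. f x powr p \<partial>M) powr (1 / p) * (\<integral>x. g x powr q \<partial>M) powr (1 / q)"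
proof -
  have young: "f x * g x \<le> f x powr p / p + g x powr q / q" for x
    using Youngs_inequality[of p q "f x" "g x"] nn pq by simp
  show int: "integrable M (\<lambda>x. f x * g x)"
  proof (rule Bochner_Integration.integrable_bound)
    show "integrable M (\<lambda>x. f x powr p / p + g x powr q / q)" using f g by auto
    show "AE x in M. norm (f x * g x) \<le> norm (f x powr p / p + g x powr q / q)"
      using young nn pq by (intro AE_I2) simp
  qed simp
  define A where "A = (\<integral>x. f x powr p \<partial>M)"
  define B where "B = (\<integral>x. g x powr q \<partial>M)"
  have AB: "A \<ge> 0" "B \<ge> 0" by (auto simp: A_def B_def)
  show "(\<integral>x. f x * g x \<partial>M) \<le> A powr (1 / p) * B powr (1 / q)"
  proof (cases "A = 0 \<or> B = 0")
    case True
    have "AE x in M. f x * g x = 0"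
    proof (cases "A = 0")
      case True
      hence "AE x in M. f x powr p = 0" using f unfolding A_def by (subst (asm) integral_nonneg_eq_0_iff_AE) auto
      thus ?thesis by eventually_elim auto
    next
      case False
      hence "B = 0" using \<open>A = 0 \<or> B = 0\<close> by simp
      hence "AE x in M. g x powr q = 0" using g unfolding B_def by (subst (asm) integral_nonneg_eq_0_iff_AE) auto
      thus ?thesis by eventually_elim auto
    qed
    hence "(\<integral>x. f x * g x \<partial>M) = 0" by (rule integral_eq_zero_AE)
    thus ?thesis by simp
  next
    case False
    hence pos: "A > 0" "B > 0" using AB by auto
    define a where "a = A powr (1 / p)"
    define b where "b = B powr (1 / q)"
    have ab: "a > 0" "b > 0" using pos by (auto simp: a_def b_def)
    have "f x * g x \<le> a * b * ((f x powr p / A) / p + (g x powr q / B) / q)" for x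
    proof -
      have "(f x / a) * (g x / b) \<le> (f x / a) powr p / p + (g x / b) powr q / q"
        using Youngs_inequality[of p q "f x / a" "g x / b"] nn pq ab by simp
      moreover have "(f x / a) powr p = f x powr p / A" "(g x / b) powr q = g x powr q / B"
        using pos pq nn by (simp_all add: powr_divide a_def b_def powr_powr)
      ultimately show ?thesis using ab by (simp add: field_simps)
    qed
    hence "(\<integral>x. f x * g x \<partial>M) \<le> (\<integral>x. a * b * ((f x powr p / A) / p + (g x powr q / B) / q) \<partial>M)"
      using int f g by (intro integral_mono) auto
    also have "\<dots> = a * b * (A / A / p + B / B / q)"
      using f g by (simp add: A_def B_def)
    also have "\<dots> = a * b" using pos pq by simp
    finally show ?thesis by (simp add: a_def b_def)
  qed
qed

section \<open>Bounds for weak solutions\<close>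

text \<open>No regularity of the boundary enters here; the exterior cone condition is added only
  where continuity up to the boundary is proved. In place of N/s < p the product form is
  assumed.\<close>

locale fractional_domain =
  fixes \<Omega> :: "'a::euclidean_space set" and s p :: real
  assumes open_domain: "open \<Omega>" and bounded_domain: "bounded \<Omega>"
    and s: "0 < s" "s < 1" and p: "2 < p" "real DIM('a) < p * s"
begin

lemma domain_borel[measurable]: "\<Omega> \<in> sets borel"
  using open_domain by simp

lemma domain_finite: "emeasure lborel \<Omega> < \<infinity>"
  using bounded_domain by (rule emeasure_bounded_finite)

text \<open>The power of the measure gained by Hoelder's inequality when an L^2 norm over a set is
  bounded by an L^p norm. The condition p > N/s places it above the threshold of
  \<open>stampacchia_bound\<close>.\<close>

definition \<gamma> :: real where "\<gamma> = 1 / 2 - 1 / p"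

lemma gamma: "\<gamma> > 1 / 2 - s / real DIM('a)" "\<gamma> > 0"
  using p s by (auto simp: \<gamma>_def field_simps)

lemma subset_domain_finite:
  assumes "A \<subseteq> \<Omega>"
  shows "emeasure lborel A < \<infinity>" "A \<in> sets borel \<Longrightarrow> measure lborel A \<le> measure lborel \<Omega>"
proof -
  show "emeasure lborel A < \<infinity>"
    using assms domain_finite emeasure_mono[of A \<Omega> lborel] by (auto intro: order_le_less_trans)
  show "A \<in> sets borel \<Longrightarrow> measure lborel A \<le> measure lborel \<Omega>"
    using assms domain_finite by (intro measure_mono_fmeasurable) (auto simp: fmeasurable_def)
qed

lemma energy_space_L2: "u \<in> energy_space \<Omega> s \<Longrightarrow> integrable lborel (\<lambda>x. (u x)\<^sup>2)"
  using faber_krahn(1)[OF _ s(1) domain_borel domain_finite] energy_spaceD(2) by blast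

definition data_norm :: "('a \<Rightarrow> real) \<Rightarrow> real" where
  "data_norm g = (\<integral>x. indicat_real \<Omega> x * \<bar>g x\<bar> powr p \<partial>lborel) powr (1 / p)"

definition Lp_data :: "('a \<Rightarrow> real) \<Rightarrow> bool" where
  "Lp_data g \<longleftrightarrow> g \<in> borel_measurable borel \<and> integrable lborel (\<lambda>x. indicat_real \<Omega> x * \<bar>g x\<bar> powr p)"

definition data_const :: real where
  "data_const = sqrt (faber_krahn_const TYPE('a) s * measure lborel \<Omega> powr (2 * s / real DIM('a)))"

text \<open>Hoelder with exponents p/2 and p/(p-2) is applied to the square of g on A, which alone
  produces the power \<gamma> of the measure of A; the L^2 norm of \<phi> is bounded by Faber-Krahn
  on all of \<Omega>, so the constant does not depend on A.\<close>

lemma data_bound: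
  assumes g: "Lp_data g" and \<phi>: "\<phi> \<in> energy_space \<Omega> s"
    and A[measurable]: "A \<in> sets borel" and sub: "A \<subseteq> \<Omega>" and off: "AE x in lborel. x \<notin> A \<longrightarrow> \<phi> x = 0"
  shows "integrable lborel (\<lambda>x. g x * \<phi> x)"
    and "\<bar>\<integral>x. g x * \<phi> x \<partial>lborel\<bar> \<le> data_const * data_norm g * measure lborel A powr \<gamma> * sqrt (energy s \<phi> \<phi>)"
proof -
  have gm[measurable]: "g \<in> borel_measurable borel" using g by (simp add: Lp_data_def)
  note [measurable] = energy_spaceD(1)[OF \<phi>]
  have fA: "emeasure lborel A < \<infinity>" using subset_domain_finite(1)[OF sub] .
  have q: "p / 2 > 1" "p / (p - 2) > 1" "1 / (p / 2) + 1 / (p / (p - 2)) = 1"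
    using p by (auto simp: field_simps)
  have e1: "(indicat_real \<Omega> x * (g x)\<^sup>2) powr (p / 2) = indicat_real \<Omega> x * \<bar>g x\<bar> powr p" for x
  proof (cases "x \<in> \<Omega>")
    case True
    have "(g x)\<^sup>2 powr (p / 2) = (\<bar>g x\<bar> powr 2) powr (p / 2)" by simp
    also have "\<dots> = \<bar>g x\<bar> powr p" unfolding powr_powr by simp
    finally show ?thesis using True by simp
  qed simp
  have e2: "indicat_real A x powr (p / (p - 2)) = indicat_real A x" for x by (simp add: indicator_def)
  have e3: "indicat_real \<Omega> x * (g x)\<^sup>2 * indicat_real A x = (indicat_real A x * g x)\<^sup>2" for x
    using sub by (auto simp: indicator_def)
  have i1: "integrable lborel (\<lambda>x. (indicat_real \<Omega> x * (g x)\<^sup>2) powr (p / 2))"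
    using g unfolding e1 by (simp add: Lp_data_def)
  have i2: "integrable lborel (\<lambda>x. indicat_real A x powr (p / (p - 2)))"
    unfolding e2 using fA by simp
  note H = Hoelder_inequality[OF _ _ _ _ q i1 i2, unfolded e1 e2 e3]
  have iA: "integrable lborel (\<lambda>x. (indicat_real A x * g x)\<^sup>2)" by (rule H(1)) simp_all
  have "(\<integral>x. (indicat_real A x * g x)\<^sup>2 \<partial>lborel) \<le> (\<integral>x. indicat_real \<Omega> x * \<bar>g x\<bar> powr p \<partial>lborel) powr (1 / (p / 2)) * measure lborel A powr (1 / (p / (p - 2)))"
    using H(2) by simp
  also have "\<dots> = (data_norm g * measure lborel A powr \<gamma>)\<^sup>2"
  proof -
    have "1 / (p / 2) = 1 / p + 1 / p" "1 / (p / (p - 2)) = \<gamma> + \<gamma>" using p by (auto simp: \<gamma>_def field_simps)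
    thus ?thesis by (simp only: power_mult_distrib power2_eq_square data_norm_def powr_add mult_ac)
  qed
  finally have "sqrt (\<integral>x. (indicat_real A x * g x)\<^sup>2 \<partial>lborel) \<le> sqrt ((data_norm g * measure lborel A powr \<gamma>)\<^sup>2)"
    by (rule real_sqrt_le_mono)
  also have "\<dots> = data_norm g * measure lborel A powr \<gamma>" by (simp add: data_norm_def)
  finally have n1: "sqrt (\<integral>x. (indicat_real A x * g x)\<^sup>2 \<partial>lborel) \<le> data_norm g * measure lborel A powr \<gamma>" .
  have "(\<integral>x. (\<phi> x)\<^sup>2 \<partial>lborel) \<le> faber_krahn_const TYPE('a) s * measure lborel \<Omega> powr (2 * s / real DIM('a)) * energy s \<phi> \<phi>"
    by (rule faber_krahn(2)[OF \<phi> s(1) domain_borel domain_finite energy_spaceD(2)[OF \<phi>]])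
  hence n2: "sqrt (\<integral>x. (\<phi> x)\<^sup>2 \<partial>lborel) \<le> data_const * sqrt (energy s \<phi> \<phi>)"
    unfolding data_const_def real_sqrt_mult[symmetric] by (rule real_sqrt_le_mono)
  have eq: "AE x in lborel. (indicat_real A x * g x) * \<phi> x = g x * \<phi> x"
    using off by eventually_elim (auto simp: indicator_def)
  have int: "integrable lborel (\<lambda>x. (indicat_real A x * g x) * \<phi> x)"
    by (rule L2_mult_integrable[OF _ _ iA energy_space_L2[OF \<phi>]]) simp_all
  show "integrable lborel (\<lambda>x. g x * \<phi> x)"
    by (rule integrable_cong_AE_imp[OF int _ eq]) simp
  have "(\<integral>x. g x * \<phi> x \<partial>lborel) = (\<integral>x. (indicat_real A x * g x) * \<phi> x \<partial>lborel)"
    using eq by (intro integral_cong_AE) (auto elim!: eventually_mono)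
  also have "\<bar>\<dots>\<bar> \<le> sqrt (\<integral>x. (indicat_real A x * g x)\<^sup>2 \<partial>lborel) * sqrt (\<integral>x. (\<phi> x)\<^sup>2 \<partial>lborel)"
    by (rule L2_Cauchy_Schwarz[OF _ _ iA energy_space_L2[OF \<phi>]]) simp_all
  also have "\<dots> \<le> (data_norm g * measure lborel A powr \<gamma>) * (data_const * sqrt (energy s \<phi> \<phi>))"
    by (rule mult_mono[OF n1 n2]) (auto simp: data_norm_def)
  finally show "\<bar>\<integral>x. g x * \<phi> x \<partial>lborel\<bar> \<le> data_const * data_norm g * measure lborel A powr \<gamma> * sqrt (energy s \<phi> \<phi>)"
    by (simp add: mult_ac)
qed

lemma data_const_nonneg: "data_const \<ge> 0"
  using faber_krahn_const_pos[where 'a='a, of s] by (simp add: data_const_def)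

text \<open>In terms of the fractional Laplacian the datum is \<open>frac_const N s / 2\<close>
  times g, since \<open>energy\<close> carries no normalising factor.\<close>

definition weak_solution :: "('a \<Rightarrow> real) \<Rightarrow> ('a \<Rightarrow> real) \<Rightarrow> bool" where
  "weak_solution v g \<longleftrightarrow> v \<in> energy_space \<Omega> s \<and>
     (\<forall>\<phi>\<in>energy_space \<Omega> s. energy s v \<phi> = (\<integral>x. g x * \<phi> x \<partial>lborel))"

lemma weak_solution_ex:
  assumes g: "Lp_data g"
  obtains v where "weak_solution v g"
proof -
  note b = data_bound[OF g _ domain_borel order_refl energy_spaceD(2)]
  obtain v where "v \<in> energy_space \<Omega> s" "\<And>\<phi>. \<phi> \<in> energy_space \<Omega> s \<Longrightarrow> energy s v \<phi> = (\<integral>x. g x * \<phi> x \<partial>lborel)"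
  proof (rule weak_solution_exists[OF domain_borel domain_finite s(1), where L = "\<lambda>\<phi>. \<integral>x. g x * \<phi> x \<partial>lborel"
        and B = "data_const * data_norm g * measure lborel \<Omega> powr \<gamma>"])
    fix u v a b assume uv: "u \<in> energy_space \<Omega> s" "v \<in> energy_space \<Omega> s"
    have "(\<integral>x. g x * (a * u x + b * v x) \<partial>lborel) = (\<integral>x. a * (g x * u x) + b * (g x * v x) \<partial>lborel)"
      by (simp add: algebra_simps)
    also have "\<dots> = a * (\<integral>x. g x * u x \<partial>lborel) + b * (\<integral>x. g x * v x \<partial>lborel)"
      using b(1)[OF uv(1) uv(1)] b(1)[OF uv(2) uv(2)] by simp
    finally show "(\<integral>x. g x * (a * u x + b * v x) \<partial>lborel) = a * (\<integral>x. g x * u x \<partial>lborel) + b * (\<integral>x. g x * v x \<partial>lborel)" .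
  qed (use b(2) in auto)
  thus ?thesis using that by (auto simp: weak_solution_def)
qed

text \<open>The constant is uniform over subdomains, and w need not vanish outside \<Omega>. Both
  are needed for differences of translates, which satisfy an equation only where the domain and its
  translate overlap. The functional is tested with the truncations of w, supported in superlevel
  sets.\<close>

lemma maximum_principle:
  obtains D where "D > 0" "\<And>w \<Omega>' k0 B. w \<in> energy_space UNIV s \<Longrightarrow> \<Omega>' \<in> sets borel \<Longrightarrow> \<Omega>' \<subseteq> \<Omega> \<Longrightarrow> B > 0 \<Longrightarrow>
     AE x in lborel. x \<notin> \<Omega>' \<longrightarrow> w x \<le> k0 \<Longrightarrow>
     (\<And>\<phi> A. \<phi> \<in> energy_space \<Omega>' s \<Longrightarrow> A \<in> sets borel \<Longrightarrow> A \<subseteq> \<Omega>' \<Longrightarrow> AE x in lborel. x \<notin> A \<longrightarrow> \<phi> x = 0 \<Longrightarrow>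
         energy s w \<phi> \<le> B * measure lborel A powr \<gamma> * sqrt (energy s \<phi> \<phi>)) \<Longrightarrow>
     AE x in lborel. w x \<le> k0 + D * B"
proof -
  obtain D where D: "D > 0" and st: "\<And>w k0 B. w \<in> borel_measurable borel \<Longrightarrow> B > 0 \<Longrightarrow> AE x in lborel. x \<notin> \<Omega> \<longrightarrow> w x \<le> k0 \<Longrightarrow>
     (\<And>k. k \<ge> k0 \<Longrightarrow> (\<lambda>x. max 0 (w x - k)) \<in> energy_space \<Omega> s) \<Longrightarrow>
     (\<And>k. k \<ge> k0 \<Longrightarrow> energy s (\<lambda>x. max 0 (w x - k)) (\<lambda>x. max 0 (w x - k))
         \<le> B * measure lborel {x \<in> \<Omega>. w x > k} powr \<gamma> * sqrt (energy s (\<lambda>x. max 0 (w x - k)) (\<lambda>x. max 0 (w x - k)))) \<Longrightarrow>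
     AE x in lborel. w x \<le> k0 + D * B"
    using stampacchia_bound[OF domain_borel domain_finite s(1) gamma(1)] by auto
  show thesis
  proof (rule that[OF D])
    fix w \<Omega>' k0 B
    assume w: "w \<in> energy_space UNIV s" and [measurable]: "\<Omega>' \<in> sets borel" and sub: "\<Omega>' \<subseteq> \<Omega>" and B: "B > 0"
      and off: "AE x in lborel. x \<notin> \<Omega>' \<longrightarrow> w x \<le> k0"
      and en: "\<And>\<phi> A. \<phi> \<in> energy_space \<Omega>' s \<Longrightarrow> A \<in> sets borel \<Longrightarrow> A \<subseteq> \<Omega>' \<Longrightarrow> AE x in lborel. x \<notin> A \<longrightarrow> \<phi> x = 0 \<Longrightarrow>
         energy s w \<phi> \<le> B * measure lborel A powr \<gamma> * sqrt (energy s \<phi> \<phi>)"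
    note [measurable] = energy_spaceD(1)[OF w]
    have mem: "(\<lambda>x. max 0 (w x - k)) \<in> energy_space T s" if "k \<ge> k0" "\<Omega>' \<subseteq> T" for k T
    proof (rule energy_space_bound[OF w])
      show "AE x in lborel. x \<notin> T \<longrightarrow> max 0 (w x - k) = 0"
        using off by eventually_elim (use that in auto)
    qed (auto simp: max_def)
    show "AE x in lborel. w x \<le> k0 + D * B"
    proof (rule st[OF _ B])
      show "AE x in lborel. x \<notin> \<Omega> \<longrightarrow> w x \<le> k0" using off by eventually_elim (use sub in auto)
      fix k assume k: "k \<ge> k0"
      show "(\<lambda>x. max 0 (w x - k)) \<in> energy_space \<Omega> s" using mem[OF k sub] .
      let ?\<phi> = "\<lambda>x. max 0 (w x - k)" and ?A = "{x \<in> \<Omega>'. w x > k}"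
      have \<phi>: "?\<phi> \<in> energy_space \<Omega>' s" using mem[OF k order_refl] .
      have "energy s ?\<phi> ?\<phi> \<le> energy s w ?\<phi>" by (rule energy_trunc_le[OF w \<phi>])
      also have "\<dots> \<le> B * measure lborel ?A powr \<gamma> * sqrt (energy s ?\<phi> ?\<phi>)"
      proof (rule en[OF \<phi>])
        show "AE x in lborel. x \<notin> ?A \<longrightarrow> ?\<phi> x = 0" using off by eventually_elim (use k in auto)
      qed auto
      also have "\<dots> \<le> B * measure lborel {x \<in> \<Omega>. w x > k} powr \<gamma> * sqrt (energy s ?\<phi> ?\<phi>)"
      proof -
        have "measure lborel ?A \<le> measure lborel {x \<in> \<Omega>. w x > k}"
          using sub subset_domain_finite(1)[of "{x \<in> \<Omega>. w x > k}"]
          by (intro measure_mono_fmeasurable) (auto simp: fmeasurable_def)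
        thus ?thesis using B gamma by (intro mult_right_mono mult_left_mono powr_mono2) (auto simp: energy_nonneg)
      qed
      finally show "energy s ?\<phi> ?\<phi> \<le> B * measure lborel {x \<in> \<Omega>. w x > k} powr \<gamma> * sqrt (energy s ?\<phi> ?\<phi>)" .
    qed simp
  qed
qed

lemma energy_space_mono: "u \<in> energy_space A r \<Longrightarrow> A \<subseteq> B \<Longrightarrow> u \<in> energy_space B r"
  by (auto simp: energy_space_def elim!: eventually_mono)

text \<open>The maximum principle for v and -v with boundary level 0. The hypothesis concerns a
  functional rather than a datum so that it also covers fractional divergences, for which only the
  power \<gamma> of the support is available.\<close>

lemma sup_bound:
  obtains D where "D > 0" "\<And>v B. v \<in> energy_space \<Omega> s \<Longrightarrow> B > 0 \<Longrightarrow>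
     (\<And>\<phi> A. \<phi> \<in> energy_space \<Omega> s \<Longrightarrow> A \<in> sets borel \<Longrightarrow> A \<subseteq> \<Omega> \<Longrightarrow> AE x in lborel. x \<notin> A \<longrightarrow> \<phi> x = 0 \<Longrightarrow>
         \<bar>energy s v \<phi>\<bar> \<le> B * measure lborel A powr \<gamma> * sqrt (energy s \<phi> \<phi>)) \<Longrightarrow>
     AE x in lborel. \<bar>v x\<bar> \<le> D * B"
proof -
  obtain D where D: "D > 0" and mp: "\<And>w \<Omega>' k0 B. w \<in> energy_space UNIV s \<Longrightarrow> \<Omega>' \<in> sets borel \<Longrightarrow> \<Omega>' \<subseteq> \<Omega> \<Longrightarrow> B > 0 \<Longrightarrow>
     AE x in lborel. x \<notin> \<Omega>' \<longrightarrow> w x \<le> k0 \<Longrightarrow>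
     (\<And>\<phi> A. \<phi> \<in> energy_space \<Omega>' s \<Longrightarrow> A \<in> sets borel \<Longrightarrow> A \<subseteq> \<Omega>' \<Longrightarrow> AE x in lborel. x \<notin> A \<longrightarrow> \<phi> x = 0 \<Longrightarrow>
         energy s w \<phi> \<le> B * measure lborel A powr \<gamma> * sqrt (energy s \<phi> \<phi>)) \<Longrightarrow>
     AE x in lborel. w x \<le> k0 + D * B" by (rule maximum_principle) blast
  show thesis
  proof (rule that[OF D])
    fix v B
    assume v: "v \<in> energy_space \<Omega> s" and B: "B > 0"
      and en: "\<And>\<phi> A. \<phi> \<in> energy_space \<Omega> s \<Longrightarrow> A \<in> sets borel \<Longrightarrow> A \<subseteq> \<Omega> \<Longrightarrow> AE x in lborel. x \<notin> A \<longrightarrow> \<phi> x = 0 \<Longrightarrow>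
         \<bar>energy s v \<phi>\<bar> \<le> B * measure lborel A powr \<gamma> * sqrt (energy s \<phi> \<phi>)"
    have v': "(\<lambda>x. - v x) \<in> energy_space \<Omega> s" using energy_space_lincomb[OF v v, of "-1" 0] by simp
    have neg: "energy s (\<lambda>x. - v x) \<phi> = - energy s v \<phi>" if "\<phi> \<in> energy_space \<Omega> s" for \<phi>
      using energy_lincomb[OF v v that, of "-1" 0] by simp
    have "AE x in lborel. v x \<le> 0 + D * B"
      by (rule mp[OF energy_space_mono[OF v] domain_borel order_refl B])
         (use energy_spaceD(2)[OF v] en in \<open>auto simp: abs_le_iff elim!: eventually_mono\<close>)
    moreover have "AE x in lborel. - v x \<le> 0 + D * B"
      by (rule mp[OF energy_space_mono[OF v'] domain_borel order_refl B])
         (use energy_spaceD(2)[OF v'] en neg in \<open>auto simp: abs_le_iff elim!: eventually_mono\<close>)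
    ultimately show "AE x in lborel. \<bar>v x\<bar> \<le> D * B" by eventually_elim auto
  qed
qed

lemma weak_solution_bounded:
  assumes "weak_solution v g" "Lp_data g"
  obtains M where "M > 0" "AE x in lborel. \<bar>v x\<bar> \<le> M"
proof -
  obtain D where D: "D > 0" "\<And>v B. v \<in> energy_space \<Omega> s \<Longrightarrow> B > 0 \<Longrightarrow>
     (\<And>\<phi> A. \<phi> \<in> energy_space \<Omega> s \<Longrightarrow> A \<in> sets borel \<Longrightarrow> A \<subseteq> \<Omega> \<Longrightarrow> AE x in lborel. x \<notin> A \<longrightarrow> \<phi> x = 0 \<Longrightarrow>
         \<bar>energy s v \<phi>\<bar> \<le> B * measure lborel A powr \<gamma> * sqrt (energy s \<phi> \<phi>)) \<Longrightarrow>
     AE x in lborel. \<bar>v x\<bar> \<le> D * B" by (rule sup_bound) blast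
  let ?B = "data_const * data_norm g + 1"
  have B: "?B > 0" using data_const_nonneg by (simp add: data_norm_def add_nonneg_pos)
  have "AE x in lborel. \<bar>v x\<bar> \<le> D * ?B"
  proof (rule D(2)[OF _ B])
    show "v \<in> energy_space \<Omega> s" using assms by (simp add: weak_solution_def)
    fix \<phi> A assume A: "\<phi> \<in> energy_space \<Omega> s" "A \<in> sets borel" "A \<subseteq> \<Omega>" "AE x in lborel. x \<notin> A \<longrightarrow> \<phi> x = 0"
    have "\<bar>energy s v \<phi>\<bar> \<le> data_const * data_norm g * measure lborel A powr \<gamma> * sqrt (energy s \<phi> \<phi>)"
      using data_bound(2)[OF assms(2) A] assms(1) A by (simp add: weak_solution_def)
    also have "\<dots> \<le> ?B * measure lborel A powr \<gamma> * sqrt (energy s \<phi> \<phi>)"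
      by (intro mult_right_mono) (auto simp: energy_nonneg)
    finally show "\<bar>energy s v \<phi>\<bar> \<le> ?B * measure lborel A powr \<gamma> * sqrt (energy s \<phi> \<phi>)" .
  qed
  thus thesis using that[of "D * ?B"] D(1) B by simp
qed

end

section \<open>Translations\<close>

lemma gag_shift: "gag s (\<lambda>x. u (x + h)) z = gag s u (z + (h, h))"
  by (cases z) (simp add: gag_def)

lemma integral_pair_shift:
  fixes f :: "'a::euclidean_space \<times> 'a \<Rightarrow> real"
  assumes "f \<in> borel_measurable (lborel \<Otimes>\<^sub>M lborel)"
  shows "(\<integral>z. f (z + c) \<partial>(lborel \<Otimes>\<^sub>M lborel)) = (\<integral>z. f z \<partial>(lborel \<Otimes>\<^sub>M lborel))"
    and "integrable (lborel \<Otimes>\<^sub>M lborel) (\<lambda>z. f (z + c)) \<longleftrightarrow> integrable (lborel \<Otimes>\<^sub>M lborel) f"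
  using integral_lborel_shift[of f c] assms by (simp_all add: lborel_prod)

lemma energy_space_shift:
  assumes u: "u \<in> energy_space \<Omega> s"
  shows "(\<lambda>x. u (x + h)) \<in> energy_space {x. x + h \<in> \<Omega>} s"
proof -
  note [measurable] = energy_spaceD(1)[OF u]
  have "integrable (lborel \<Otimes>\<^sub>M lborel) (\<lambda>z. (gag s (\<lambda>x. u (x + h)) z)\<^sup>2)"
    unfolding gag_shift using energy_spaceD(3)[OF u] by (subst integral_pair_shift(2)[of "\<lambda>z. (gag s u z)\<^sup>2"]) simp_all
  thus ?thesis using AE_lborel_shift[OF energy_spaceD(2)[OF u], of h] by (simp add: energy_space_def)
qed

lemma energy_shift:
  assumes [measurable]: "u \<in> borel_measurable borel" "v \<in> borel_measurable borel"
  shows "energy s (\<lambda>x. u (x + h)) v = energy s u (\<lambda>x. v (x - h))"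
proof -
  have "energy s u (\<lambda>x. v (x - h)) = (\<integral>z. gag s u z * gag s v (z + (- h, - h)) \<partial>(lborel \<Otimes>\<^sub>M lborel))"
    using gag_shift[of s v "- h"] by (simp add: energy_def)
  also have "\<dots> = (\<integral>z. gag s u (z + (h, h)) * gag s v (z + (h, h) + (- h, - h)) \<partial>(lborel \<Otimes>\<^sub>M lborel))"
  proof (rule integral_pair_shift(1)[symmetric])
    show "(\<lambda>z. gag s u z * gag s v (z + (- h, - h))) \<in> borel_measurable (lborel \<Otimes>\<^sub>M lborel)"
      unfolding gag_shift[symmetric] by simp
  qed
  finally show ?thesis by (simp add: energy_def gag_shift add.assoc zero_prod_def[symmetric])
qed

context fractional_domain
begin

text \<open>A test function supported where both x and x + h lie in \<Omega> remains admissible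
  after translation, so there v(x + h) - v(x) solves the equation with the translated difference of
  data. Elsewhere the bound k0 is assumed and serves as boundary value. The positive \<eta> covers
  the case that the difference of data has norm 0.\<close>

lemma translation_bound:
  obtains C where "C > 0" "\<And>v g h k0 \<eta>. weak_solution v g \<Longrightarrow> Lp_data g \<Longrightarrow> Lp_data (\<lambda>x. g (x + h) - g x) \<Longrightarrow> \<eta> > 0 \<Longrightarrow>
     AE x in lborel. \<not> (x \<in> \<Omega> \<and> x + h \<in> \<Omega>) \<longrightarrow> \<bar>v (x + h) - v x\<bar> \<le> k0 \<Longrightarrow>
     AE x in lborel. \<bar>v (x + h) - v x\<bar> \<le> k0 + C * (data_norm (\<lambda>x. g (x + h) - g x) + \<eta>)"
proof -
  obtain D where D: "D > 0" and mp: "\<And>w \<Omega>' k0 B. w \<in> energy_space UNIV s \<Longrightarrow> \<Omega>' \<in> sets borel \<Longrightarrow> \<Omega>' \<subseteq> \<Omega> \<Longrightarrow> B > 0 \<Longrightarrow>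
     AE x in lborel. x \<notin> \<Omega>' \<longrightarrow> w x \<le> k0 \<Longrightarrow>
     (\<And>\<phi> A. \<phi> \<in> energy_space \<Omega>' s \<Longrightarrow> A \<in> sets borel \<Longrightarrow> A \<subseteq> \<Omega>' \<Longrightarrow> AE x in lborel. x \<notin> A \<longrightarrow> \<phi> x = 0 \<Longrightarrow>
         energy s w \<phi> \<le> B * measure lborel A powr \<gamma> * sqrt (energy s \<phi> \<phi>)) \<Longrightarrow>
     AE x in lborel. w x \<le> k0 + D * B" by (rule maximum_principle) blast
  have C: "D * (data_const + 1) > 0" using D data_const_nonneg by (simp add: add_nonneg_pos)
  show thesis
  proof (rule that[OF C])
    fix v g h and k0 \<eta> :: real
    assume v: "weak_solution v g" and g: "Lp_data g" and gh: "Lp_data (\<lambda>x. g (x + h) - g x)" and \<eta>: "\<eta> > 0"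
      and off: "AE x in lborel. \<not> (x \<in> \<Omega> \<and> x + h \<in> \<Omega>) \<longrightarrow> \<bar>v (x + h) - v x\<bar> \<le> k0"
    have vE: "v \<in> energy_space \<Omega> s" using v by (simp add: weak_solution_def)
    have [measurable]: "g \<in> borel_measurable borel" using g by (simp add: Lp_data_def)
    note [measurable] = energy_spaceD(1)[OF vE]
    let ?O = "{x \<in> \<Omega>. x + h \<in> \<Omega>}"
    have O[measurable]: "?O \<in> sets borel" by measurable
    have v1: "(\<lambda>x. v (x + h)) \<in> energy_space UNIV s"
      using energy_space_mono[OF energy_space_shift[OF vE] subset_UNIV] .
    have v2: "v \<in> energy_space UNIV s" using energy_space_mono[OF vE subset_UNIV] .
    define dn where "dn = data_norm (\<lambda>x. g (x + h) - g x)"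
    have dn: "dn \<ge> 0" by (simp add: dn_def data_norm_def)
    define B where "B = (data_const + 1) * (dn + \<eta>)"
    have B: "B > 0" using dn \<eta> data_const_nonneg by (simp add: B_def add_nonneg_pos)
    \<comment> \<open>The sign \<sigma> treats the upper and the lower bound at once.\<close>
    have main: "AE x in lborel. \<sigma> * v (x + h) + (- \<sigma>) * v x \<le> k0 + D * B" if \<sigma>: "\<bar>\<sigma>\<bar> = 1" for \<sigma> :: real
    proof (rule mp[OF energy_space_lincomb[OF v1 v2] O _ B])
      show "AE x in lborel. x \<notin> ?O \<longrightarrow> \<sigma> * v (x + h) + (- \<sigma>) * v x \<le> k0"
        using off
      proof eventually_elim
        case (elim x)
        have "\<sigma> * v (x + h) + (- \<sigma>) * v x = \<sigma> * (v (x + h) - v x)" by (simp add: algebra_simps)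
        also have "\<dots> \<le> \<bar>v (x + h) - v x\<bar>"
          using abs_ge_self[of "\<sigma> * (v (x + h) - v x)"] \<sigma> by (simp add: abs_mult)
        finally show ?case using elim by auto
      qed
      fix \<phi> A
      assume \<phi>: "\<phi> \<in> energy_space ?O s" and A: "A \<in> sets borel" "A \<subseteq> ?O" "AE x in lborel. x \<notin> A \<longrightarrow> \<phi> x = 0"
      note [measurable] = energy_spaceD(1)[OF \<phi>]
      have \<phi>1: "\<phi> \<in> energy_space \<Omega> s" using energy_space_mono[OF \<phi>] by auto
      have \<phi>2: "(\<lambda>x. \<phi> (x - h)) \<in> energy_space \<Omega> s"
        using energy_space_mono[OF energy_space_shift[OF \<phi>, of "- h"], of \<Omega>] by auto
      have "energy s (\<lambda>x. \<sigma> * v (x + h) + (- \<sigma>) * v x) \<phi> = \<sigma> * energy s (\<lambda>x. v (x + h)) \<phi> + (- \<sigma>) * energy s v \<phi>"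
        by (rule energy_lincomb[OF v1 v2 \<phi>])
      also have "energy s (\<lambda>x. v (x + h)) \<phi> = energy s v (\<lambda>x. \<phi> (x - h))" by (rule energy_shift) simp_all
      also have "\<dots> = (\<integral>x. g x * \<phi> (x - h) \<partial>lborel)" using v \<phi>2 by (simp add: weak_solution_def)
      also have "\<dots> = (\<integral>x. g (x + h) * \<phi> x \<partial>lborel)"
        using integral_lborel_shift(1)[of "\<lambda>x. g x * \<phi> (x - h)" h] by simp
      also have "energy s v \<phi> = (\<integral>x. g x * \<phi> x \<partial>lborel)" using v \<phi>1 by (simp add: weak_solution_def)
      finally have e: "energy s (\<lambda>x. \<sigma> * v (x + h) + (- \<sigma>) * v x) \<phi>
         = \<sigma> * (\<integral>x. g (x + h) * \<phi> x \<partial>lborel) + (- \<sigma>) * (\<integral>x. g x * \<phi> x \<partial>lborel)" .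
      have i1: "integrable lborel (\<lambda>x. g x * \<phi> x)"
        by (rule data_bound(1)[OF g \<phi>1 domain_borel order_refl energy_spaceD(2)[OF \<phi>1]])
      have "integrable lborel (\<lambda>x. g x * \<phi> (x - h))"
        by (rule data_bound(1)[OF g \<phi>2 domain_borel order_refl energy_spaceD(2)[OF \<phi>2]])
      hence i2: "integrable lborel (\<lambda>x. g (x + h) * \<phi> x)"
        using integral_lborel_shift(2)[of "\<lambda>x. g x * \<phi> (x - h)" h] by simp
      have "energy s (\<lambda>x. \<sigma> * v (x + h) + (- \<sigma>) * v x) \<phi> = \<sigma> * (\<integral>x. (g (x + h) - g x) * \<phi> x \<partial>lborel)"
        unfolding e using i1 i2 by (simp add: algebra_simps)
      also have "\<dots> \<le> \<bar>\<integral>x. (g (x + h) - g x) * \<phi> x \<partial>lborel\<bar>"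
        using abs_ge_self[of "\<sigma> * (\<integral>x. (g (x + h) - g x) * \<phi> x \<partial>lborel)"] \<sigma> by (simp add: abs_mult)
      also have "\<dots> \<le> data_const * dn * measure lborel A powr \<gamma> * sqrt (energy s \<phi> \<phi>)"
        unfolding dn_def using A by (intro data_bound(2)[OF gh \<phi>1]) auto
      also have "\<dots> \<le> B * measure lborel A powr \<gamma> * sqrt (energy s \<phi> \<phi>)"
      proof -
        have "data_const * dn \<le> B" unfolding B_def using dn \<eta> data_const_nonneg by (intro mult_mono) auto
        thus ?thesis by (intro mult_right_mono) (auto simp: energy_nonneg)
      qed
      finally show "energy s (\<lambda>x. \<sigma> * v (x + h) + (- \<sigma>) * v x) \<phi> \<le> B * measure lborel A powr \<gamma> * sqrt (energy s \<phi> \<phi>)" .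
    qed auto
    from main[of 1] main[of "-1"]
    have "AE x in lborel. \<bar>v (x + h) - v x\<bar> \<le> k0 + D * B"
      by (simp, elim eventually_elim2) (auto simp: abs_le_iff)
    thus "AE x in lborel. \<bar>v (x + h) - v x\<bar> \<le> k0 + D * (data_const + 1) * (data_norm (\<lambda>x. g (x + h) - g x) + \<eta>)"
      by (simp add: B_def dn_def mult.assoc)
  qed
qed

end

section \<open>Weakly superharmonic functions\<close>

lemma integral_lborel_reflect:
  fixes f :: "'a::euclidean_space \<Rightarrow> real"
  assumes [measurable]: "f \<in> borel_measurable borel"
  shows "(\<integral>x. f (a - x) \<partial>lborel) = (\<integral>x. f x \<partial>lborel)"
    and "integrable lborel (\<lambda>x. f (a - x)) \<longleftrightarrow> integrable lborel f"
proof -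
  have "distr lborel borel (\<lambda>x. a - x) = (lborel :: 'a measure)"
    using lborel_affine[of "-1" a] by (simp add: density_1)
  thus "(\<integral>x. f (a - x) \<partial>lborel) = (\<integral>x. f x \<partial>lborel)"
    and "integrable lborel (\<lambda>x. f (a - x)) \<longleftrightarrow> integrable lborel f"
    using integral_distr[of "\<lambda>x. a - x" lborel borel f] integrable_distr_eq[of "\<lambda>x. a - x" lborel borel f] by simp_all
qed

lemma inverse_powr_kernel: "1 / norm h powr (c + d) = norm h powr (- d - c)"
proof -
  have "- (c + d) = - d - c" by simp
  thus ?thesis by (metis powr_minus_divide)
qed

lemma tail_kernel_integrable:
  fixes s \<delta> :: real
  assumes s: "s > 0" and \<delta>: "\<delta> > 0"
  shows "integrable lborel (\<lambda>h::'a::euclidean_space. indicat_real {h. \<delta> < norm h} h / norm h powr (real DIM('a) + 2 * s))"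
proof (rule integrableI_nonneg)
  let ?c = "real DIM('a) + 2 * s"
  have "(\<integral>\<^sup>+h. ennreal (indicat_real {h. \<delta> < norm h} h / norm h powr ?c) \<partial>(lborel :: 'a measure))
    \<le> (\<integral>\<^sup>+h. ennreal (\<delta> powr - ?c) * indicator (cball 0 1) h + indicator (- ball 0 1) h * ennreal (norm h powr (- (2 * s) - DIM('a))) \<partial>(lborel :: 'a measure))"
  proof (intro nn_integral_mono)
    fix h :: 'a
    have 1: "1 / norm h powr ?c \<le> \<delta> powr - ?c" if "\<delta> < norm h"
      using that \<delta> s by (simp only: powr_minus_divide) (intro divide_left_mono powr_mono2 mult_pos_pos, auto)
    have 2: "1 / norm h powr ?c = norm h powr (- (2 * s) - DIM('a))" by (rule inverse_powr_kernel)
    show "ennreal (indicat_real {h. \<delta> < norm h} h / norm h powr ?c)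
      \<le> ennreal (\<delta> powr - ?c) * indicator (cball 0 1) h + indicator (- ball 0 1) h * ennreal (norm h powr (- (2 * s) - DIM('a)))"
    proof (cases "\<delta> < norm h")
      case True
      show ?thesis
      proof (cases "norm h \<le> 1")
        case le: True
        have "ennreal (indicat_real {h. \<delta> < norm h} h / norm h powr ?c) \<le> ennreal (\<delta> powr - ?c) * indicator (cball 0 1) h"
          using 1[OF True] le True by (simp add: ennreal_leI)
        thus ?thesis by (rule add_increasing2[rotated]) simp
      next
        case False
        thus ?thesis using True 2 by (simp add: indicator_def)
      qed
    qed simp
  qed
  also have "\<dots> = ennreal (\<delta> powr - ?c) * emeasure lborel (cball (0::'a) 1) + (\<integral>\<^sup>+h. indicator (- ball 0 1) h * ennreal (norm h powr (- (2 * s) - DIM('a))) \<partial>(lborel :: 'a measure))"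
  proof -
    define f1 f2 where "f1 h = ennreal (\<delta> powr - ?c) * indicator (cball 0 1) h"
      and "f2 h = indicator (- ball 0 1) h * ennreal (norm h powr (- (2 * s) - DIM('a)))" for h :: 'a
    have [measurable]: "cball (0::'a) 1 \<in> sets borel" "- ball (0::'a) 1 \<in> sets borel" by auto
    have [measurable]: "f1 \<in> borel_measurable borel" "f2 \<in> borel_measurable borel"
      unfolding f1_def f2_def by measurable
    have "(\<integral>\<^sup>+h. f1 h + f2 h \<partial>lborel) = (\<integral>\<^sup>+h. f1 h \<partial>lborel) + (\<integral>\<^sup>+h. f2 h \<partial>lborel)"
      by (rule nn_integral_add) simp_all
    also have "(\<integral>\<^sup>+h. f1 h \<partial>lborel) = ennreal (\<delta> powr - ?c) * emeasure lborel (cball (0::'a) 1)"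
      unfolding f1_def by (rule nn_integral_cmult_indicator) simp
    finally show ?thesis unfolding f1_def f2_def .
  qed
  also have "\<dots> < \<infinity>"
    using far_kernel_finite[of "2 * s", where 'a='a] s emeasure_lborel_cball_finite[of "0::'a" 1] by (simp add: ennreal_mult_less_top)
  finally show "(\<integral>\<^sup>+h. ennreal (indicat_real {h. \<delta> < norm h} h / norm h powr ?c) \<partial>(lborel :: 'a measure)) < \<infinity>" .
qed auto

text \<open>Near the origin the integrand behaves like |h|^(2 - 2s - N), at infinity like |h|^(-2s -
  N); the two halves use s < 1 and s > 0.\<close>

lemma lipschitz_kernel_finite:
  fixes s M L :: real
  assumes s: "0 < s" "s < 1" and nn: "L \<ge> 0" "M \<ge> 0"
  shows "(\<integral>\<^sup>+h. ennreal ((min (L * norm h) M)\<^sup>2 / norm h powr (real DIM('a) + 2 * s)) \<partial>(lborel :: 'a::euclidean_space measure)) < \<infinity>"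
    (is "?I < \<infinity>")
proof -
  let ?c = "real DIM('a) + 2 * s"
  have "?I \<le> (\<integral>\<^sup>+h. ennreal (L\<^sup>2) * (indicator (cball 0 1) h * ennreal (norm h powr ((2 - 2 * s) - DIM('a))))
       + ennreal (M\<^sup>2) * (indicator (- ball 0 1) h * ennreal (norm h powr (- (2 * s) - DIM('a)))) \<partial>(lborel :: 'a measure))"
  proof (intro nn_integral_mono)
    fix h :: 'a
    have m: "(min (L * norm h) M)\<^sup>2 \<le> (L * norm h)\<^sup>2" "(min (L * norm h) M)\<^sup>2 \<le> M\<^sup>2" 
      using nn by (intro power_mono; simp)+
    have 1: "(L * norm h)\<^sup>2 / norm h powr ?c = L\<^sup>2 * norm h powr ((2 - 2 * s) - DIM('a))"
    proof (cases "h = 0")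
      case False
      hence "(norm h)\<^sup>2 = norm h powr 2" by simp
      hence "(norm h)\<^sup>2 / norm h powr ?c = norm h powr ((2 - 2 * s) - DIM('a))"
        by (simp only: powr_diff[symmetric]) (simp add: algebra_simps)
      thus ?thesis by (simp only: power_mult_distrib times_divide_eq_right[symmetric])
    qed simp
    have 2: "M\<^sup>2 / norm h powr ?c = M\<^sup>2 * norm h powr (- (2 * s) - DIM('a))" 
      using inverse_powr_kernel[of h "DIM('a)" "2 * s"] by (simp add: divide_inverse)
    show "ennreal ((min (L * norm h) M)\<^sup>2 / norm h powr ?c) \<le> ennreal (L\<^sup>2) * (indicator (cball 0 1) h * ennreal (norm h powr ((2 - 2 * s) - DIM('a))))
       + ennreal (M\<^sup>2) * (indicator (- ball 0 1) h * ennreal (norm h powr (- (2 * s) - DIM('a))))"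
    proof (cases "norm h \<le> 1")
      case True
      have "(min (L * norm h) M)\<^sup>2 / norm h powr ?c \<le> L\<^sup>2 * norm h powr ((2 - 2 * s) - DIM('a))"
        unfolding 1[symmetric] by (intro divide_right_mono m) auto
      hence "ennreal ((min (L * norm h) M)\<^sup>2 / norm h powr ?c) \<le> ennreal (L\<^sup>2) * ennreal (norm h powr ((2 - 2 * s) - DIM('a)))"
        by (simp add: ennreal_mult'[symmetric] ennreal_leI)
      thus ?thesis using True by (intro add_increasing2) (auto simp: indicator_def)
    next
      case False
      have "(min (L * norm h) M)\<^sup>2 / norm h powr ?c \<le> M\<^sup>2 * norm h powr (- (2 * s) - DIM('a))"
        unfolding 2[symmetric] by (intro divide_right_mono m) auto
      hence "ennreal ((min (L * norm h) M)\<^sup>2 / norm h powr ?c) \<le> ennreal (M\<^sup>2) * ennreal (norm h powr (- (2 * s) - DIM('a)))"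
        by (simp add: ennreal_mult'[symmetric] ennreal_leI)
      thus ?thesis using False by (simp add: indicator_def)
    qed
  qed
  also have "\<dots> = ennreal (L\<^sup>2) * (\<integral>\<^sup>+h. indicator (cball 0 1) h * ennreal (norm h powr ((2 - 2 * s) - DIM('a))) \<partial>(lborel :: 'a measure))
       + ennreal (M\<^sup>2) * (\<integral>\<^sup>+h. indicator (- ball 0 1) h * ennreal (norm h powr (- (2 * s) - DIM('a))) \<partial>(lborel :: 'a measure))"
  proof -
    define f1 f2 where "f1 h = indicator (cball 0 1) h * ennreal (norm h powr ((2 - 2 * s) - DIM('a)))"
      and "f2 h = indicator (- ball 0 1) h * ennreal (norm h powr (- (2 * s) - DIM('a)))" for h :: 'a
    have [measurable]: "cball (0::'a) 1 \<in> sets borel" "- ball (0::'a) 1 \<in> sets borel" by auto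
    have [measurable]: "f1 \<in> borel_measurable borel" "f2 \<in> borel_measurable borel"
      unfolding f1_def f2_def by measurable
    have "(\<integral>\<^sup>+h. ennreal (L\<^sup>2) * f1 h + ennreal (M\<^sup>2) * f2 h \<partial>lborel)
      = ennreal (L\<^sup>2) * (\<integral>\<^sup>+h. f1 h \<partial>lborel) + ennreal (M\<^sup>2) * (\<integral>\<^sup>+h. f2 h \<partial>lborel)"
      by (simp add: nn_integral_add nn_integral_cmult)
    thus ?thesis unfolding f1_def f2_def .
  qed
  also have "\<dots> < \<infinity>"
    using near_kernel_finite[of "2 - 2 * s", where 'a='a] far_kernel_finite[of "2 * s", where 'a='a] s by (simp add: ennreal_mult_less_top)
  finally show ?thesis .
qed

text \<open>A barrier need not vanish at infinity and so has no finite energy on all pairs. Against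
  test functions supported in \<Omega> only pairs meeting \<Omega> matter, and over these the energy
  of a bounded Lipschitz function is finite.\<close>

lemma lipschitz_gag_integrable:
  fixes w :: "'a::euclidean_space \<Rightarrow> real"
  assumes s: "0 < s" "s < 1" and [measurable]: "\<Omega> \<in> sets borel" and fin: "emeasure lborel \<Omega> < \<infinity>"
    and w[measurable]: "w \<in> borel_measurable borel" and wb: "\<And>x y. \<bar>w x - w y\<bar> \<le> M" and wl: "\<And>x y. \<bar>w x - w y\<bar> \<le> L * norm (x - y)"
  shows "{z. fst z \<in> \<Omega> \<or> snd z \<in> \<Omega>} \<in> sets (lborel \<Otimes>\<^sub>M lborel)"
    and "integrable (lborel \<Otimes>\<^sub>M lborel) (\<lambda>z. (indicat_real {z. fst z \<in> \<Omega> \<or> snd z \<in> \<Omega>} z * gag s w z)\<^sup>2)"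
proof -
  let ?c = "real DIM('a) + 2 * s"
  let ?LL = "lborel \<Otimes>\<^sub>M (lborel :: 'a measure)"
  have M: "M \<ge> 0" using wb[of undefined undefined] by simp
  have L: "L \<ge> 0"
  proof -
    obtain b :: 'a where "b \<in> Basis" using nonempty_Basis by blast
    hence "norm b = 1" by simp
    thus ?thesis using order_trans[OF abs_ge_zero wl[of b 0]] by simp
  qed
  define S where "S = {z :: 'a \<times> 'a. fst z \<in> \<Omega> \<or> snd z \<in> \<Omega>}"
  have Sm[measurable]: "S \<in> sets (lborel \<Otimes>\<^sub>M lborel)"
  proof -
    have "S = (\<Omega> \<times> UNIV) \<union> (UNIV \<times> \<Omega>)" by (auto simp: S_def)
    thus ?thesis by simp
  qed
  have gagsq: "(gag s w (x, y))\<^sup>2 = (w x - w y)\<^sup>2 / norm (x - y) powr ?c" for x y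
    by (simp add: power2_eq_square gag_mult)
  have half: "(\<integral>\<^sup>+x. \<integral>\<^sup>+y. indicator \<Omega> x * ennreal ((gag s w (x, y))\<^sup>2) \<partial>lborel \<partial>lborel) < \<infinity>"
  proof -
    let ?k = "\<lambda>h::'a. ennreal ((min (L * norm h) M)\<^sup>2 / norm h powr ?c)"
    have "(\<integral>\<^sup>+x. \<integral>\<^sup>+y. indicator \<Omega> x * ennreal ((gag s w (x, y))\<^sup>2) \<partial>lborel \<partial>lborel)
       \<le> (\<integral>\<^sup>+x. \<integral>\<^sup>+y. indicator \<Omega> x * ?k (x - y) \<partial>lborel \<partial>lborel)"
    proof (intro nn_integral_mono mult_left_mono ennreal_leI)
      fix x y :: 'a
      have "(w x - w y)\<^sup>2 \<le> (min (L * norm (x - y)) M)\<^sup>2"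
        using wb[of x y] wl[of x y] by (subst abs_le_square_iff[symmetric]) auto
      thus "(gag s w (x, y))\<^sup>2 \<le> (min (L * norm (x - y)) M)\<^sup>2 / norm (x - y) powr ?c"
        unfolding gagsq by (rule divide_right_mono) simp
    qed simp
    also have "\<dots> = (\<integral>\<^sup>+x. indicator \<Omega> x * (\<integral>\<^sup>+h. ?k h \<partial>lborel) \<partial>lborel)"
      by (intro nn_integral_cong) (simp add: nn_integral_cmult nn_integral_lborel_reflect[of ?k])
    also have "\<dots> = (\<integral>\<^sup>+h. ?k h \<partial>lborel) * emeasure lborel \<Omega>"
      by (subst mult.commute, subst nn_integral_cmult_indicator) auto
    also have "\<dots> < \<infinity>" using lipschitz_kernel_finite[OF s L M, where 'a='a] fin by (simp add: ennreal_mult_less_top)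
    finally show ?thesis .
  qed
  have half': "(\<integral>\<^sup>+z. indicator \<Omega> (fst z) * ennreal ((gag s w z)\<^sup>2) \<partial>?LL) < \<infinity>"
    using half by (subst lborel.nn_integral_fst[symmetric]) simp_all
  have swap: "(gag s w (y, x))\<^sup>2 = (gag s w (x, y))\<^sup>2" for x y
    by (simp add: gagsq norm_minus_commute power2_commute)
  have half'': "(\<integral>\<^sup>+z. indicator \<Omega> (snd z) * ennreal ((gag s w z)\<^sup>2) \<partial>?LL) < \<infinity>"
  proof -
    have "(\<integral>\<^sup>+z. indicator \<Omega> (snd z) * ennreal ((gag s w z)\<^sup>2) \<partial>?LL)
       = (\<integral>\<^sup>+y. \<integral>\<^sup>+x. indicator \<Omega> y * ennreal ((gag s w (x, y))\<^sup>2) \<partial>lborel \<partial>lborel)"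
      by (subst lborel_pair.nn_integral_snd[symmetric]) simp_all
    also have "\<dots> = (\<integral>\<^sup>+x. \<integral>\<^sup>+y. indicator \<Omega> x * ennreal ((gag s w (x, y))\<^sup>2) \<partial>lborel \<partial>lborel)"
      by (simp add: swap)
    finally show ?thesis using half by simp
  qed
  have W2: "integrable ?LL (\<lambda>z. (indicat_real S z * gag s w z)\<^sup>2)"
  proof (rule integrableI_nonneg)
    have "(\<integral>\<^sup>+z. ennreal ((indicat_real S z * gag s w z)\<^sup>2) \<partial>?LL)
       \<le> (\<integral>\<^sup>+z. indicator \<Omega> (fst z) * ennreal ((gag s w z)\<^sup>2) + indicator \<Omega> (snd z) * ennreal ((gag s w z)\<^sup>2) \<partial>?LL)"
      by (intro nn_integral_mono) (auto simp: indicator_def S_def)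
    also have "\<dots> = (\<integral>\<^sup>+z. indicator \<Omega> (fst z) * ennreal ((gag s w z)\<^sup>2) \<partial>?LL) + (\<integral>\<^sup>+z. indicator \<Omega> (snd z) * ennreal ((gag s w z)\<^sup>2) \<partial>?LL)"
      by (rule nn_integral_add) simp_all
    also have "\<dots> < \<infinity>" using half' half'' by simp
    finally show "(\<integral>\<^sup>+z. ennreal ((indicat_real S z * gag s w z)\<^sup>2) \<partial>?LL) < \<infinity>" .
  qed auto
  show "{z. fst z \<in> \<Omega> \<or> snd z \<in> \<Omega>} \<in> sets (lborel \<Otimes>\<^sub>M lborel)"
    unfolding S_def[symmetric] by (rule Sm)
  show "integrable (lborel \<Otimes>\<^sub>M lborel) (\<lambda>z. (indicat_real {z. fst z \<in> \<Omega> \<or> snd z \<in> \<Omega>} z * gag s w z)\<^sup>2)"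
    unfolding S_def[symmetric] by (rule W2)
qed

text \<open>A pointwise bound on second differences becomes a weak inequality: symmetrise in the
  pair, pass to the variable h, average over h and -h. In \<open>sec\<close> the conversion to
  \<open>ennreal\<close> discards negative values, so only the positive part of the second
  difference has to be integrable against the kernel.\<close>

lemma weakly_superharmonic:
  fixes w \<phi> P :: "'a::euclidean_space \<Rightarrow> real"
  assumes s: "0 < s" "s < 1" and [measurable]: "\<Omega> \<in> sets borel" and fin: "emeasure lborel \<Omega> < \<infinity>"
    and w[measurable]: "w \<in> borel_measurable borel" and wb: "\<And>x y. \<bar>w x - w y\<bar> \<le> M" and wl: "\<And>x y. \<bar>w x - w y\<bar> \<le> L * norm (x - y)"
    and \<phi>: "\<phi> \<in> energy_space \<Omega> s" and \<phi>0: "\<And>x. 0 \<le> \<phi> x" and \<phi>i: "integrable lborel \<phi>"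
    and P: "\<And>x. \<phi> x \<noteq> 0 \<Longrightarrow> 0 \<le> P x" "integrable lborel (\<lambda>x. \<phi> x * P x)"
    and sec: "\<And>x. \<phi> x \<noteq> 0 \<Longrightarrow> (\<integral>\<^sup>+h. ennreal ((w (x + h) + w (x - h) - 2 * w x) / norm h powr (real DIM('a) + 2 * s)) \<partial>lborel) \<le> ennreal (2 * P x)"
  shows "integrable (lborel \<Otimes>\<^sub>M lborel) (\<lambda>z. gag s w z * gag s \<phi> z)"
    and "- 2 * (\<integral>x. \<phi> x * P x \<partial>lborel) \<le> (\<integral>z. gag s w z * gag s \<phi> z \<partial>(lborel \<Otimes>\<^sub>M lborel))"
proof -
  note [measurable] = energy_spaceD(1)[OF \<phi>]
  let ?c = "real DIM('a) + 2 * s"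
  let ?LL = "lborel \<Otimes>\<^sub>M (lborel :: 'a measure)"
  have M: "M \<ge> 0" using wb[of undefined undefined] by simp
  define S where "S = {z :: 'a \<times> 'a. fst z \<in> \<Omega> \<or> snd z \<in> \<Omega>}"
  have [measurable]: "S \<in> sets (lborel \<Otimes>\<^sub>M lborel)"
    and W2: "integrable ?LL (\<lambda>z. (indicat_real S z * gag s w z)\<^sup>2)"
    unfolding S_def by (rule lipschitz_gag_integrable[OF s _ fin w wb wl], simp)+
  have offS: "AE z in ?LL. indicat_real S z * gag s w z * gag s \<phi> z = gag s w z * gag s \<phi> z"
    using AE_lborel_pair(1)[OF energy_spaceD(2)[OF \<phi>], where 'b='a] AE_lborel_pair(2)[OF energy_spaceD(2)[OF \<phi>], where 'b='a]
    by eventually_elim (auto simp: S_def indicator_def gag_def split: prod.splits)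
  show int: "integrable ?LL (\<lambda>z. gag s w z * gag s \<phi> z)"
    by (rule integrable_cong_AE_imp[OF L2_mult_integrable[OF _ _ W2 energy_spaceD(3)[OF \<phi>]] _ offS]) simp_all
  \<comment> \<open>Away from the diagonal the kernel is integrable, so the product can be split
    into two separately integrable halves; dominated convergence removes the cut afterwards.\<close>
  define X where "X n = {z :: 'a \<times> 'a. 1 / real (Suc n) < norm (fst z - snd z)}" for n
  have [measurable]: "X n \<in> sets (lborel \<Otimes>\<^sub>M lborel)" for n
  proof -
    have "X n = {z \<in> space (lborel \<Otimes>\<^sub>M lborel). 1 / real (Suc n) < norm (fst z - snd z)}"
      by (simp add: X_def space_pair_measure)
    also have "\<dots> \<in> sets (lborel \<Otimes>\<^sub>M lborel)" by measurable
    finally show ?thesis .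
  qed
  have lim: "(\<lambda>n. \<integral>z. indicat_real (X n) z * (gag s w z * gag s \<phi> z) \<partial>?LL) \<longlonglongrightarrow> (\<integral>z. gag s w z * gag s \<phi> z \<partial>?LL)"
  proof (rule integral_dominated_convergence[where w="\<lambda>z. \<bar>gag s w z * gag s \<phi> z\<bar>"])
    show "AE z in ?LL. (\<lambda>n. indicat_real (X n) z * (gag s w z * gag s \<phi> z)) \<longlonglongrightarrow> gag s w z * gag s \<phi> z"
    proof (intro AE_I2)
      fix z :: "'a \<times> 'a"
      obtain x y where z: "z = (x, y)" by (cases z)
      show "(\<lambda>n. indicat_real (X n) z * (gag s w z * gag s \<phi> z)) \<longlonglongrightarrow> gag s w z * gag s \<phi> z"
      proof (cases "x = y")
        case True thus ?thesis by (simp add: z gag_def)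
      next
        case False
        hence "norm (x - y) > 0" by simp
        then obtain n0 where n0: "1 / real (Suc n0) < norm (x - y)" using nat_approx_posE by blast
        have "\<forall>\<^sub>F n in sequentially. indicat_real (X n) z * (gag s w z * gag s \<phi> z) = gag s w z * gag s \<phi> z"
          using eventually_ge_at_top[of n0]
        proof eventually_elim
          case (elim n)
          have "1 / real (Suc n) \<le> 1 / real (Suc n0)" using elim by (intro divide_left_mono) auto
          thus ?case using n0 by (simp add: X_def z indicator_def)
        qed
        thus ?thesis by (rule tendsto_eventually)
      qed
    qed
    show "AE z in ?LL. norm (indicat_real (X n) z * (gag s w z * gag s \<phi> z)) \<le> \<bar>gag s w z * gag s \<phi> z\<bar>" for n
      by (intro AE_I2) (auto simp: indicator_def)
  qed (use int in auto)
  have each: "- 2 * (\<integral>x. \<phi> x * P x \<partial>lborel) \<le> (\<integral>z. indicat_real (X n) z * (gag s w z * gag s \<phi> z) \<partial>?LL)" for n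
  proof -
    define \<delta> where "\<delta> = 1 / real (Suc n)"
    have \<delta>: "\<delta> > 0" by (simp add: \<delta>_def)
    define k where "k h = indicat_real {h. \<delta> < norm h} h / norm h powr ?c" for h :: 'a
    have [measurable]: "k \<in> borel_measurable borel" unfolding k_def by measurable
    have ki: "integrable lborel k" unfolding k_def using tail_kernel_integrable[OF s(1) \<delta>, where 'a='a] .
    have k0: "k h \<ge> 0" "k (- h) = k h" for h by (auto simp: k_def indicator_def)
    have ksym: "k (x - y) = k (y - x)" for x y by (simp add: k_def norm_minus_commute indicator_def)
    define f where "f x y = (w x - w y) * \<phi> x * k (x - y)" for x y
    have fm[measurable]: "(\<lambda>(x, y). f x y) \<in> borel_measurable ?LL" unfolding f_def by measurable
    have fi: "integrable ?LL (\<lambda>(x, y). f x y)"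
    proof (rule Bochner_Integration.integrable_bound)
      show "integrable ?LL (\<lambda>(x, y). M * (\<phi> x * k (x - y)))"
      proof (rule lborel_pair.Fubini_integrable)
        have "(\<integral>y. norm (case (x, y) of (x, y) \<Rightarrow> M * (\<phi> x * k (x - y))) \<partial>lborel) = M * \<phi> x * (\<integral>h. k h \<partial>lborel)" for x
          using M \<phi>0 k0 integral_lborel_reflect(1)[of k x] by (simp add: abs_mult mult.assoc)
        thus "integrable lborel (\<lambda>x. \<integral>y. norm (case (x, y) of (x, y) \<Rightarrow> M * (\<phi> x * k (x - y))) \<partial>lborel)"
          using \<phi>i by simp
        show "AE x in lborel. integrable lborel (\<lambda>y. case (x, y) of (x, y) \<Rightarrow> M * (\<phi> x * k (x - y)))"
          using integral_lborel_reflect(2)[of k] ki by simp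
      qed simp
      show "AE z in ?LL. norm (case z of (x, y) \<Rightarrow> f x y) \<le> norm (case z of (x, y) \<Rightarrow> M * (\<phi> x * k (x - y)))"
      proof (intro AE_I2, clarsimp)
        fix x y
        have "\<bar>w x - w y\<bar> * (\<phi> x * k (x - y)) \<le> M * (\<phi> x * k (x - y))"
          using wb[of x y] \<phi>0 k0 by (intro mult_right_mono) auto
        thus "\<bar>f x y\<bar> \<le> \<bar>M * (\<phi> x * k (x - y))\<bar>" using \<phi>0[of x] k0(1)[of "x - y"] M by (simp add: f_def abs_mult mult.assoc)
      qed
    qed simp
    have fi': "integrable ?LL (\<lambda>(x, y). f y x)" using lborel_pair.integrable_product_swap[OF fi] by simp
    have fswap: "(\<integral>(x, y). f y x \<partial>?LL) = (\<integral>(x, y). f x y \<partial>?LL)"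
      using lborel_pair.integral_product_swap[OF fm] by simp
    have pt: "indicat_real (X n) z * (gag s w z * gag s \<phi> z) = (case z of (x, y) \<Rightarrow> f x y) + (case z of (x, y) \<Rightarrow> f y x)" for z
    proof -
      obtain x y where z: "z = (x, y)" by (cases z)
      have "indicat_real (X n) z * (gag s w z * gag s \<phi> z) = (w x - w y) * (\<phi> x - \<phi> y) * k (x - y)"
        by (simp add: z gag_mult k_def X_def \<delta>_def indicator_def)
      also have "\<dots> = f x y + f y x" by (simp add: f_def ksym[of y x] algebra_simps)
      finally show ?thesis by (simp add: z)
    qed
    have "(\<integral>z. indicat_real (X n) z * (gag s w z * gag s \<phi> z) \<partial>?LL) = 2 * (\<integral>(x, y). f x y \<partial>?LL)"
      unfolding pt using fi fi' fswap by (simp add: Bochner_Integration.integral_add)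
    also have "(\<integral>(x, y). f x y \<partial>?LL) = (\<integral>x. \<integral>y. f x y \<partial>lborel \<partial>lborel)"
      by (rule lborel_pair.integral_fst[OF fi, symmetric])
    finally have eq: "(\<integral>z. indicat_real (X n) z * (gag s w z * gag s \<phi> z) \<partial>?LL) = 2 * (\<integral>x. \<integral>y. f x y \<partial>lborel \<partial>lborel)" .
    have "(\<integral>x. - (\<phi> x * P x) \<partial>lborel) \<le> (\<integral>x. \<integral>y. f x y \<partial>lborel \<partial>lborel)"
    proof (rule integral_mono)
      show "integrable lborel (\<lambda>x. - (\<phi> x * P x))" using P by simp
      show "integrable lborel (\<lambda>x. \<integral>y. f x y \<partial>lborel)" by (rule lborel_pair.integrable_fst[OF fi])
      fix x
      show "- (\<phi> x * P x) \<le> (\<integral>y. f x y \<partial>lborel)"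
      proof (cases "\<phi> x = 0")
        case False
        have i1: "integrable lborel (\<lambda>h. (w x - w (x - h)) * k h)" and i2: "integrable lborel (\<lambda>h. (w x - w (x + h)) * k h)"
        proof -
          have "integrable lborel (\<lambda>h. (w x - w (q h)) * k h)" if [measurable]: "q \<in> borel_measurable borel" for q
          proof (rule Bochner_Integration.integrable_bound[where f="\<lambda>h. M * k h"])
            show "AE h in lborel. norm ((w x - w (q h)) * k h) \<le> norm (M * k h)"
              using wb k0 M by (intro AE_I2) (simp add: abs_mult mult_right_mono)
          qed (use ki in auto)
          from this[of "\<lambda>h. x - h"] this[of "\<lambda>h. x + h"]
          show "integrable lborel (\<lambda>h. (w x - w (x - h)) * k h)" "integrable lborel (\<lambda>h. (w x - w (x + h)) * k h)" by simp_all
        qed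
        define J where "J = (\<integral>h. (w x - w (x - h)) * k h \<partial>lborel)"
        have J1: "(\<integral>y. f x y \<partial>lborel) = \<phi> x * J"
        proof -
          have "(\<integral>y. f x y \<partial>lborel) = \<phi> x * (\<integral>y. (w x - w y) * k (x - y) \<partial>lborel)"
            by (subst Bochner_Integration.integral_mult_right_zero[symmetric], intro Bochner_Integration.integral_cong) (simp_all add: f_def mult_ac)
          also have "(\<integral>y. (w x - w y) * k (x - y) \<partial>lborel) = J"
            unfolding J_def using integral_lborel_reflect(1)[of "\<lambda>h. (w x - w (x - h)) * k h" x] by simp
          finally show ?thesis .
        qed
        \<comment> \<open>The reflected form of J; adding both forms turns first differences into
          minus the second difference.\<close>
        have J2: "J = (\<integral>h. (w x - w (x + h)) * k h \<partial>lborel)"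
          unfolding J_def using integral_lborel_reflect(1)[of "\<lambda>h. (w x - w (x - h)) * k h" 0] by (simp add: k0)
        have "- (2 * J) = (\<integral>h. (w (x + h) + w (x - h) - 2 * w x) * k h \<partial>lborel)"
        proof -
          have "(\<integral>h. (w (x + h) + w (x - h) - 2 * w x) * k h \<partial>lborel) = (\<integral>h. - ((w x - w (x - h)) * k h) - (w x - w (x + h)) * k h \<partial>lborel)"
            by (intro Bochner_Integration.integral_cong) (auto simp: algebra_simps)
          also have "\<dots> = - J - J" using i1 i2 J2 by (simp add: J_def)
          finally show ?thesis by simp
        qed
        also have "\<dots> \<le> 2 * P x"
        proof (rule integral_real_bounded)
          have "(\<integral>\<^sup>+h. ennreal ((w (x + h) + w (x - h) - 2 * w x) * k h) \<partial>lborel)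
             \<le> (\<integral>\<^sup>+h. ennreal ((w (x + h) + w (x - h) - 2 * w x) / norm h powr ?c) \<partial>lborel)"
          proof (intro nn_integral_mono)
            fix h show "ennreal ((w (x + h) + w (x - h) - 2 * w x) * k h) \<le> ennreal ((w (x + h) + w (x - h) - 2 * w x) / norm h powr ?c)"
              by (simp add: k_def indicator_def)
          qed
          also have "\<dots> \<le> ennreal (2 * P x)" by (rule sec[OF False])
          finally show "(\<integral>\<^sup>+h. ennreal ((w (x + h) + w (x - h) - 2 * w x) * k h) \<partial>lborel) \<le> ennreal (2 * P x)" .
        qed (use P(1)[OF False] in simp)
        finally have "- P x \<le> J" by simp
        hence "\<phi> x * (- P x) \<le> \<phi> x * J" by (rule mult_left_mono) (rule \<phi>0)
        thus ?thesis by (simp add: J1)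
      qed (simp add: f_def)
    qed
    thus ?thesis unfolding eq by simp
  qed
  show "- 2 * (\<integral>x. \<phi> x * P x \<partial>lborel) \<le> (\<integral>z. gag s w z * gag s \<phi> z \<partial>?LL)"
    using lim by (rule LIMSEQ_le_const) (use each in auto)
qed

section \<open>Exterior cones and barriers\<close>

text \<open>A cone is invariant under dilation about its vertex, so it contains at every small scale
  \<rho> a ball of radius comparable to \<rho> at a comparable distance. This scale invariant form
  is what the barrier uses.\<close>

lemma cone_exterior_balls:
  fixes \<Omega> :: "'a::euclidean_space set"
  assumes cone: "exterior_cone_condition \<Omega>" and x0: "x0 \<in> frontier \<Omega>"
  obtains e \<kappa> r0 where "norm e = 1" "0 < \<kappa>" "\<kappa> \<le> 1/2" "0 < r0"
    "\<And>\<rho> y. 0 < \<rho> \<Longrightarrow> \<rho> \<le> r0 \<Longrightarrow> norm (y - (x0 + (5/2 * \<rho>) *\<^sub>R e)) < \<kappa> * \<rho> \<Longrightarrow> y \<notin> \<Omega>"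
proof -
  from cone x0 obtain e \<theta> h where e: "norm e = 1" and \<theta>: "0 < \<theta>" "\<theta> < pi / 2" and h: "0 < h"
    and c: "closure \<Omega> \<inter> finite_cone x0 e \<theta> h = {x0}" unfolding exterior_cone_condition_def by blast
  have c0: "cos \<theta> > 0" using \<theta> by (intro cos_gt_zero) auto
  have c1: "cos \<theta> < 1" using cos_monotone_0_pi[of 0 \<theta>] \<theta> by simp
  \<comment> \<open>The second bound is
    \<open>cos \<theta> * (5/2 + \<kappa>) \<le> 5/2 - \<kappa>\<close> solved for \<kappa>, which
    puts the ball inside the infinite cone. The bound 1/2 keeps it between distances 2\<rho> and
    3\<rho> from the vertex, hence below the height when \<rho> is at most h/3.\<close>
  define \<kappa> where "\<kappa> = min (1/2) (5/2 * (1 - cos \<theta>) / (1 + cos \<theta>))"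
  have \<kappa>: "0 < \<kappa>" "\<kappa> \<le> 1/2" using c0 c1 by (auto simp: \<kappa>_def)
  have "\<kappa> \<le> 5/2 * (1 - cos \<theta>) / (1 + cos \<theta>)" by (simp add: \<kappa>_def)
  hence "\<kappa> * (1 + cos \<theta>) \<le> 5/2 * (1 - cos \<theta>)" using c0 by (subst (asm) pos_le_divide_eq) auto
  hence k2: "cos \<theta> * (5/2 + \<kappa>) \<le> 5/2 - \<kappa>" by (simp add: algebra_simps)
  show thesis
  proof (rule that[OF e \<kappa>, of "h / 3"])
    show "0 < h / 3" using h by simp
    fix \<rho> y assume \<rho>: "0 < \<rho>" "\<rho> \<le> h / 3" and y: "norm (y - (x0 + (5/2 * \<rho>) *\<^sub>R e)) < \<kappa> * \<rho>"
    define z where "z = y - (x0 + (5/2 * \<rho>) *\<^sub>R e)"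
    have yz: "y - x0 = (5/2 * \<rho>) *\<^sub>R e + z" by (simp add: z_def)
    have z: "norm z < \<kappa> * \<rho>" using y by (simp add: z_def)
    have ee: "e \<bullet> e = 1" using e by (simp add: norm_eq_1)
    have ze: "\<bar>z \<bullet> e\<bar> \<le> norm z" using Cauchy_Schwarz_ineq2[of z e] e by simp
    have n: "norm (y - x0) \<le> (5/2 + \<kappa>) * \<rho>"
      using norm_triangle_ineq[of "(5/2 * \<rho>) *\<^sub>R e" z] z e \<rho> unfolding yz by (simp add: algebra_simps)
    have ip: "(y - x0) \<bullet> e = 5/2 * \<rho> + z \<bullet> e" unfolding yz by (simp add: inner_add_left ee)
    have lo: "(5/2 - \<kappa>) * \<rho> \<le> (y - x0) \<bullet> e" unfolding ip using ze z by (simp add: algebra_simps)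
    have "cos \<theta> * norm (y - x0) \<le> cos \<theta> * ((5/2 + \<kappa>) * \<rho>)" using n c0 by (intro mult_left_mono) auto
    also have "\<dots> \<le> (5/2 - \<kappa>) * \<rho>" using mult_right_mono[OF k2, of \<rho>] \<rho> by (simp add: mult.assoc)
    finally have 1: "cos \<theta> * norm (y - x0) \<le> (y - x0) \<bullet> e" using lo by linarith
    have "(y - x0) \<bullet> e \<le> norm (y - x0)" using norm_cauchy_schwarz[of "y - x0" e] e by simp
    also have "\<dots> \<le> (5/2 + \<kappa>) * \<rho>" by (rule n)
    also have "\<dots> \<le> 3 * \<rho>" using \<kappa> \<rho> by (intro mult_right_mono) auto
    also have "\<dots> \<le> h" using \<rho> by simp
    finally have 2: "y \<in> finite_cone x0 e \<theta> h" using 1 by (simp add: finite_cone_def)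
    have "0 < (5/2 - \<kappa>) * \<rho>" using \<kappa> \<rho> by simp
    hence "y \<noteq> x0" using lo by auto
    thus "y \<notin> \<Omega>" using 2 c closure_subset[of \<Omega>] by blast
  qed
qed

section \<open>Elementary estimates for powers\<close>

lemma powr_midpoint_le:
  fixes A B a :: real
  assumes "A > 0" "B > 0" "0 \<le> a" "a \<le> 1"
  shows "A powr a + B powr a \<le> 2 * ((A + B) / 2) powr a"
proof -
  define m where "m = (A + B) / 2"
  have m: "m > 0" using assms by (simp add: m_def)
  \<comment> \<open>Weighted Young inequality against the mean \<open>m\<close>: after addition the
    individual values of A and B disappear.\<close>
  have "A powr a * m powr (1 - a) \<le> a * A + (1 - a) * m" "B powr a * m powr (1 - a) \<le> a * B + (1 - a) * m"
    using assms m by (intro Youngs_inequality_0; simp)+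
  hence "A powr a * m powr (1 - a) + B powr a * m powr (1 - a) \<le> (a * A + (1 - a) * m) + (a * B + (1 - a) * m)"
    by (rule add_mono)
  also have "\<dots> = a * (A + B) + 2 * (1 - a) * m" by (simp only: ring_distribs)
  also have "A + B = 2 * m" by (simp add: m_def)
  also have "a * (2 * m) + 2 * (1 - a) * m = 2 * m" by (simp add: left_diff_distrib right_diff_distrib)
  finally have "(A powr a + B powr a) * m powr (1 - a) \<le> 2 * m" by (simp only: distrib_right)
  also have "2 * m = 2 * m powr a * m powr (1 - a)" using m by (simp add: powr_add[symmetric])
  finally have "A powr a + B powr a \<le> 2 * m powr a" using m by (subst (asm) mult_le_cancel_right_pos) auto
  thus ?thesis by (simp only: m_def)
qed

lemma powr_diff_le:
  fixes \<rho> \<tau> \<alpha> :: real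
  assumes "0 < \<rho>" "\<rho> \<le> \<tau>" "0 \<le> \<alpha>" "\<alpha> \<le> 1"
  shows "\<tau> powr \<alpha> - \<rho> powr \<alpha> \<le> \<rho> powr (\<alpha> - 1) * (\<tau> - \<rho>)"
proof -
  have "(\<tau> / \<rho>) powr \<alpha> \<le> (\<tau> / \<rho>) powr 1" using assms by (intro powr_mono) (auto simp: field_simps)
  hence "\<tau> powr \<alpha> / \<rho> powr \<alpha> \<le> \<tau> / \<rho>" using assms by (simp add: powr_divide)
  hence "\<tau> powr \<alpha> \<le> \<rho> powr \<alpha> * (\<tau> / \<rho>)" using assms by (simp add: field_simps)
  also have "\<dots> = \<rho> powr (\<alpha> - 1) * \<tau>" using assms by (simp add: powr_diff)
  finally have "\<tau> powr \<alpha> \<le> \<rho> powr (\<alpha> - 1) * \<tau>" .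
  moreover have "\<rho> powr \<alpha> = \<rho> powr (\<alpha> - 1) * \<rho>" using assms by (simp add: powr_diff)
  ultimately show ?thesis by (simp add: algebra_simps)
qed

text \<open>Young's inequality between \<open>y powr b\<close> and 1. The factor a/b is the point:
  it makes the defect of the barrier proportional to its exponent.\<close>

lemma powr_increment_le:
  fixes y a b :: real
  assumes "y \<ge> 1" "0 < a" "a \<le> b"
  shows "y powr a - 1 \<le> (a / b) * (y powr b - 1)"
proof -
  have "(y powr b) powr (a / b) * 1 powr (1 - a / b) \<le> (a / b) * y powr b + (1 - a / b) * 1"
    using assms by (intro Youngs_inequality_0) auto
  thus ?thesis using assms by (simp add: powr_powr algebra_simps)
qed

definition barrier_const :: "'a::euclidean_space itself \<Rightarrow> real \<Rightarrow> ennreal" where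
  "barrier_const _ s = (\<integral>\<^sup>+k. ennreal (((1 + (norm k)\<^sup>2) powr (s / 2) - 1) / norm k powr (real DIM('a) + 2 * s)) \<partial>(lborel :: 'a measure))"

lemma barrier_const_finite:
  fixes s :: real
  assumes s: "0 < s" "s < 1"
  shows "barrier_const TYPE('a::euclidean_space) s < \<infinity>"
proof -
  let ?c = "real DIM('a) + 2 * s"
  define f1 f2 where "f1 h = indicator (cball 0 1) h * ennreal (norm h powr ((2 - 2 * s) - DIM('a)))"
    and "f2 h = indicator (- ball 0 1) h * ennreal (norm h powr (- s - DIM('a)))" for h :: 'a
  have [measurable]: "cball (0::'a) 1 \<in> sets borel" "- ball (0::'a) 1 \<in> sets borel" by auto
  have [measurable]: "f1 \<in> borel_measurable borel" "f2 \<in> borel_measurable borel"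
    unfolding f1_def f2_def by measurable
  have "barrier_const TYPE('a) s \<le> (\<integral>\<^sup>+h. f1 h + ennreal 2 * f2 h \<partial>lborel)"
    unfolding barrier_const_def
  proof (intro nn_integral_mono)
    fix h :: 'a
    show "ennreal (((1 + (norm h)\<^sup>2) powr (s / 2) - 1) / norm h powr ?c) \<le> f1 h + ennreal 2 * f2 h"
    proof (cases "norm h \<le> 1")
      case True
      have "(1 + (norm h)\<^sup>2) powr (s / 2) - 1 \<le> (s / 2 / 1) * ((1 + (norm h)\<^sup>2) powr 1 - 1)"
        using s by (intro powr_increment_le) auto
      also have "\<dots> = s / 2 * (norm h)\<^sup>2" by simp
      also have "\<dots> \<le> 1 * (norm h)\<^sup>2" using s by (intro mult_right_mono) auto
      finally have "((1 + (norm h)\<^sup>2) powr (s / 2) - 1) / norm h powr ?c \<le> (norm h)\<^sup>2 / norm h powr ?c"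
        by (simp add: divide_right_mono)
      also have "\<dots> = norm h powr ((2 - 2 * s) - DIM('a))"
      proof (cases "h = 0")
        case False
        hence "(norm h)\<^sup>2 = norm h powr 2" by simp
        thus ?thesis by (simp only: powr_diff[symmetric]) (simp add: algebra_simps)
      qed simp
      finally have "ennreal (((1 + (norm h)\<^sup>2) powr (s / 2) - 1) / norm h powr ?c) \<le> f1 h"
        using True by (simp add: f1_def ennreal_leI)
      thus ?thesis by (rule add_increasing2[rotated]) simp
    next
      case False
      hence h: "norm h > 1" by simp
      have "(1 + (norm h)\<^sup>2) powr (s / 2) \<le> (2 * (norm h)\<^sup>2) powr (s / 2)"
        using h s by (intro powr_mono2) (auto simp: one_le_power)
      also have "\<dots> = 2 powr (s / 2) * norm h powr s"
      proof -
        have "(norm h)\<^sup>2 = norm h powr 2" using h by simp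
        thus ?thesis by (simp only: powr_mult powr_powr) simp
      qed
      also have "2 powr (s / 2) \<le> 2 powr (1::real)" using s by (intro powr_mono) auto
      finally have "(1 + (norm h)\<^sup>2) powr (s / 2) - 1 \<le> 2 * norm h powr s" by (simp add: mult_right_mono)
      hence "((1 + (norm h)\<^sup>2) powr (s / 2) - 1) / norm h powr ?c \<le> 2 * norm h powr s / norm h powr ?c"
        by (intro divide_right_mono) auto
      also have "\<dots> = 2 * norm h powr (- s - DIM('a))"
      proof -
        have "s - ?c = - s - DIM('a)" by simp
        thus ?thesis by (simp only: times_divide_eq_right[symmetric] powr_diff[symmetric])
      qed
      finally have "ennreal (((1 + (norm h)\<^sup>2) powr (s / 2) - 1) / norm h powr ?c) \<le> ennreal 2 * ennreal (norm h powr (- s - DIM('a)))"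
        by (simp add: ennreal_mult'[symmetric] ennreal_leI del: ennreal_numeral)
      also have "\<dots> = ennreal 2 * f2 h" using h by (simp add: f2_def)
      finally show ?thesis by (rule add_increasing[rotated]) simp
    qed
  qed
  also have "\<dots> = (\<integral>\<^sup>+h. f1 h \<partial>lborel) + ennreal 2 * (\<integral>\<^sup>+h. f2 h \<partial>lborel)"
    by (subst nn_integral_add) (simp_all add: nn_integral_cmult)
  also have "\<dots> < \<infinity>"
    using near_kernel_finite[of "2 - 2 * s", where 'a='a] far_kernel_finite[of s, where 'a='a] s
    unfolding f1_def f2_def by (simp add: ennreal_mult_less_top)
  finally show ?thesis .
qed

text \<open>The substitution h = sqrt(Q) k reduces to Q = 1 and produces the power a - s;
  \<open>powr_increment_le\<close> with b = s/2 produces the factor 2a/s, which tends to 0 with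
  a.\<close>

lemma barrier_kernel:
  fixes s Q a :: real
  assumes s: "0 < s" "s < 1" and Q: "Q > 0" and a: "0 < a" "a \<le> s / 2"
  shows "(\<integral>\<^sup>+h. ennreal (((Q + (norm h)\<^sup>2) powr a - Q powr a) / norm h powr (real DIM('a) + 2 * s)) \<partial>(lborel :: 'a::euclidean_space measure))
    \<le> ennreal (Q powr (a - s) * (2 * a / s * enn2real (barrier_const TYPE('a) s)))"
proof -
  let ?c = "real DIM('a) + 2 * s"
  define \<rho> where "\<rho> = sqrt Q"
  have \<rho>: "\<rho> > 0" "\<rho>\<^sup>2 = Q" using Q by (auto simp: \<rho>_def)
  have \<rho>Q: "\<rho> powr b = Q powr (b / 2)" for b
    using Q by (simp add: \<rho>_def powr_half_sqrt[symmetric] powr_powr)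
  have scaled: "(\<integral>\<^sup>+h. ennreal (((Q + (norm h)\<^sup>2) powr a - Q powr a) / norm h powr ?c) \<partial>(lborel :: 'a measure))
     = ennreal (\<rho> ^ DIM('a)) * (\<integral>\<^sup>+k. ennreal (((Q + (norm (\<rho> *\<^sub>R k))\<^sup>2) powr a - Q powr a) / norm (\<rho> *\<^sub>R k) powr ?c) \<partial>(lborel :: 'a measure))"
    using nn_integral_lborel_affine[of "\<lambda>h::'a. ennreal (((Q + (norm h)\<^sup>2) powr a - Q powr a) / norm h powr ?c)" \<rho> 0] \<rho> by simp
  have "(\<integral>\<^sup>+k. ennreal (((Q + (norm (\<rho> *\<^sub>R k))\<^sup>2) powr a - Q powr a) / norm (\<rho> *\<^sub>R k) powr ?c) \<partial>(lborel :: 'a measure))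
     \<le> (\<integral>\<^sup>+k. ennreal (Q powr a * \<rho> powr - ?c * (2 * a / s)) * ennreal (((1 + (norm k)\<^sup>2) powr (s / 2) - 1) / norm k powr ?c) \<partial>(lborel :: 'a measure))"
  proof (intro nn_integral_mono)
    fix k :: 'a
    have "Q + (norm (\<rho> *\<^sub>R k))\<^sup>2 = Q * (1 + (norm k)\<^sup>2)"
      using \<rho> by (simp add: power_mult_distrib algebra_simps)
    moreover have "(Q * (1 + (norm k)\<^sup>2)) powr a = Q powr a * (1 + (norm k)\<^sup>2) powr a"
      using Q by (subst powr_mult) auto
    ultimately have "(Q + (norm (\<rho> *\<^sub>R k))\<^sup>2) powr a - Q powr a = Q powr a * ((1 + (norm k)\<^sup>2) powr a - 1)"
      by (simp only: right_diff_distrib mult_1_right)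
    also have "\<dots> \<le> Q powr a * ((a / (s / 2)) * ((1 + (norm k)\<^sup>2) powr (s / 2) - 1))"
      using a by (intro mult_left_mono powr_increment_le) auto
    finally have "((Q + (norm (\<rho> *\<^sub>R k))\<^sup>2) powr a - Q powr a) / norm (\<rho> *\<^sub>R k) powr ?c
       \<le> Q powr a * ((a / (s / 2)) * ((1 + (norm k)\<^sup>2) powr (s / 2) - 1)) / norm (\<rho> *\<^sub>R k) powr ?c"
      by (rule divide_right_mono) simp
    also have "\<dots> = (Q powr a * \<rho> powr - ?c * (2 * a / s)) * (((1 + (norm k)\<^sup>2) powr (s / 2) - 1) / norm k powr ?c)"
    proof -
      have "norm (\<rho> *\<^sub>R k) powr ?c = \<rho> powr ?c * norm k powr ?c" using \<rho> by (simp add: powr_mult)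
      moreover have "Q powr a * ((a / (s / 2)) * X) / (\<rho> powr ?c * Y) = (Q powr a * \<rho> powr - ?c * (2 * a / s)) * (X / Y)" for X Y
        unfolding powr_minus_divide by (simp add: field_simps)
      ultimately show ?thesis by (simp only:)
    qed
    finally have "ennreal (((Q + (norm (\<rho> *\<^sub>R k))\<^sup>2) powr a - Q powr a) / norm (\<rho> *\<^sub>R k) powr ?c)
       \<le> ennreal ((Q powr a * \<rho> powr - ?c * (2 * a / s)) * (((1 + (norm k)\<^sup>2) powr (s / 2) - 1) / norm k powr ?c))"
      by (rule ennreal_leI)
    also have "\<dots> = ennreal (Q powr a * \<rho> powr - ?c * (2 * a / s)) * ennreal (((1 + (norm k)\<^sup>2) powr (s / 2) - 1) / norm k powr ?c)"
      by (rule ennreal_mult') (use a s in auto)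
    finally show "ennreal (((Q + (norm (\<rho> *\<^sub>R k))\<^sup>2) powr a - Q powr a) / norm (\<rho> *\<^sub>R k) powr ?c)
      \<le> ennreal (Q powr a * \<rho> powr - ?c * (2 * a / s)) * ennreal (((1 + (norm k)\<^sup>2) powr (s / 2) - 1) / norm k powr ?c)" .
  qed
  also have "\<dots> = ennreal (Q powr a * \<rho> powr - ?c * (2 * a / s)) * barrier_const TYPE('a) s"
  proof -
    define K where "K k = ennreal (((1 + (norm k)\<^sup>2) powr (s / 2) - 1) / norm k powr ?c)" for k :: 'a
    have K: "K \<in> borel_measurable lborel" unfolding K_def by measurable
    show ?thesis unfolding barrier_const_def K_def[symmetric] by (rule nn_integral_cmult[OF K])
  qed
  finally have le: "(\<integral>\<^sup>+k. ennreal (((Q + (norm (\<rho> *\<^sub>R k))\<^sup>2) powr a - Q powr a) / norm (\<rho> *\<^sub>R k) powr ?c) \<partial>(lborel :: 'a measure))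
     \<le> ennreal (Q powr a * \<rho> powr - ?c * (2 * a / s)) * barrier_const TYPE('a) s" .
  define b where "b = enn2real (barrier_const TYPE('a) s)"
  have b: "barrier_const TYPE('a) s = ennreal b" "b \<ge> 0"
    using barrier_const_finite[OF s, where 'a='a] by (simp_all add: b_def)
  have as: "0 \<le> 2 * a / s" using a s by simp
  have e1: "ennreal (\<rho> ^ DIM('a)) * (ennreal (Q powr a * \<rho> powr - ?c * (2 * a / s)) * ennreal b)
     = ennreal (\<rho> ^ DIM('a) * (Q powr a * \<rho> powr - ?c * (2 * a / s) * b))"
  proof -
    have "ennreal (Q powr a * \<rho> powr - ?c * (2 * a / s)) * ennreal b = ennreal (Q powr a * \<rho> powr - ?c * (2 * a / s) * b)"
      by (intro ennreal_mult'[symmetric] mult_nonneg_nonneg as powr_ge_zero)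
    thus ?thesis using \<rho> by (simp only:) (intro ennreal_mult'[symmetric], simp)
  qed
  have e2: "\<rho> ^ DIM('a) * (Q powr a * \<rho> powr - ?c * (2 * a / s) * b) = (\<rho> ^ DIM('a) * \<rho> powr - ?c) * Q powr a * (2 * a / s * b)"
    by (simp only: mult_ac)
  have e3: "(\<rho> ^ DIM('a) * \<rho> powr - ?c) * Q powr a * (2 * a / s * b) = Q powr (a - s) * (2 * a / s * b)"
  proof -
    have "\<rho> ^ DIM('a) * \<rho> powr - ?c = \<rho> powr (- (2 * s))"
      using \<rho>(1) by (simp add: powr_realpow[symmetric] powr_add[symmetric])
    moreover have "\<rho> powr (- (2 * s)) * Q powr a = Q powr (a - s)"
      unfolding \<rho>Q by (simp add: powr_add[symmetric])
    ultimately show ?thesis by (simp only:)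
  qed
  have eq: "ennreal (\<rho> ^ DIM('a)) * (ennreal (Q powr a * \<rho> powr - ?c * (2 * a / s)) * ennreal b) = ennreal (Q powr (a - s) * (2 * a / s * b))"
    by (simp only: e1 e2 e3)
  show ?thesis unfolding scaled b_def[symmetric] eq[symmetric] b(1)[symmetric] by (rule mult_left_mono[OF le]) simp
qed

text \<open>The function |x - x0|^(2a), smoothed by \<epsilon> to be Lipschitz and capped at its
  size at distance r to be bounded.\<close>

definition barrier :: "real \<Rightarrow> real \<Rightarrow> real \<Rightarrow> 'a::euclidean_space \<Rightarrow> 'a \<Rightarrow> real" where
  "barrier a r \<epsilon> x0 x = min (((norm (x - x0))\<^sup>2 + \<epsilon>\<^sup>2) powr a) ((r\<^sup>2) powr a)"

lemma measurable_barrier[measurable]: "barrier a r \<epsilon> x0 \<in> borel_measurable borel"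
proof -
  have "barrier a r \<epsilon> x0 = (\<lambda>x. min (((norm (x - x0))\<^sup>2 + \<epsilon>\<^sup>2) powr a) ((r\<^sup>2) powr a))"
    by (simp add: barrier_def fun_eq_iff)
  thus ?thesis by simp
qed

lemma barrier_lipschitz:
  fixes x0 :: "'a::euclidean_space"
  assumes "0 \<le> a" "2 * a \<le> 1" "\<epsilon> > 0"
  shows "\<bar>barrier a r \<epsilon> x0 x - barrier a r \<epsilon> x0 y\<bar> \<le> \<epsilon> powr (2 * a - 1) * norm (x - y)"
proof -
  \<comment> \<open>The distance from (x, \<epsilon>) to (x0, 0) in the product space: 1-Lipschitz
    in x and never below \<epsilon>.\<close>
  define \<rho> where "\<rho> x = norm (x - x0, \<epsilon>)" for x
  have \<rho>2: "(\<rho> x)\<^sup>2 = (norm (x - x0))\<^sup>2 + \<epsilon>\<^sup>2" for x by (simp add: \<rho>_def norm_prod_def)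
  have \<rho>: "\<epsilon> \<le> \<rho> x" for x
  proof (rule power2_le_imp_le)
    show "\<epsilon>\<^sup>2 \<le> (\<rho> x)\<^sup>2" by (simp add: \<rho>2)
    show "0 \<le> \<rho> x" by (simp add: \<rho>_def)
  qed
  have eq: "((norm (x - x0))\<^sup>2 + \<epsilon>\<^sup>2) powr a = \<rho> x powr (2 * a)" for x
  proof -
    have "(\<rho> x)\<^sup>2 = \<rho> x powr 2" using \<rho>[of x] assms by simp
    thus ?thesis unfolding \<rho>2[symmetric] by (simp only: powr_powr)
  qed
  have lip: "\<bar>\<rho> x - \<rho> y\<bar> \<le> norm (x - y)" for x y
    using norm_triangle_ineq3[of "(x - x0, \<epsilon>)" "(y - x0, \<epsilon>)"] by (simp add: \<rho>_def norm_prod_def)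
  have le: "\<rho> x powr (2 * a) - \<rho> y powr (2 * a) \<le> \<epsilon> powr (2 * a - 1) * norm (x - y)" for x y
  proof (cases "\<rho> y \<le> \<rho> x")
    case True
    have "\<rho> x powr (2 * a) - \<rho> y powr (2 * a) \<le> \<rho> y powr (2 * a - 1) * (\<rho> x - \<rho> y)"
      using True \<rho>[of y] assms by (intro powr_diff_le) auto
    also have "\<dots> \<le> \<epsilon> powr (2 * a - 1) * norm (x - y)"
      using True \<rho>[of y] assms lip[of x y] by (intro mult_mono powr_mono2') auto
    finally show ?thesis .
  next
    case False
    hence "\<rho> x powr (2 * a) \<le> \<rho> y powr (2 * a)" using \<rho>[of x] assms by (intro powr_mono2) auto
    moreover have "0 \<le> \<epsilon> powr (2 * a - 1) * norm (x - y)" by simp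
    ultimately show ?thesis by linarith
  qed
  show ?thesis unfolding barrier_def eq
    using le[of x y] le[of y x] by (auto simp: min_def norm_minus_commute)
qed

text \<open>The parallelogram law computes the mean of the arguments at x + h and x - h, and
  concavity of the power moves the mean inside. The cap only lowers the values at these two points,
  and by hypothesis it is inactive at x.\<close>

lemma barrier_second_difference:
  fixes x0 :: "'a::euclidean_space"
  assumes a: "0 \<le> a" "a \<le> 1" and \<epsilon>: "\<epsilon> > 0" and x: "(norm (x - x0))\<^sup>2 + \<epsilon>\<^sup>2 \<le> r\<^sup>2"
  defines "Q \<equiv> (norm (x - x0))\<^sup>2 + \<epsilon>\<^sup>2"
  shows "barrier a r \<epsilon> x0 (x + h) + barrier a r \<epsilon> x0 (x - h) - 2 * barrier a r \<epsilon> x0 x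
    \<le> 2 * ((Q + (norm h)\<^sup>2) powr a - Q powr a)"
proof -
  have Q: "Q > 0" using \<epsilon> by (simp add: Q_def add_nonneg_pos)
  have bx: "barrier a r \<epsilon> x0 x = Q powr a"
    using x a Q unfolding barrier_def Q_def by (intro min_absorb1 powr_mono2) auto
  define A where "A = (norm (x + h - x0))\<^sup>2 + \<epsilon>\<^sup>2"
  define B where "B = (norm (x - h - x0))\<^sup>2 + \<epsilon>\<^sup>2"
  have AB: "A > 0" "B > 0" using \<epsilon> by (auto simp: A_def B_def add_nonneg_pos)
  have sum: "(A + B) / 2 = Q + (norm h)\<^sup>2"
  proof -
    have "(norm ((x - x0) + h))\<^sup>2 + (norm ((x - x0) - h))\<^sup>2 = 2 * (norm (x - x0))\<^sup>2 + 2 * (norm h)\<^sup>2"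
      by (simp add: power2_norm_eq_inner inner_add inner_diff inner_commute algebra_simps)
    thus ?thesis by (simp add: A_def B_def Q_def algebra_simps)
  qed
  have "barrier a r \<epsilon> x0 (x + h) + barrier a r \<epsilon> x0 (x - h) \<le> A powr a + B powr a"
    by (simp add: barrier_def A_def B_def add_mono)
  also have "\<dots> \<le> 2 * ((A + B) / 2) powr a" by (rule powr_midpoint_le[OF AB a])
  finally show ?thesis unfolding sum bx by simp
qed

context fractional_domain
begin

text \<open>Near \<open>x0\<close> the exterior balls contribute to the fractional Laplacian of the barrier, restricted
  to the domain, a positive multiple of \<open>Q powr (a - s)\<close> that does not depend on \<open>a\<close>, while the
  negative contribution of the barrier itself vanishes as \<open>a \<rightarrow> 0\<close>.\<close>

lemma boundary_comparison:
  fixes v g :: "'a \<Rightarrow> real" and x0 e :: 'a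
  assumes v: "weak_solution v g" and g: "Lp_data g" and gM: "\<And>x. g x \<le> Mg" and Mg: "Mg \<ge> 0"
    and vM: "AE x in lborel. v x \<le> Mv" and Mv: "Mv \<ge> 0"
    and e: "norm e = 1" and \<kappa>: "0 < \<kappa>" "\<kappa> \<le> 1/2" and r: "0 < r"
    and ext: "\<And>\<rho> y. 0 < \<rho> \<Longrightarrow> \<rho> \<le> r \<Longrightarrow> norm (y - (x0 + (5/2 * \<rho>) *\<^sub>R e)) < \<kappa> * \<rho> \<Longrightarrow> y \<notin> \<Omega>"
  defines "c0 \<equiv> 4 powr - (real DIM('a) + 2 * s) * \<kappa> ^ DIM('a) * measure lborel (ball (0::'a) 1)"
  assumes a: "0 < a" "a \<le> s / 2" and aI: "2 * (2 * a / s * enn2real (barrier_const TYPE('a) s)) \<le> c0"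
    and \<Lambda>: "\<Lambda> > 0" "Mv \<le> \<Lambda> * (r\<^sup>2) powr a" "Mg \<le> \<Lambda> * c0 * (r\<^sup>2) powr (a - s)" and \<epsilon>: "\<epsilon> > 0"
  shows "AE x in lborel. v x \<le> \<Lambda> * barrier a r \<epsilon> x0 x"
proof -
  let ?c = "real DIM('a) + 2 * s"
  let ?LL = "lborel \<Otimes>\<^sub>M (lborel :: 'a measure)"
  let ?b = "enn2real (barrier_const TYPE('a) s)"
  define w where "w = (barrier a r \<epsilon> x0 :: 'a \<Rightarrow> real)"
  define Q where "Q x = (norm (x - x0))\<^sup>2 + \<epsilon>\<^sup>2" for x
  have Q: "Q x > 0" "\<epsilon>\<^sup>2 \<le> Q x" for x using \<epsilon> by (auto simp: Q_def add_nonneg_pos)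
  have w_eq: "w x = min (Q x powr a) ((r\<^sup>2) powr a)" for x by (simp add: w_def barrier_def Q_def)
  have [measurable]: "Q \<in> borel_measurable borel" unfolding Q_def by measurable
  have [measurable]: "w \<in> borel_measurable borel" unfolding w_def by measurable
  have w0: "w x > 0" for x using Q[of x] r by (simp add: w_eq)
  have wle: "w x \<le> (r\<^sup>2) powr a" for x by (simp add: w_eq)
  have wb: "\<bar>w x - w y\<bar> \<le> (r\<^sup>2) powr a" for x y using w0[of x] w0[of y] wle[of x] wle[of y] by linarith
  have wl: "\<bar>w x - w y\<bar> \<le> \<epsilon> powr (2 * a - 1) * norm (x - y)" for x y
    unfolding w_def using a s \<epsilon> by (intro barrier_lipschitz) auto
  have vE: "v \<in> energy_space \<Omega> s" using v by (simp add: weak_solution_def)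
  note [measurable] = energy_spaceD(1)[OF vE]
  have [measurable]: "g \<in> borel_measurable borel" using g by (simp add: Lp_data_def)
  \<comment> \<open>A representative of v for which the bound \<open>Mv\<close> and the vanishing
    outside \<Omega> hold at every point.\<close>
  define u where "u x = (if x \<in> \<Omega> \<and> v x \<le> Mv then v x else 0)" for x
  have [measurable]: "u \<in> borel_measurable borel" unfolding u_def by measurable
  have uv: "AE x in lborel. v x = u x"
    using vM energy_spaceD(2)[OF vE] by eventually_elim (auto simp: u_def)
  have uE: "u \<in> energy_space \<Omega> s" by (rule energy_space_cong[OF vE _ uv]) simp
  define \<phi> where "\<phi> x = max 0 (u x - \<Lambda> * w x)" for x
  have [measurable]: "\<phi> \<in> borel_measurable borel" unfolding \<phi>_def by measurable
  have \<phi>0: "0 \<le> \<phi> x" for x by (simp add: \<phi>_def)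
  have u0: "u x = 0" "\<phi> x = 0" if "x \<notin> \<Omega>" for x
    using that w0[of x] \<Lambda>(1) by (auto simp: u_def \<phi>_def)
  have uMv: "u x \<le> Mv" for x using Mv by (simp add: u_def)
  \<comment> \<open>Where \<open>Q x\<close> exceeds \<open>r\<^sup>2\<close> the barrier has
    reached its cap, and \<Lambda> times the cap is at least \<open>Mv\<close>.\<close>
  have supp: "x \<in> \<Omega>" "Q x \<le> r\<^sup>2" if "\<phi> x \<noteq> 0" for x
  proof -
    show "x \<in> \<Omega>" using u0 that by blast
    show "Q x \<le> r\<^sup>2"
    proof (rule ccontr)
      assume "\<not> Q x \<le> r\<^sup>2"
      hence "(r\<^sup>2) powr a \<le> Q x powr a" using a by (intro powr_mono2) auto
      hence "w x = (r\<^sup>2) powr a" by (simp add: w_eq)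
      thus False using that uMv[of x] \<Lambda>(2) by (simp add: \<phi>_def max_def split: if_splits)
    qed
  qed
  have wQ: "w x = Q x powr a" if "\<phi> x \<noteq> 0" for x
    using supp(2)[OF that] Q[of x] a unfolding w_eq by (intro min_absorb1 powr_mono2) auto
  have \<phi>le: "\<phi> x \<le> Mv * indicat_real \<Omega> x" for x
  proof (cases "x \<in> \<Omega>")
    case True
    thus ?thesis using uMv[of x] w0[of x] \<Lambda>(1) Mv by (simp add: \<phi>_def) (smt (verit) mult_pos_pos)
  qed (simp add: u0)
  have \<phi>i: "integrable lborel \<phi>"
  proof (rule Bochner_Integration.integrable_bound)
    show "integrable lborel (\<lambda>x. Mv * indicat_real \<Omega> x)" using domain_finite by simp
    show "AE x in lborel. norm (\<phi> x) \<le> norm (Mv * indicat_real \<Omega> x)"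
      using \<phi>le \<phi>0 by (intro AE_I2) (smt (verit) real_norm_def)
  qed simp
  define S where "S = {z :: 'a \<times> 'a. fst z \<in> \<Omega> \<or> snd z \<in> \<Omega>}"
  have Sm[measurable]: "S \<in> sets ?LL"
    unfolding S_def by (rule lipschitz_gag_integrable(1)[OF s domain_borel domain_finite _ wb wl]) simp
  have W2: "integrable ?LL (\<lambda>z. (indicat_real S z * gag s w z)\<^sup>2)"
    unfolding S_def by (rule lipschitz_gag_integrable(2)[OF s domain_borel domain_finite _ wb wl]) simp
  have \<phi>E: "\<phi> \<in> energy_space \<Omega> s"
  proof -
    have "integrable ?LL (\<lambda>z. (gag s \<phi> z)\<^sup>2)"
    proof (rule Bochner_Integration.integrable_bound)
      show "integrable ?LL (\<lambda>z. 2 * (gag s u z)\<^sup>2 + 2 * \<Lambda>\<^sup>2 * (indicat_real S z * gag s w z)\<^sup>2)"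
        using energy_spaceD(3)[OF uE] W2 by simp
      show "AE z in ?LL. norm ((gag s \<phi> z)\<^sup>2) \<le> norm (2 * (gag s u z)\<^sup>2 + 2 * \<Lambda>\<^sup>2 * (indicat_real S z * gag s w z)\<^sup>2)"
      proof (intro AE_I2)
        fix z
        have "(gag s \<phi> z)\<^sup>2 \<le> 2 * (gag s u z)\<^sup>2 + 2 * \<Lambda>\<^sup>2 * (indicat_real S z * gag s w z)\<^sup>2"
        proof (cases "z \<in> S")
          case False
          thus ?thesis by (cases z) (simp add: S_def gag_def u0)
        next
          case True
          obtain x y where z: "z = (x, y)" by (cases z)
          let ?n = "norm (x - y) powr (real DIM('a) / 2 + s)"
          have "\<bar>\<phi> x - \<phi> y\<bar> \<le> \<bar>(u x - u y) - \<Lambda> * (w x - w y)\<bar>"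
            unfolding \<phi>_def right_diff_distrib by linarith
          hence "\<bar>\<phi> x - \<phi> y\<bar> / ?n \<le> \<bar>(u x - u y) - \<Lambda> * (w x - w y)\<bar> / ?n" by (rule divide_right_mono) simp
          hence "\<bar>gag s \<phi> z\<bar> \<le> \<bar>gag s u z - \<Lambda> * gag s w z\<bar>"
            by (simp add: z gag_def diff_divide_distrib[symmetric])
          hence "(gag s \<phi> z)\<^sup>2 \<le> (gag s u z - \<Lambda> * gag s w z)\<^sup>2" by (simp add: abs_le_square_iff)
          also have "\<dots> \<le> 2 * (gag s u z)\<^sup>2 + 2 * (\<Lambda> * gag s w z)\<^sup>2"
            using zero_le_power2[of "gag s u z + \<Lambda> * gag s w z"] by (simp add: power2_sum power2_diff)
          finally show ?thesis using True by (simp add: power_mult_distrib)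
        qed
        thus "norm ((gag s \<phi> z)\<^sup>2) \<le> norm (2 * (gag s u z)\<^sup>2 + 2 * \<Lambda>\<^sup>2 * (indicat_real S z * gag s w z)\<^sup>2)" by simp
      qed
    qed simp
    thus ?thesis using u0 by (auto simp: energy_space_def)
  qed
  \<comment> \<open>The common density: the datum, the defect of the barrier and the gain from the
    exterior balls are all measured against the integral of \<open>R\<close>.\<close>
  define R where "R x = \<phi> x * Q x powr (a - s)" for x
  have [measurable]: "R \<in> borel_measurable borel" unfolding R_def by measurable
  have R0: "0 \<le> R x" for x using \<phi>0 by (simp add: R_def)
  have Ri: "integrable lborel R"
  proof (rule Bochner_Integration.integrable_bound)
    show "integrable lborel (\<lambda>x. (\<epsilon>\<^sup>2) powr (a - s) * \<phi> x)" using \<phi>i by simp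
    show "AE x in lborel. norm (R x) \<le> norm ((\<epsilon>\<^sup>2) powr (a - s) * \<phi> x)"
    proof (intro AE_I2)
      fix x
      have "Q x powr (a - s) \<le> (\<epsilon>\<^sup>2) powr (a - s)" using Q[of x] \<epsilon> a s by (intro powr_mono2') auto
      hence "R x \<le> (\<epsilon>\<^sup>2) powr (a - s) * \<phi> x" unfolding R_def using \<phi>0[of x] by (subst mult.commute) (rule mult_right_mono)
      thus "norm (R x) \<le> norm ((\<epsilon>\<^sup>2) powr (a - s) * \<phi> x)" using R0[of x] by simp
    qed
  qed simp
  define P where "P x = Q x powr (a - s) * (2 * a / s * ?b)" for x
  have P0: "0 \<le> P x" for x using a s by (simp add: P_def)
  have \<phi>P: "\<phi> x * P x = (2 * a / s * ?b) * R x" for x by (simp add: P_def R_def)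
  have sh: "integrable ?LL (\<lambda>z. gag s w z * gag s \<phi> z)"
    "- 2 * (\<integral>x. \<phi> x * P x \<partial>lborel) \<le> (\<integral>z. gag s w z * gag s \<phi> z \<partial>?LL)"
  proof -
    have sec: "(\<integral>\<^sup>+h. ennreal ((w (x + h) + w (x - h) - 2 * w x) / norm h powr ?c) \<partial>lborel) \<le> ennreal (2 * P x)" if "\<phi> x \<noteq> 0" for x
    proof -
      have "(\<integral>\<^sup>+h. ennreal ((w (x + h) + w (x - h) - 2 * w x) / norm h powr ?c) \<partial>lborel)
        \<le> (\<integral>\<^sup>+h. 2 * ennreal (((Q x + (norm h)\<^sup>2) powr a - Q x powr a) / norm h powr ?c) \<partial>(lborel :: 'a measure))"
      proof (intro nn_integral_mono)
        fix h
        have "w (x + h) + w (x - h) - 2 * w x \<le> 2 * ((Q x + (norm h)\<^sup>2) powr a - Q x powr a)"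
          unfolding w_def Q_def using supp(2)[OF that] a s \<epsilon>
          by (intro barrier_second_difference) (auto simp: Q_def)
        hence "(w (x + h) + w (x - h) - 2 * w x) / norm h powr ?c \<le> 2 * ((Q x + (norm h)\<^sup>2) powr a - Q x powr a) / norm h powr ?c"
          by (rule divide_right_mono) simp
        hence "ennreal ((w (x + h) + w (x - h) - 2 * w x) / norm h powr ?c) \<le> ennreal (2 * (((Q x + (norm h)\<^sup>2) powr a - Q x powr a) / norm h powr ?c))"
          by (intro ennreal_leI) (simp only: times_divide_eq_right)
        also have "\<dots> = 2 * ennreal (((Q x + (norm h)\<^sup>2) powr a - Q x powr a) / norm h powr ?c)"
          by (subst ennreal_mult') simp_all
        finally show "ennreal ((w (x + h) + w (x - h) - 2 * w x) / norm h powr ?c)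
          \<le> 2 * ennreal (((Q x + (norm h)\<^sup>2) powr a - Q x powr a) / norm h powr ?c)" .
      qed
      also have "\<dots> = 2 * (\<integral>\<^sup>+h. ennreal (((Q x + (norm h)\<^sup>2) powr a - Q x powr a) / norm h powr ?c) \<partial>(lborel :: 'a measure))"
        by (rule nn_integral_cmult) simp
      also have "\<dots> \<le> 2 * ennreal (P x)"
        unfolding P_def using barrier_kernel[OF s Q(1) a, where 'a='a] by (rule mult_left_mono) simp
      also have "\<dots> = ennreal (2 * P x)" by (subst ennreal_mult') simp_all
      finally show ?thesis .
    qed
    have Pi: "integrable lborel (\<lambda>x. \<phi> x * P x)" unfolding \<phi>P using Ri by simp
    show "integrable ?LL (\<lambda>z. gag s w z * gag s \<phi> z)"
      by (rule weakly_superharmonic(1)[OF s domain_borel domain_finite _ wb wl \<phi>E \<phi>0 \<phi>i P0 Pi sec]) simp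
    show "- 2 * (\<integral>x. \<phi> x * P x \<partial>lborel) \<le> (\<integral>z. gag s w z * gag s \<phi> z \<partial>?LL)"
      by (rule weakly_superharmonic(2)[OF s domain_borel domain_finite _ wb wl \<phi>E \<phi>0 \<phi>i P0 Pi sec]) simp
  qed
  define \<rho> where "\<rho> x = sqrt (Q x)" for x
  have [measurable]: "\<rho> \<in> borel_measurable borel" unfolding \<rho>_def by measurable
  have \<rho>: "\<rho> x > 0" "(\<rho> x)\<^sup>2 = Q x" "norm (x - x0) \<le> \<rho> x" for x
    using Q[of x] by (auto simp: \<rho>_def Q_def intro!: real_le_rsqrt)
  define cen where "cen x = x0 + (5/2 * \<rho> x) *\<^sub>R e" for x
  have [measurable]: "cen \<in> borel_measurable borel" unfolding cen_def by measurable
  \<comment> \<open>\<open>T x y\<close> says that y lies in the exterior ball whose scale is the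
    regularised distance \<open>\<rho> x\<close>.\<close>
  define T where "T x y = (norm (y - cen x) < \<kappa> * \<rho> x)" for x y
  have [measurable]: "Measurable.pred ?LL (\<lambda>z. T (fst z) (snd z))" "\<And>x. Measurable.pred borel (T x)"
    unfolding T_def by measurable
  have Tout: "y \<notin> \<Omega>" if "\<phi> x \<noteq> 0" "T x y" for x y
  proof -
    have "\<rho> x \<le> r" using supp(2)[OF that(1)] r unfolding \<rho>_def by (intro real_le_lsqrt) auto
    thus ?thesis using ext[OF \<rho>(1)[of x]] that(2) by (simp add: T_def cen_def)
  qed
  have Tdist: "2 * \<rho> x \<le> norm (y - x0)" "0 < norm (x - y)" "norm (x - y) \<le> 4 * \<rho> x" if "T x y" for x y
  proof -
    have y: "y - x0 = (y - cen x) + (5/2 * \<rho> x) *\<^sub>R e" by (simp add: cen_def)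
    have n: "norm ((5/2 * \<rho> x) *\<^sub>R e) = 5/2 * \<rho> x" using e \<rho>(1)[of x] by simp
    have t: "norm (y - cen x) \<le> 1/2 * \<rho> x"
    proof -
      have "\<kappa> * \<rho> x \<le> 1/2 * \<rho> x" using \<kappa>(2) \<rho>(1)[of x] by (intro mult_right_mono) auto
      thus ?thesis using that unfolding T_def by linarith
    qed
    show 1: "2 * \<rho> x \<le> norm (y - x0)"
    proof -
      have "(5/2 * \<rho> x) *\<^sub>R e = (y - x0) - (y - cen x)" by (simp add: cen_def)
      hence "norm ((5/2 * \<rho> x) *\<^sub>R e) \<le> norm (y - x0) + norm (y - cen x)" by (simp only: norm_triangle_ineq4)
      thus ?thesis using t n by linarith
    qed
    have 2: "norm (y - x0) \<le> 3 * \<rho> x"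
    proof -
      have "norm (y - x0) \<le> norm (y - cen x) + norm ((5/2 * \<rho> x) *\<^sub>R e)" by (simp only: y norm_triangle_ineq)
      thus ?thesis using t n by linarith
    qed
    show "0 < norm (x - y)"
    proof -
      have "x \<noteq> y" using 1 \<rho>(1,3)[of x] by (auto simp: not_le)
      thus ?thesis by simp
    qed
    have "norm (x - y) \<le> norm (x - x0) + norm (y - x0)"
      using norm_triangle_ineq4[of "x - x0" "y - x0"] by simp
    thus "norm (x - y) \<le> 4 * \<rho> x" using 2 \<rho>(3)[of x] by simp
  qed
  \<comment> \<open>The extra interaction of x with the exterior ball at its own scale. It comes
    from the values of w outside \<Omega>, where the solution vanishes.\<close>
  define \<Gamma> where "\<Gamma> x y = \<phi> x * (w y * (if T x y then 1 else 0) / norm (x - y) powr ?c)" for x y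
  have \<Gamma>m[measurable]: "(\<lambda>(x, y). \<Gamma> x y) \<in> borel_measurable ?LL"
    unfolding \<Gamma>_def case_prod_beta by measurable
  have \<Gamma>0: "0 \<le> \<Gamma> x y" for x y using \<phi>0[of x] w0[of y] by (simp add: \<Gamma>_def)
  have c0: "c0 > 0" unfolding c0_def using \<kappa> content_ball_pos[of 1 "0::'a"] by simp
  \<comment> \<open>Points of the exterior ball are farther from x0 than x, so w is at least
    \<open>w x\<close> there; their distance from x is at most \<open>4 * \<rho> x\<close>, and the
    volume is that of a ball of radius \<open>\<kappa> * \<rho> x\<close>. These facts give exactly
    \<open>c0\<close>.\<close>
  have G: "ennreal (c0 * Q x powr (a - s)) \<le> (\<integral>\<^sup>+y. ennreal (w y * (if T x y then 1 else 0) / norm (x - y) powr ?c) \<partial>lborel)"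
    if "\<phi> x \<noteq> 0" for x
  proof -
    let ?m = "w x * (4 * \<rho> x) powr - ?c"
    have ball: "{y. T x y} = ball (cen x) (\<kappa> * \<rho> x)" by (auto simp: T_def dist_norm norm_minus_commute)
    have "measure lborel (ball (cen x) (\<kappa> * \<rho> x)) = (\<kappa> * \<rho> x) ^ DIM('a) * measure lborel (ball (0::'a) 1)"
      using \<kappa> \<rho>(1)[of x] by (intro content_ball_conv_unit_ball) simp
    hence em: "emeasure lborel (ball (cen x) (\<kappa> * \<rho> x)) = ennreal ((\<kappa> * \<rho> x) ^ DIM('a) * measure lborel (ball (0::'a) 1))"
      using emeasure_lborel_ball_finite[of "cen x" "\<kappa> * \<rho> x"] by (simp add: emeasure_eq_ennreal_measure)
    have "c0 * Q x powr (a - s) = ?m * ((\<kappa> * \<rho> x) ^ DIM('a) * measure lborel (ball (0::'a) 1))"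
    proof -
      have 1: "\<rho> x powr b = Q x powr (b / 2)" for b
        using Q[of x] by (simp add: \<rho>_def powr_half_sqrt[symmetric] powr_powr)
      have 2: "(4 * \<rho> x) powr - ?c = 4 powr - ?c * \<rho> x powr - ?c" using \<rho>(1)[of x] by (subst powr_mult) auto
      have "\<rho> x ^ DIM('a) = \<rho> x powr DIM('a)" using \<rho>(1)[of x] by (simp add: powr_realpow)
      hence "\<rho> x powr - ?c * \<rho> x ^ DIM('a) = \<rho> x powr (- ?c + DIM('a))" by (simp only: powr_add)
      also have "- ?c + DIM('a) = - (2 * s)" by simp
      finally have 3: "\<rho> x powr - ?c * \<rho> x ^ DIM('a) = Q x powr (- s)" using 1[of "- (2 * s)"] by simp
      have 4: "Q x powr (a - s) = Q x powr a * Q x powr (- s)" by (simp add: powr_add[symmetric])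
      show ?thesis unfolding c0_def wQ[OF that] 2 power_mult_distrib 4 3[symmetric] by (simp only: mult_ac)
    qed
    hence "ennreal (c0 * Q x powr (a - s)) = ennreal ?m * emeasure lborel (ball (cen x) (\<kappa> * \<rho> x))"
      unfolding em using w0[of x] by (simp add: ennreal_mult'[symmetric])
    also have "\<dots> = (\<integral>\<^sup>+y. ennreal ?m * indicator (ball (cen x) (\<kappa> * \<rho> x)) y \<partial>lborel)"
      by (subst nn_integral_cmult_indicator) simp_all
    also have "\<dots> \<le> (\<integral>\<^sup>+y. ennreal (w y * (if T x y then 1 else 0) / norm (x - y) powr ?c) \<partial>lborel)"
    proof (intro nn_integral_mono)
      fix y
      show "ennreal ?m * indicator (ball (cen x) (\<kappa> * \<rho> x)) y \<le> ennreal (w y * (if T x y then 1 else 0) / norm (x - y) powr ?c)"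
      proof (cases "T x y")
        case True
        note td = Tdist[OF True]
        have "\<rho> x \<le> norm (y - x0)" using td(1) \<rho>(1)[of x] by linarith
        hence "(\<rho> x)\<^sup>2 \<le> (norm (y - x0))\<^sup>2" using \<rho>(1)[of x] by (intro power_mono) auto
        moreover have "(norm (y - x0))\<^sup>2 \<le> Q y" by (simp add: Q_def)
        ultimately have "Q x \<le> Q y" unfolding \<rho>(2) by (rule order_trans)
        hence "Q x powr a \<le> Q y powr a" using a Q[of x] by (intro powr_mono2) auto
        hence "w x \<le> w y" unfolding w_eq by (rule min.mono) simp
        moreover have "(4 * \<rho> x) powr - ?c \<le> norm (x - y) powr - ?c"
          using td(2,3) s by (intro powr_mono2') auto
        ultimately have "?m \<le> w y * norm (x - y) powr - ?c"
          using w0[of y] by (intro mult_mono) auto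
        also have "\<dots> = w y / norm (x - y) powr ?c" by (simp only: powr_minus_divide) simp
        finally have "ennreal ?m \<le> ennreal (w y / norm (x - y) powr ?c)" by (rule ennreal_leI)
        moreover have "y \<in> ball (cen x) (\<kappa> * \<rho> x)" using True unfolding ball[symmetric] by (rule CollectI)
        ultimately show ?thesis using True by (simp only: indicator_simps if_True mult_1_right)
      next
        case False
        hence "y \<notin> ball (cen x) (\<kappa> * \<rho> x)" unfolding ball[symmetric] by simp
        hence "indicator (ball (cen x) (\<kappa> * \<rho> x)) y = (0 :: ennreal)" by (rule indicator_simps(2))
        thus ?thesis by (simp only: mult_zero_right zero_le)
      qed
    qed
    finally show ?thesis .
  qed
  \<comment> \<open>If \<phi> is nonzero at x and y lies in its exterior ball, then \<phi> vanishes
    at y while u - \<Lambda> w equals -\<Lambda> w there, so the product exceeds the square by the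
    term in \<Gamma>. For all other pairs the monotonicity of the positive part suffices.\<close>
  have pt: "(gag s \<phi> z)\<^sup>2 + \<Lambda> * ((case z of (x, y) \<Rightarrow> \<Gamma> x y) + (case z of (x, y) \<Rightarrow> \<Gamma> y x)) \<le> gag s u z * gag s \<phi> z - \<Lambda> * (gag s w z * gag s \<phi> z)" for z
  proof -
    obtain x y where z: "z = (x, y)" by (cases z)
    define d where "d x = u x - \<Lambda> * w x" for x
    have \<phi>d: "\<phi> x = max 0 (d x)" for x by (simp add: \<phi>_def d_def)
    let ?ga = "\<lambda>x y. \<phi> x * (w y * (if T x y then 1 else 0))"
    have side: "(\<phi> x - \<phi> y)\<^sup>2 + \<Lambda> * (?ga x y + ?ga y x) \<le> (d x - d y) * (\<phi> x - \<phi> y)" if h: "\<phi> x \<noteq> 0" "T x y" for x y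
    proof -
      have y: "\<phi> y = 0" "d y = - \<Lambda> * w y" using u0[OF Tout[OF h]] by (auto simp: d_def)
      have dx: "d x = \<phi> x" using h(1) by (auto simp: \<phi>d max_def split: if_splits)
      show ?thesis using h(2) unfolding y dx by (simp add: power2_eq_square algebra_simps)
    qed
    have key: "(\<phi> x - \<phi> y)\<^sup>2 + \<Lambda> * (?ga x y + ?ga y x) \<le> (d x - d y) * (\<phi> x - \<phi> y)"
    proof (cases "\<phi> x \<noteq> 0 \<and> T x y")
      case True thus ?thesis using side by blast
    next
      case 1: False
      show ?thesis
      proof (cases "\<phi> y \<noteq> 0 \<and> T y x")
        case True
        have "(\<phi> y - \<phi> x)\<^sup>2 + \<Lambda> * (?ga y x + ?ga x y) \<le> (d y - d x) * (\<phi> y - \<phi> x)" using side True by blast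
        thus ?thesis by (simp add: power2_commute algebra_simps)
      next
        case 2: False
        have "?ga x y = 0" "?ga y x = 0" using 1 2 by auto
        moreover have "(\<phi> x - \<phi> y)\<^sup>2 \<le> (d x - d y) * (\<phi> x - \<phi> y)"
          unfolding \<phi>d by (rule pos_part_square_le)
        ultimately show ?thesis by (simp only: add_0_right mult_zero_right)
      qed
    qed
    let ?n = "norm (x - y) powr ?c"
    have "((\<phi> x - \<phi> y)\<^sup>2 + \<Lambda> * (?ga x y + ?ga y x)) / ?n \<le> ((d x - d y) * (\<phi> x - \<phi> y)) / ?n"
      using key by (rule divide_right_mono) simp
    moreover have "((\<phi> x - \<phi> y)\<^sup>2 + \<Lambda> * (?ga x y + ?ga y x)) / ?n = (gag s \<phi> z)\<^sup>2 + \<Lambda> * (\<Gamma> x y + \<Gamma> y x)"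
    proof -
      have "(gag s \<phi> z)\<^sup>2 = (\<phi> x - \<phi> y)\<^sup>2 / ?n" by (simp add: z power2_eq_square[of "gag _ _ _"] gag_mult) (simp add: power2_eq_square)
      moreover have "\<Gamma> x y = ?ga x y / ?n" "\<Gamma> y x = ?ga y x / ?n" by (simp_all add: \<Gamma>_def norm_minus_commute)
      moreover have "(A + \<Lambda> * (B + C)) / n = A / n + \<Lambda> * (B / n + C / n)" for A B C n :: real
        by (simp add: add_divide_distrib distrib_left)
      ultimately show ?thesis by (simp only:)
    qed
    moreover have "((d x - d y) * (\<phi> x - \<phi> y)) / ?n = gag s u z * gag s \<phi> z - \<Lambda> * (gag s w z * gag s \<phi> z)"
    proof -
      have "(d x - d y) * (\<phi> x - \<phi> y) = (u x - u y) * (\<phi> x - \<phi> y) - \<Lambda> * ((w x - w y) * (\<phi> x - \<phi> y))"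
        by (simp add: d_def algebra_simps)
      thus ?thesis unfolding z gag_mult by (simp only: diff_divide_distrib times_divide_eq_right)
    qed
    ultimately show ?thesis by (simp only: z prod.case)
  qed
  have rhs: "integrable ?LL (\<lambda>z. gag s u z * gag s \<phi> z - \<Lambda> * (gag s w z * gag s \<phi> z))"
    using energy_space_integrable[OF uE \<phi>E] sh(1) by simp
  have \<Gamma>i: "integrable ?LL (\<lambda>(x, y). \<Gamma> x y)"
  proof (rule Bochner_Integration.integrable_bound)
    show "integrable ?LL (\<lambda>z. (gag s u z * gag s \<phi> z - \<Lambda> * (gag s w z * gag s \<phi> z)) / \<Lambda>)" using rhs by simp
    show "AE z in ?LL. norm (case z of (x, y) \<Rightarrow> \<Gamma> x y) \<le> norm ((gag s u z * gag s \<phi> z - \<Lambda> * (gag s w z * gag s \<phi> z)) / \<Lambda>)"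
    proof (intro AE_I2)
      fix z :: "'a \<times> 'a"
      obtain x y where z: "z = (x, y)" by (cases z)
      have "\<Lambda> * \<Gamma> x y \<le> (gag s \<phi> z)\<^sup>2 + \<Lambda> * (\<Gamma> x y + \<Gamma> y x)"
        using \<Gamma>0[of y x] \<Lambda>(1) by (simp add: distrib_left)
      also have "\<dots> \<le> gag s u z * gag s \<phi> z - \<Lambda> * (gag s w z * gag s \<phi> z)" using pt[of z] by (simp add: z)
      finally have "\<Gamma> x y \<le> (gag s u z * gag s \<phi> z - \<Lambda> * (gag s w z * gag s \<phi> z)) / \<Lambda>"
        using \<Lambda>(1) by (subst pos_le_divide_eq) (auto simp: mult.commute)
      thus "norm (case z of (x, y) \<Rightarrow> \<Gamma> x y) \<le> norm ((gag s u z * gag s \<phi> z - \<Lambda> * (gag s w z * gag s \<phi> z)) / \<Lambda>)"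
        using \<Gamma>0[of x y] by (simp only: z prod.case real_norm_def)
    qed
  qed simp
  have \<Gamma>i': "integrable ?LL (\<lambda>(x, y). \<Gamma> y x)" using lborel_pair.integrable_product_swap[OF \<Gamma>i] by simp
  have \<Gamma>swap: "(\<integral>(x, y). \<Gamma> y x \<partial>?LL) = (\<integral>(x, y). \<Gamma> x y \<partial>?LL)"
    using lborel_pair.integral_product_swap[OF \<Gamma>m] by simp
  have \<Gamma>low: "c0 * (\<integral>x. R x \<partial>lborel) \<le> (\<integral>(x, y). \<Gamma> x y \<partial>?LL)"
  proof -
    have "ennreal (c0 * (\<integral>x. R x \<partial>lborel)) = (\<integral>\<^sup>+x. ennreal (c0 * R x) \<partial>lborel)"
      using Ri R0 c0 by (subst nn_integral_eq_integral) auto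
    also have "\<dots> \<le> (\<integral>\<^sup>+x. \<integral>\<^sup>+y. ennreal (\<Gamma> x y) \<partial>lborel \<partial>lborel)"
    proof (rule nn_integral_mono)
      fix x
      let ?f = "\<lambda>y. ennreal (w y * (if T x y then 1 else 0) / norm (x - y) powr ?c)"
      have fm: "?f \<in> borel_measurable lborel" by measurable
      show "ennreal (c0 * R x) \<le> (\<integral>\<^sup>+y. ennreal (\<Gamma> x y) \<partial>lborel)"
      proof (cases "\<phi> x = 0")
        case False
        have "ennreal (c0 * R x) = ennreal (\<phi> x) * ennreal (c0 * Q x powr (a - s))"
          using \<phi>0[of x] by (simp add: R_def ennreal_mult'[symmetric] mult_ac)
        also have "\<dots> \<le> ennreal (\<phi> x) * (\<integral>\<^sup>+y. ?f y \<partial>lborel)" by (rule mult_left_mono[OF G[OF False]]) simp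
        also have "\<dots> = (\<integral>\<^sup>+y. ennreal (\<phi> x) * ?f y \<partial>lborel)" by (rule nn_integral_cmult[OF fm, symmetric])
        also have "\<dots> = (\<integral>\<^sup>+y. ennreal (\<Gamma> x y) \<partial>lborel)"
          unfolding \<Gamma>_def by (intro nn_integral_cong ennreal_mult'[symmetric] \<phi>0)
        finally show ?thesis .
      qed (simp add: R_def)
    qed
    also have "\<dots> = (\<integral>\<^sup>+z. ennreal (case z of (x, y) \<Rightarrow> \<Gamma> x y) \<partial>?LL)"
      by (subst lborel.nn_integral_fst[symmetric]) simp_all
    also have "\<dots> = ennreal (\<integral>(x, y). \<Gamma> x y \<partial>?LL)"
      using \<Gamma>i \<Gamma>0 by (intro nn_integral_eq_integral) auto
    finally show ?thesis using \<Gamma>0 by (subst (asm) ennreal_le_iff) (auto intro!: integral_nonneg_AE)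
  qed
  have "energy s \<phi> \<phi> + 2 * \<Lambda> * (\<integral>(x, y). \<Gamma> x y \<partial>?LL) = (\<integral>z. (gag s \<phi> z)\<^sup>2 + \<Lambda> * ((case z of (x, y) \<Rightarrow> \<Gamma> x y) + (case z of (x, y) \<Rightarrow> \<Gamma> y x)) \<partial>?LL)"
    using energy_spaceD(3)[OF \<phi>E] \<Gamma>i \<Gamma>i' \<Gamma>swap by (simp add: energy_def power2_eq_square)
  also have "\<dots> \<le> (\<integral>z. gag s u z * gag s \<phi> z - \<Lambda> * (gag s w z * gag s \<phi> z) \<partial>?LL)"
    using energy_spaceD(3)[OF \<phi>E] \<Gamma>i \<Gamma>i' rhs pt by (intro integral_mono) auto
  also have "\<dots> = energy s u \<phi> - \<Lambda> * (\<integral>z. gag s w z * gag s \<phi> z \<partial>?LL)"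
    using energy_space_integrable[OF uE \<phi>E] sh(1) by (simp add: energy_def)
  finally have main: "energy s \<phi> \<phi> + 2 * \<Lambda> * (\<integral>(x, y). \<Gamma> x y \<partial>?LL) \<le> energy s u \<phi> - \<Lambda> * (\<integral>z. gag s w z * gag s \<phi> z \<partial>?LL)" .
  have t1: "energy s u \<phi> \<le> \<Lambda> * c0 * (\<integral>x. R x \<partial>lborel)"
  proof -
    have "energy s u \<phi> = energy s v \<phi>" using uv by (intro energy_cong) (auto elim!: eventually_mono)
    also have "\<dots> = (\<integral>x. g x * \<phi> x \<partial>lborel)" using v \<phi>E by (simp add: weak_solution_def)
    also have "\<dots> \<le> (\<integral>x. \<Lambda> * c0 * R x \<partial>lborel)"
    proof (rule integral_mono)
      show "integrable lborel (\<lambda>x. g x * \<phi> x)"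
        by (rule data_bound(1)[OF g \<phi>E domain_borel order_refl energy_spaceD(2)[OF \<phi>E]])
      show "integrable lborel (\<lambda>x. \<Lambda> * c0 * R x)" using Ri by simp
      fix x
      show "g x * \<phi> x \<le> \<Lambda> * c0 * R x"
      proof (cases "\<phi> x = 0")
        case False
        have "(r\<^sup>2) powr (a - s) \<le> Q x powr (a - s)" using supp(2)[OF False] Q[of x] a s by (intro powr_mono2') auto
        hence "\<Lambda> * c0 * (r\<^sup>2) powr (a - s) \<le> \<Lambda> * c0 * Q x powr (a - s)" using \<Lambda>(1) c0 by (intro mult_left_mono) auto
        hence "g x \<le> \<Lambda> * c0 * Q x powr (a - s)" using gM[of x] \<Lambda>(3) by linarith
        hence "g x * \<phi> x \<le> (\<Lambda> * c0 * Q x powr (a - s)) * \<phi> x" using \<phi>0[of x] by (rule mult_right_mono)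
        thus ?thesis by (simp only: R_def mult_ac)
      qed (simp add: R_def)
    qed
    finally show ?thesis by simp
  qed
  have t2: "- \<Lambda> * (\<integral>z. gag s w z * gag s \<phi> z \<partial>?LL) \<le> \<Lambda> * (c0 * (\<integral>x. R x \<partial>lborel))"
  proof -
    have "- (\<integral>z. gag s w z * gag s \<phi> z \<partial>?LL) \<le> 2 * (\<integral>x. \<phi> x * P x \<partial>lborel)" using sh(2) by linarith
    also have "\<dots> = 2 * (2 * a / s * ?b) * (\<integral>x. R x \<partial>lborel)" unfolding \<phi>P by simp
    also have "\<dots> \<le> c0 * (\<integral>x. R x \<partial>lborel)" using aI R0 by (intro mult_right_mono) (auto intro!: integral_nonneg_AE)
    finally have "\<Lambda> * - (\<integral>z. gag s w z * gag s \<phi> z \<partial>?LL) \<le> \<Lambda> * (c0 * (\<integral>x. R x \<partial>lborel))" using \<Lambda>(1) by (intro mult_left_mono) auto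
    thus ?thesis by simp
  qed
  have t3: "\<Lambda> * (c0 * (\<integral>x. R x \<partial>lborel)) \<le> \<Lambda> * (\<integral>(x, y). \<Gamma> x y \<partial>?LL)"
    using \<Gamma>low \<Lambda>(1) by (intro mult_left_mono) auto
  \<comment> \<open>\<Gamma> occurs twice, once for each order of the pair: one copy absorbs the
    datum, the other the defect of the barrier.\<close>
  have "energy s \<phi> \<phi> \<le> 0" using main t1 t2 t3 by (simp add: mult.assoc)
  hence "energy s \<phi> \<phi> = 0" using energy_nonneg[of s \<phi>] by simp
  hence "(\<integral>x. (\<phi> x)\<^sup>2 \<partial>lborel) \<le> 0"
    using faber_krahn(2)[OF \<phi>E s(1) domain_borel domain_finite energy_spaceD(2)[OF \<phi>E]] by simp
  moreover have "0 \<le> (\<integral>x. (\<phi> x)\<^sup>2 \<partial>lborel)" by (intro integral_nonneg_AE) auto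
  ultimately have "(\<integral>x. (\<phi> x)\<^sup>2 \<partial>lborel) = 0" by simp
  hence "AE x in lborel. (\<phi> x)\<^sup>2 = 0"
    using energy_space_L2[OF \<phi>E] by (subst (asm) integral_nonneg_eq_0_iff_AE) auto
  thus ?thesis using uv
    by eventually_elim (auto simp: \<phi>_def w_def max_def split: if_splits)
qed

end

section \<open>Continuity of weak solutions\<close>

lemma dense_of_AE:
  fixes G :: "'a::euclidean_space set"
  assumes "AE x in lborel. x \<in> G"
  shows "closure G = UNIV"
proof (rule ccontr)
  assume "closure G \<noteq> UNIV"
  then obtain x where "x \<in> - closure G" by auto
  moreover have "open (- closure G)" by auto
  ultimately obtain r where r: "r > 0" "ball x r \<subseteq> - closure G" by (meson openE)
  from assms obtain N where N: "N \<in> null_sets lborel" "{x. x \<notin> G} \<subseteq> N" by (auto simp: eventually_ae_filter)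
  have "ball x r \<subseteq> N" using r N closure_subset[of G] by blast
  hence "emeasure lborel (ball x r) \<le> emeasure lborel N" using N by (intro emeasure_mono) auto
  also have "\<dots> = 0" using N by auto
  finally have "measure lborel (ball x r) = 0" by (simp add: measure_def)
  thus False using content_ball_pos[OF r(1), of x] by simp
qed

lemma AE_continuous_le:
  fixes f :: "'a::euclidean_space \<Rightarrow> real"
  assumes "continuous_on UNIV f" "open U" "AE x in lborel. x \<in> U \<longrightarrow> f x \<le> c" "x \<in> U"
  shows "f x \<le> c"
proof (rule ccontr)
  assume "\<not> f x \<le> c"
  hence x: "x \<in> U \<inter> {x. c < f x}" using assms by auto
  have "open (U \<inter> {x. c < f x})" using assms by (intro open_Int open_Collect_less continuous_on_const) auto
  moreover have "closure {x. x \<in> U \<longrightarrow> f x \<le> c} = UNIV" by (rule dense_of_AE) (use assms in simp)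
  ultimately have "(U \<inter> {x. c < f x}) \<inter> {x. x \<in> U \<longrightarrow> f x \<le> c} \<noteq> {}"
    using x by (metis Int_UNIV_right empty_iff open_Int_closure_eq_empty)
  thus False by auto
qed

text \<open>Averages over small balls inherit the modulus of continuity at every point, whereas v
  satisfies it only almost everywhere for each fixed h. Comparing v with its averages shows that v
  is uniformly continuous on a set of full measure; such a set is dense, so v extends.\<close>

lemma continuous_representative:
  fixes v :: "'a::euclidean_space \<Rightarrow> real"
  assumes v[measurable]: "v \<in> borel_measurable borel" and bnd: "AE x in lborel. \<bar>v x\<bar> \<le> M"
    and mod: "\<And>\<eta>. \<eta> > 0 \<Longrightarrow> \<exists>\<delta>>0. \<forall>h. norm h < \<delta> \<longrightarrow> (AE x in lborel. \<bar>v (x + h) - v x\<bar> \<le> \<eta>)"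
  obtains v' where "continuous_on UNIV v'" "AE x in lborel. v x = v' x"
proof -
  define m where "m r = measure lborel (ball (0::'a) r)" for r
  have m: "m r > 0" if "r > 0" for r unfolding m_def using that by (rule content_ball_pos)
  define A where "A r x = (\<integral>h. indicat_real (ball 0 r) h * v (x + h) \<partial>lborel) / m r" for r x
  have bm[measurable]: "ball (0::'a) r \<in> sets borel" for r by simp
  have ib[simp]: "integrable lborel (indicat_real (ball (0::'a) r))" for r
    using emeasure_lborel_ball_finite[of "0::'a" r] by (intro integrable_real_indicator) auto
  have shift: "AE h in lborel. P (x + h)" if "AE x in lborel. P x" for P and x :: 'a
    using AE_lborel_shift[OF that, of x] by (simp add: add.commute)
  have int: "integrable lborel (\<lambda>h. indicat_real (ball 0 r) h * v (x + h))" for r x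
  proof (rule Bochner_Integration.integrable_bound)
    show "integrable lborel (\<lambda>h::'a. \<bar>M\<bar> * indicat_real (ball 0 r) h)" by simp
    show "AE h in lborel. norm (indicat_real (ball 0 r) h * v (x + h)) \<le> norm (\<bar>M\<bar> * indicat_real (ball 0 r) h)"
      using shift[OF bnd, of x] by eventually_elim (simp add: indicator_def)
  qed simp
  have avg: "\<bar>\<integral>h. indicat_real (ball 0 r) h * q h \<partial>lborel\<bar> / m r \<le> \<eta>"
    if r: "r > 0" and q: "integrable lborel (\<lambda>h. indicat_real (ball 0 r) h * q h)" and ae: "AE h in lborel. h \<in> ball 0 r \<longrightarrow> \<bar>q h\<bar> \<le> \<eta>" for r \<eta> and q :: "'a \<Rightarrow> real"
  proof -
    have "\<bar>\<integral>h. indicat_real (ball 0 r) h * q h \<partial>lborel\<bar> \<le> (\<integral>h. \<bar>indicat_real (ball 0 r) h * q h\<bar> \<partial>lborel)"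
      by (rule integral_abs_bound)
    also have "\<dots> \<le> (\<integral>h. indicat_real (ball 0 r) h * \<eta> \<partial>(lborel :: 'a measure))"
    proof (rule integral_mono_AE)
      show "integrable lborel (\<lambda>h. \<bar>indicat_real (ball 0 r) h * q h\<bar>)" using q by simp
      show "integrable lborel (\<lambda>h::'a. indicat_real (ball 0 r) h * \<eta>)" by simp
      show "AE h in lborel. \<bar>indicat_real (ball 0 r) h * q h\<bar> \<le> indicat_real (ball 0 r) h * \<eta>"
        using ae by eventually_elim (simp add: indicator_def)
    qed
    also have "\<dots> = m r * \<eta>" by (simp add: m_def)
    finally show ?thesis using m[OF r] by (simp add: divide_le_eq mult.commute)
  qed
  have equi: "\<bar>A r x - A r y\<bar> \<le> \<eta>" if r: "r > 0" and ae: "AE z in lborel. \<bar>v (z + (x - y)) - v z\<bar> \<le> \<eta>" for r x y \<eta>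
  proof -
    have eq: "indicat_real (ball 0 r) h * (v (x + h) - v (y + h)) = indicat_real (ball 0 r) h * v (x + h) - indicat_real (ball 0 r) h * v (y + h)" for h
      by (rule right_diff_distrib)
    have "A r x - A r y = (\<integral>h. indicat_real (ball 0 r) h * (v (x + h) - v (y + h)) \<partial>lborel) / m r"
      unfolding eq A_def using int by (simp add: diff_divide_distrib)
    hence "\<bar>A r x - A r y\<bar> = \<bar>\<integral>h. indicat_real (ball 0 r) h * (v (x + h) - v (y + h)) \<partial>lborel\<bar> / m r"
      using m[OF r] by (simp add: abs_divide)
    also have "\<dots> \<le> \<eta>"
    proof (rule avg[OF r])
      show "integrable lborel (\<lambda>h. indicat_real (ball 0 r) h * (v (x + h) - v (y + h)))"
        unfolding eq using int by simp
      show "AE h in lborel. h \<in> ball 0 r \<longrightarrow> \<bar>v (x + h) - v (y + h)\<bar> \<le> \<eta>"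
        using shift[OF ae, of y] by eventually_elim (simp add: algebra_simps)
    qed
    finally show ?thesis .
  qed
  have appr: "AE x in lborel. \<forall>r. 0 < r \<longrightarrow> r \<le> \<delta> \<longrightarrow> \<bar>A r x - v x\<bar> \<le> \<eta>"
    if ae: "\<And>h. norm h < \<delta> \<Longrightarrow> AE x in lborel. \<bar>v (x + h) - v x\<bar> \<le> \<eta>" for \<delta> \<eta>
  proof -
    \<comment> \<open>The exceptional set of x depends on h. By Fubini, almost every x admits almost
      every h, which is enough for an average over h.\<close>
    have "AE x in lborel. AE h in lborel. norm h < \<delta> \<longrightarrow> \<bar>v (x + h) - v x\<bar> \<le> \<eta>"
    proof (subst lborel_pair.AE_commute)
      show "AE h in lborel. AE x in lborel. norm h < \<delta> \<longrightarrow> \<bar>v (x + h) - v x\<bar> \<le> \<eta>"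
      proof (rule AE_I2)
        fix h show "AE x in lborel. norm h < \<delta> \<longrightarrow> \<bar>v (x + h) - v x\<bar> \<le> \<eta>"
          using ae[of h] by (cases "norm h < \<delta>") auto
      qed
      show "{z \<in> space (lborel \<Otimes>\<^sub>M lborel). norm (snd z) < \<delta> \<longrightarrow> \<bar>v (fst z + snd z) - v (fst z)\<bar> \<le> \<eta>} \<in> sets (lborel \<Otimes>\<^sub>M lborel)"
        by measurable
    qed
    thus ?thesis
    proof eventually_elim
      case (elim x)
      show ?case
      proof (intro allI impI)
        fix r assume r: "0 < r" "r \<le> \<delta>"
        have eq: "indicat_real (ball 0 r) h * (v (x + h) - v x) = indicat_real (ball 0 r) h * v (x + h) - indicat_real (ball 0 r) h * v x" for h
          by (rule right_diff_distrib)
        have c: "integrable lborel (\<lambda>h::'a. indicat_real (ball 0 r) h * v x)" by simp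
        have "(\<integral>h. indicat_real (ball 0 r) h * v x \<partial>(lborel :: 'a measure)) = m r * v x" by (simp add: m_def)
        hence "A r x - v x = (\<integral>h. indicat_real (ball 0 r) h * (v (x + h) - v x) \<partial>lborel) / m r"
          unfolding eq A_def using int c m[OF r(1)] by (simp add: diff_divide_distrib m_def)
        hence "\<bar>A r x - v x\<bar> = \<bar>\<integral>h. indicat_real (ball 0 r) h * (v (x + h) - v x) \<partial>lborel\<bar> / m r"
          using m[OF r(1)] by (simp add: abs_divide)
        also have "\<dots> \<le> \<eta>"
        proof (rule avg[OF r(1)])
          show "integrable lborel (\<lambda>h. indicat_real (ball 0 r) h * (v (x + h) - v x))"
            unfolding eq using int c by simp
          show "AE h in lborel. h \<in> ball 0 r \<longrightarrow> \<bar>v (x + h) - v x\<bar> \<le> \<eta>"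
            using elim by eventually_elim (use r in auto)
        qed
        finally show "\<bar>A r x - v x\<bar> \<le> \<eta>" .
      qed
    qed
  qed
  define e where "e n = 1 / real (Suc n)" for n
  have e: "e n > 0" for n by (simp add: e_def)
  have "\<exists>\<delta>>0. \<forall>h. norm h < \<delta> \<longrightarrow> (AE x in lborel. \<bar>v (x + h) - v x\<bar> \<le> e n)" for n by (rule mod[OF e])
  then obtain \<delta> where \<delta>: "\<And>n. \<delta> n > 0" "\<And>n h. norm h < \<delta> n \<Longrightarrow> AE x in lborel. \<bar>v (x + h) - v x\<bar> \<le> e n" by metis
  \<comment> \<open>Countably many accuracies \<open>e n\<close> keep the complement of
    \<open>G\<close> a null set.\<close>
  define G where "G = {x. \<forall>n r. 0 < r \<longrightarrow> r \<le> \<delta> n \<longrightarrow> \<bar>A r x - v x\<bar> \<le> e n}"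
  have "AE x in lborel. \<forall>n. \<forall>r. 0 < r \<longrightarrow> r \<le> \<delta> n \<longrightarrow> \<bar>A r x - v x\<bar> \<le> e n"
    by (subst AE_all_countable) (intro allI appr \<delta>(2))
  hence G: "AE x in lborel. x \<in> G" by (simp add: G_def)
  have uc: "uniformly_continuous_on G v"
    unfolding uniformly_continuous_on_def
  proof (intro allI impI)
    fix \<epsilon> :: real assume \<epsilon>: "0 < \<epsilon>"
    then obtain n where n: "e n < \<epsilon> / 3" unfolding e_def using nat_approx_posE[of "\<epsilon> / 3"] by auto
    show "\<exists>d>0. \<forall>x\<in>G. \<forall>x'\<in>G. dist x' x < d \<longrightarrow> dist (v x') (v x) < \<epsilon>"
    proof (intro exI[of _ "\<delta> n"] conjI ballI impI \<delta>(1))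
      fix x x' assume x: "x \<in> G" "x' \<in> G" and d: "dist x' x < \<delta> n"
      have "\<bar>A (\<delta> n) x' - A (\<delta> n) x\<bar> \<le> e n"
        by (rule equi[OF \<delta>(1)]) (use \<delta>(2)[of "x' - x" n] d in \<open>simp add: dist_norm\<close>)
      moreover have "\<bar>A (\<delta> n) x - v x\<bar> \<le> e n" "\<bar>A (\<delta> n) x' - v x'\<bar> \<le> e n"
        using x \<delta>(1)[of n] by (auto simp: G_def)
      ultimately show "dist (v x') (v x) < \<epsilon>" using n unfolding dist_real_def by linarith
    qed
  qed
  obtain v' where ext: "uniformly_continuous_on (closure G) v'" and v': "\<And>x. x \<in> G \<Longrightarrow> v x = v' x"
    by (rule uniformly_continuous_on_extension_on_closure[OF uc]) blast
  from ext have "continuous_on UNIV v'" unfolding dense_of_AE[OF G] by (simp add: uniformly_continuous_imp_continuous)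
  moreover have "AE x in lborel. v x = v' x" using G by eventually_elim (rule v')
  ultimately show thesis by (rule that)
qed

section \<open>Continuity of translations in L^p\<close>

lemma bounded_borel_approx:
  fixes g :: "'a::euclidean_space \<Rightarrow> real"
  assumes g[measurable]: "g \<in> borel_measurable borel" and gM: "\<And>x. \<bar>g x\<bar> \<le> M" and p: "p > 0" and \<eta>: "\<eta> > 0"
  obtains f where "continuous_on UNIV f" "integrable lborel (\<lambda>x. indicat_real (cball 0 R) x * \<bar>f x - g x\<bar> powr p)"
    "(\<integral>x. indicat_real (cball 0 R) x * \<bar>f x - g x\<bar> powr p \<partial>lborel) < \<eta>"
proof -
  have M: "M \<ge> 0" using gM[of 0] by linarith
  have "g \<in> borel_measurable lebesgue" by (rule measurable_completion) simp
  hence "g measurable_on UNIV" by (rule lebesgue_measurable_imp_measurable_on) simp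
  then obtain N F where N: "negligible N" and F: "\<And>n. continuous_on UNIV (F n)" and lim: "\<And>x. x \<notin> N \<Longrightarrow> (\<lambda>n. F n x) \<longlonglongrightarrow> g x"
    unfolding measurable_on_def by auto
  \<comment> \<open>Clamping at the bound of g preserves the pointwise limit and supplies a
    dominating function on the ball.\<close>
  define f where "f n x = max (- M) (min M (F n x))" for n x
  have f: "continuous_on UNIV (f n)" for n unfolding f_def by (intro continuous_intros F)
  have [measurable]: "f n \<in> borel_measurable borel" for n using f by (rule borel_measurable_continuous_onI)
  have [measurable]: "cball (0::'a) R \<in> sets borel" by simp
  have fM: "\<bar>f n x\<bar> \<le> M" for n x unfolding f_def using M by linarith
  have "AE x in lebesgue. x \<notin> N" using N by (intro AE_not_in) (simp add: negligible_iff_null_sets)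
  hence nN: "AE x in lborel. x \<notin> N" by (simp add: AE_completion_iff)
  have B: "integrable lborel (\<lambda>x. indicat_real (cball (0::'a) R) x * (2 * M) powr p)"
    using emeasure_lborel_cball_finite[of "0::'a" R] by simp
  have bd: "norm (indicat_real (cball 0 R) x * \<bar>f n x - g x\<bar> powr p) \<le> indicat_real (cball 0 R) x * (2 * M) powr p" for n x
  proof -
    have "\<bar>f n x - g x\<bar> \<le> 2 * M" using fM[of n x] gM[of x] by linarith
    hence "\<bar>f n x - g x\<bar> powr p \<le> (2 * M) powr p" using p by (intro powr_mono2) auto
    thus ?thesis by (simp add: indicator_def)
  qed
  have "(\<lambda>n. \<integral>x. indicat_real (cball 0 R) x * \<bar>f n x - g x\<bar> powr p \<partial>lborel) \<longlonglongrightarrow> (\<integral>x. 0 \<partial>(lborel :: 'a measure))"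
  proof (rule integral_dominated_convergence[OF _ _ B])
    show "AE x in lborel. (\<lambda>n. indicat_real (cball 0 R) x * \<bar>f n x - g x\<bar> powr p) \<longlonglongrightarrow> 0"
      using nN
    proof eventually_elim
      case (elim x)
      have "(\<lambda>n. f n x) \<longlonglongrightarrow> max (- M) (min M (g x))" unfolding f_def by (intro tendsto_intros lim elim)
      also have "max (- M) (min M (g x)) = g x" using gM[of x] by (auto simp: max_def min_def)
      finally have "(\<lambda>n. \<bar>f n x - g x\<bar>) \<longlonglongrightarrow> \<bar>g x - g x\<bar>" by (intro tendsto_intros)
      hence "(\<lambda>n. \<bar>f n x - g x\<bar> powr p) \<longlonglongrightarrow> 0 powr p" using p by (intro tendsto_powr') auto
      hence "(\<lambda>n. indicat_real (cball 0 R) x * \<bar>f n x - g x\<bar> powr p) \<longlonglongrightarrow> indicat_real (cball 0 R) x * 0"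
        by (intro tendsto_mult tendsto_const) simp
      thus ?case by simp
    qed
  qed (use bd in auto)
  hence "(\<lambda>n. \<integral>x. indicat_real (cball 0 R) x * \<bar>f n x - g x\<bar> powr p \<partial>lborel) \<longlonglongrightarrow> 0" by simp
  hence "\<forall>\<^sub>F n in sequentially. (\<integral>x. indicat_real (cball 0 R) x * \<bar>f n x - g x\<bar> powr p \<partial>lborel) < \<eta>"
    using \<eta> by (rule order_tendstoD)
  then obtain n where n: "(\<integral>x. indicat_real (cball 0 R) x * \<bar>f n x - g x\<bar> powr p \<partial>lborel) < \<eta>"
    by (auto simp: eventually_sequentially)
  have "integrable lborel (\<lambda>x. indicat_real (cball 0 R) x * \<bar>f n x - g x\<bar> powr p)"
    by (rule Bochner_Integration.integrable_bound[OF B]) (use bd in \<open>auto intro!: AE_I2 order_trans[OF bd]\<close>)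
  thus thesis using that f n by blast
qed

lemma powr_sum3_le:
  fixes a b c p :: real
  assumes "0 \<le> a" "0 \<le> b" "0 \<le> c" "0 < p"
  shows "(a + b + c) powr p \<le> 3 powr p * (a powr p + b powr p + c powr p)"
proof -
  let ?m = "max a (max b c)"
  have "(a + b + c) powr p \<le> (3 * ?m) powr p" using assms by (intro powr_mono2) auto
  also have "\<dots> = 3 powr p * ?m powr p" using assms by (simp add: powr_mult)
  also have "?m powr p \<le> a powr p + b powr p + c powr p"
    by (auto simp: max_def)
  finally show ?thesis by (simp add: mult_left_mono)
qed

context fractional_domain
begin

lemma bounded_Lp_data:
  assumes [measurable]: "g \<in> borel_measurable borel" and gM: "\<And>x. \<bar>g x\<bar> \<le> M"
  shows "Lp_data g"
proof -
  have "integrable lborel (\<lambda>x. indicat_real \<Omega> x * \<bar>g x\<bar> powr p)"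
  proof (rule Bochner_Integration.integrable_bound)
    show "integrable lborel (\<lambda>x. indicat_real \<Omega> x * M powr p)" using domain_finite by simp
    show "AE x in lborel. norm (indicat_real \<Omega> x * \<bar>g x\<bar> powr p) \<le> norm (indicat_real \<Omega> x * M powr p)"
      using gM p by (intro AE_I2) (auto simp: indicator_def intro!: powr_mono2)
  qed simp
  thus ?thesis by (simp add: Lp_data_def)
qed

lemma data_norm_translation:
  assumes g[measurable]: "g \<in> borel_measurable borel" and gM: "\<And>x. \<bar>g x\<bar> \<le> M" and \<eta>: "\<eta> > 0"
  shows "\<exists>\<delta>>0. \<forall>h. norm h < \<delta> \<longrightarrow> data_norm (\<lambda>x. g (x + h) - g x) \<le> \<eta>"
proof -
  obtain R where "\<forall>x\<in>\<Omega>. norm x \<le> R" using bounded_domain unfolding bounded_iff ..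
  hence R: "\<Omega> \<subseteq> cball 0 R" by auto
  define V where "V = measure lborel \<Omega>"
  \<comment> \<open>Chosen so that the three terms add up to at most \<open>\<eta> powr p\<close>
    after the factor \<open>3 powr p\<close>: a quarter for each approximation error, a half for the
    modulus of f. Here \<open>V + 1\<close> avoids division by 0.\<close>
  define e1 where "e1 = \<eta> powr p / (4 * 3 powr p)"
  define e2 where "e2 = (\<eta> powr p / (2 * 3 powr p * (V + 1))) powr (1 / p)"
  have V: "V \<ge> 0" by (simp add: V_def)
  have e: "e1 > 0" "e2 > 0" using \<eta> V by (auto simp: e1_def e2_def add_nonneg_eq_0_iff)
  have p0: "p > 0" using p by simp
  \<comment> \<open>The radius R + 1 accommodates \<Omega> together with its translates by vectors
    shorter than 1.\<close>
  obtain f where f: "continuous_on UNIV f" and fi: "integrable lborel (\<lambda>x. indicat_real (cball 0 (R + 1)) x * \<bar>f x - g x\<bar> powr p)"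
    and fe: "(\<integral>x. indicat_real (cball 0 (R + 1)) x * \<bar>f x - g x\<bar> powr p \<partial>lborel) < e1"
    using bounded_borel_approx[OF g gM p0 e(1), of "R + 1"] by blast
  have [measurable]: "f \<in> borel_measurable borel" using f by (rule borel_measurable_continuous_onI)
  have "uniformly_continuous_on (cball 0 (R + 1)) f"
    using f by (intro compact_uniformly_continuous) (auto intro: continuous_on_subset)
  then obtain \<delta> where \<delta>: "\<delta> > 0" "\<And>x y. x \<in> cball 0 (R + 1) \<Longrightarrow> y \<in> cball 0 (R + 1) \<Longrightarrow> dist y x < \<delta> \<Longrightarrow> dist (f y) (f x) < e2"
    using e(2) unfolding uniformly_continuous_on_def by blast
  show ?thesis
  proof (intro exI[of _ "min 1 \<delta>"] conjI allI impI)
    show "0 < min 1 \<delta>" using \<delta> by simp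
    fix h :: 'a assume h: "norm h < min 1 \<delta>"
    have inB: "x \<in> cball 0 (R + 1)" "x + h \<in> cball 0 (R + 1)" if "x \<in> \<Omega>" for x
      using subsetD[OF R that] h norm_triangle_ineq[of x h] by auto
    define q where "q x = indicat_real (cball 0 (R + 1)) x * \<bar>f x - g x\<bar> powr p" for x
    have [measurable]: "cball (0::'a) (R + 1) \<in> sets borel" by simp
    have [measurable]: "q \<in> borel_measurable borel" unfolding q_def by measurable
    have q0: "q x \<ge> 0" for x by (simp add: q_def)
    have qi: "integrable lborel q" "integrable lborel (\<lambda>x. q (x + h))" "(\<integral>x. q (x + h) \<partial>lborel) = (\<integral>x. q x \<partial>lborel)"
    proof -
      show "integrable lborel q" using fi unfolding q_def .
      thus "integrable lborel (\<lambda>x. q (x + h))" "(\<integral>x. q (x + h) \<partial>lborel) = (\<integral>x. q x \<partial>lborel)"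
        using integral_lborel_shift[of q h] by simp_all
    qed
    have le: "indicat_real \<Omega> x * \<bar>g (x + h) - g x\<bar> powr p \<le> 3 powr p * (q (x + h) + e2 powr p * indicat_real \<Omega> x + q x)" for x
    proof (cases "x \<in> \<Omega>")
      case True
      note B = inB[OF True]
      have d: "\<bar>f (x + h) - f x\<bar> < e2" using \<delta>(2)[OF B] h by (simp add: dist_norm dist_real_def)
      have "\<bar>g (x + h) - g x\<bar> \<le> \<bar>f (x + h) - g (x + h)\<bar> + e2 + \<bar>f x - g x\<bar>" using d by linarith
      hence "\<bar>g (x + h) - g x\<bar> powr p \<le> (\<bar>f (x + h) - g (x + h)\<bar> + e2 + \<bar>f x - g x\<bar>) powr p"
        using p0 by (intro powr_mono2) auto
      also have "\<dots> \<le> 3 powr p * (\<bar>f (x + h) - g (x + h)\<bar> powr p + e2 powr p + \<bar>f x - g x\<bar> powr p)"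
        using p0 e by (intro powr_sum3_le) auto
      finally show ?thesis using True B by (simp add: q_def)
    next
      case False
      thus ?thesis using q0[of x] q0[of "x + h"] by simp
    qed
    have "(\<integral>x. indicat_real \<Omega> x * \<bar>g (x + h) - g x\<bar> powr p \<partial>lborel) \<le> (\<integral>x. 3 powr p * (q (x + h) + e2 powr p * indicat_real \<Omega> x + q x) \<partial>lborel)"
    proof (rule integral_mono)
      have "Lp_data (\<lambda>x. g (x + h) - g x)"
      proof (rule bounded_Lp_data[where M = "2 * M"])
        show "\<bar>g (x + h) - g x\<bar> \<le> 2 * M" for x using gM[of x] gM[of "x + h"] by linarith
      qed simp
      thus "integrable lborel (\<lambda>x. indicat_real \<Omega> x * \<bar>g (x + h) - g x\<bar> powr p)" by (simp add: Lp_data_def)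
      show "integrable lborel (\<lambda>x. 3 powr p * (q (x + h) + e2 powr p * indicat_real \<Omega> x + q x))"
        using qi domain_finite by simp
    qed (rule le)
    also have "\<dots> = 3 powr p * ((\<integral>x. q x \<partial>lborel) + e2 powr p * V + (\<integral>x. q x \<partial>lborel))"
      using qi domain_finite by (simp add: V_def)
    also have "\<dots> \<le> 3 powr p * (e1 + \<eta> powr p / (2 * 3 powr p) + e1)"
    proof -
      have "e2 powr p = \<eta> powr p / (2 * 3 powr p * (V + 1))"
        using p0 \<eta> V by (simp add: e2_def powr_powr)
      hence "e2 powr p * V = \<eta> powr p / (2 * 3 powr p) * (V / (V + 1))" by simp
      also have "\<dots> \<le> \<eta> powr p / (2 * 3 powr p) * 1" using V by (intro mult_left_mono) auto
      finally have "e2 powr p * V \<le> \<eta> powr p / (2 * 3 powr p)" by simp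
      moreover have "(\<integral>x. q x \<partial>lborel) \<le> e1" using fe by (simp add: q_def)
      ultimately show ?thesis by (intro mult_left_mono add_mono) auto
    qed
    also have "\<dots> = \<eta> powr p" by (simp add: e1_def field_simps)
    finally have "data_norm (\<lambda>x. g (x + h) - g x) \<le> (\<eta> powr p) powr (1 / p)"
      unfolding data_norm_def using p0 by (intro powr_mono2) (auto intro!: integral_nonneg_AE)
    also have "\<dots> = \<eta>" using p0 \<eta> by (simp add: powr_powr)
    finally show "data_norm (\<lambda>x. g (x + h) - g x) \<le> \<eta>" .
  qed
qed

lemma weak_solution_minus:
  assumes "weak_solution v g"
  shows "weak_solution (\<lambda>x. - v x) (\<lambda>x. - g x)"
proof -
  have v: "v \<in> energy_space \<Omega> s" using assms by (simp add: weak_solution_def)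
  have "(\<lambda>x. - v x) \<in> energy_space \<Omega> s" using energy_space_lincomb[OF v v, of "-1" 0] by simp
  moreover have "energy s (\<lambda>x. - v x) \<phi> = (\<integral>x. - g x * \<phi> x \<partial>lborel)" if "\<phi> \<in> energy_space \<Omega> s" for \<phi>
    using energy_lincomb[OF v v that, of "-1" 0] assms that by (simp add: weak_solution_def)
  ultimately show ?thesis by (simp add: weak_solution_def)
qed

lemma boundary_decay:
  assumes cone: "exterior_cone_condition \<Omega>" and x0: "x0 \<in> frontier \<Omega>"
    and v: "weak_solution v g" and g: "g \<in> borel_measurable borel" and gM: "\<And>x. \<bar>g x\<bar> \<le> Mg" and \<eta>: "\<eta> > 0"
  shows "\<exists>\<delta>>0. AE x in lborel. x \<in> ball x0 \<delta> \<longrightarrow> \<bar>v x\<bar> \<le> \<eta>"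
proof -
  have Mg: "Mg \<ge> 0" using gM[of 0] by linarith
  have L: "Lp_data g" using bounded_Lp_data[OF g gM] .
  have L': "Lp_data (\<lambda>x. - g x)" using L by (simp add: Lp_data_def)
  obtain Mv where Mv: "Mv > 0" "AE x in lborel. \<bar>v x\<bar> \<le> Mv" using weak_solution_bounded[OF v L] by blast
  obtain e \<kappa> r where e: "norm e = 1" and \<kappa>: "0 < \<kappa>" "\<kappa> \<le> 1/2" and r: "0 < r"
    and ext: "\<And>\<rho> y. 0 < \<rho> \<Longrightarrow> \<rho> \<le> r \<Longrightarrow> norm (y - (x0 + (5/2 * \<rho>) *\<^sub>R e)) < \<kappa> * \<rho> \<Longrightarrow> y \<notin> \<Omega>"
    using cone_exterior_balls[OF cone x0] by blast
  define c0 where "c0 = 4 powr - (real DIM('a) + 2 * s) * \<kappa> ^ DIM('a) * measure lborel (ball (0::'a) 1)"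
  have c0: "c0 > 0" unfolding c0_def using \<kappa> content_ball_pos[of 1 "0::'a"] by simp
  define b where "b = enn2real (barrier_const TYPE('a) s)"
  have b: "b \<ge> 0" by (simp add: b_def)
  \<comment> \<open>The second bound is the requirement that the defect of the barrier be at most
    half of the gain \<open>c0\<close>; \<open>b + 1\<close> keeps the quotient positive.\<close>
  define a where "a = min (s / 2) (s * c0 / (4 * (b + 1)))"
  have a: "0 < a" "a \<le> s / 2" unfolding a_def using s c0 b by (simp, intro min.cobounded1)
  have aI: "2 * (2 * a / s * b) \<le> c0"
  proof -
    have "a * (4 * (b + 1)) \<le> s * c0"
    proof -
      have "a \<le> s * c0 / (4 * (b + 1))" by (simp add: a_def)
      thus ?thesis using b by (subst (asm) pos_le_divide_eq) auto
    qed
    hence "a * (4 * b) \<le> s * c0" using a b by (simp add: distrib_left)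
    thus ?thesis using s by (simp add: field_simps)
  qed
  have r2: "(r\<^sup>2) powr d > 0" for d using r by simp
  \<comment> \<open>One summand for the bound of v at the cap, one for the bound of the datum, and 1
    for positivity. \<Lambda> does not involve \<epsilon>, which can therefore be chosen
    last.\<close>
  define \<Lambda> where "\<Lambda> = 1 + Mv / (r\<^sup>2) powr a + Mg / (c0 * (r\<^sup>2) powr (a - s))"
  have \<Lambda>: "\<Lambda> > 0" "Mv \<le> \<Lambda> * (r\<^sup>2) powr a" "Mg \<le> \<Lambda> * c0 * (r\<^sup>2) powr (a - s)"
  proof -
    have nn: "Mv / (r\<^sup>2) powr a \<ge> 0" "Mg / (c0 * (r\<^sup>2) powr (a - s)) \<ge> 0" using Mv Mg c0 by auto
    show "\<Lambda> > 0" unfolding \<Lambda>_def using nn by linarith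
    have "Mv / (r\<^sup>2) powr a \<le> \<Lambda>" unfolding \<Lambda>_def using nn by linarith
    thus "Mv \<le> \<Lambda> * (r\<^sup>2) powr a" using r2[of a] by (subst (asm) pos_divide_le_eq) auto
    have "Mg / (c0 * (r\<^sup>2) powr (a - s)) \<le> \<Lambda>" unfolding \<Lambda>_def using nn by linarith
    hence "Mg \<le> \<Lambda> * (c0 * (r\<^sup>2) powr (a - s))" using r2[of "a - s"] c0 by (subst (asm) pos_divide_le_eq) auto
    thus "Mg \<le> \<Lambda> * c0 * (r\<^sup>2) powr (a - s)" by (simp only: mult.assoc)
  qed
  \<comment> \<open>Solves \<open>(2 * \<epsilon>\<^sup>2) powr a = \<eta> / \<Lambda>\<close>;
    \<epsilon> is at once the regularisation of the barrier and the radius of the ball on which it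
    is used.\<close>
  define \<epsilon> where "\<epsilon> = sqrt ((\<eta> / \<Lambda>) powr (1 / a) / 2)"
  have \<epsilon>: "\<epsilon> > 0" using \<eta> \<Lambda> by (simp add: \<epsilon>_def)
  have \<epsilon>2: "2 * \<epsilon>\<^sup>2 = (\<eta> / \<Lambda>) powr (1 / a)" by (simp add: \<epsilon>_def)
  have cmp: "AE x in lborel. u x \<le> \<Lambda> * barrier a r \<epsilon> x0 x"
    if "weak_solution u f" "Lp_data f" "\<And>x. f x \<le> Mg" "AE x in lborel. u x \<le> Mv" for u f
    by (rule boundary_comparison[OF that(1,2,3) Mg that(4) _ e \<kappa> r ext])
       (use Mv a aI \<Lambda> \<epsilon> in \<open>simp_all add: c0_def b_def\<close>)
  have near: "\<Lambda> * barrier a r \<epsilon> x0 x \<le> \<eta>" if "x \<in> ball x0 \<epsilon>" for x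
  proof -
    have "norm (x - x0) \<le> \<epsilon>" using that by (simp add: dist_norm norm_minus_commute)
    hence "(norm (x - x0))\<^sup>2 \<le> \<epsilon>\<^sup>2" by (intro power_mono) auto
    hence "((norm (x - x0))\<^sup>2 + \<epsilon>\<^sup>2) powr a \<le> (2 * \<epsilon>\<^sup>2) powr a" using a by (intro powr_mono2) auto
    also have "\<dots> = \<eta> / \<Lambda>" unfolding \<epsilon>2 using a \<eta> \<Lambda> by (simp add: powr_powr)
    finally have "barrier a r \<epsilon> x0 x \<le> \<eta> / \<Lambda>" by (simp add: barrier_def min_le_iff_disj)
    thus ?thesis using \<Lambda>(1) by (simp add: pos_le_divide_eq mult.commute)
  qed
  have 1: "AE x in lborel. v x \<le> \<Lambda> * barrier a r \<epsilon> x0 x"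
    using Mv(2) gM by (intro cmp[OF v L]) (auto simp: abs_le_iff elim!: eventually_mono)
  have 2: "AE x in lborel. - v x \<le> \<Lambda> * barrier a r \<epsilon> x0 x"
  proof (rule cmp[OF weak_solution_minus[OF v] L'])
    show "- g x \<le> Mg" for x using gM[of x] by linarith
    show "AE x in lborel. - v x \<le> Mv" using Mv(2) by eventually_elim linarith
  qed
  have "AE x in lborel. x \<in> ball x0 \<epsilon> \<longrightarrow> \<bar>v x\<bar> \<le> \<eta>"
    using 1 2
  proof eventually_elim
    case (elim x)
    show ?case
    proof
      assume "x \<in> ball x0 \<epsilon>"
      from near[OF this] elim show "\<bar>v x\<bar> \<le> \<eta>" by linarith
    qed
  qed
  thus ?thesis using \<epsilon> by blast
qed

text \<open>Balls of half the radius cover the compact boundary; a point close to the boundary then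
  lies in one of finitely many full balls.\<close>

lemma uniform_boundary_decay:
  assumes cone: "exterior_cone_condition \<Omega>"
    and v: "weak_solution v g" and g: "g \<in> borel_measurable borel" and gM: "\<And>x. \<bar>g x\<bar> \<le> Mg" and \<eta>: "\<eta> > 0"
  shows "\<exists>\<delta>>0. AE x in lborel. (\<exists>y\<in>frontier \<Omega>. dist x y < \<delta>) \<longrightarrow> \<bar>v x\<bar> \<le> \<eta>"
proof -
  have "\<forall>y\<in>frontier \<Omega>. \<exists>\<delta>>0. AE x in lborel. x \<in> ball y \<delta> \<longrightarrow> \<bar>v x\<bar> \<le> \<eta>"
    using boundary_decay[OF cone _ v g gM \<eta>] by blast
  then obtain d where d: "\<And>y. y \<in> frontier \<Omega> \<Longrightarrow> d y > 0" "\<And>y. y \<in> frontier \<Omega> \<Longrightarrow> AE x in lborel. x \<in> ball y (d y) \<longrightarrow> \<bar>v x\<bar> \<le> \<eta>"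
    by metis
  have "compact (frontier \<Omega>)" using bounded_domain by (simp add: compact_frontier_bounded)
  moreover have "frontier \<Omega> \<subseteq> (\<Union>y\<in>frontier \<Omega>. ball y (d y / 2))" using d(1) by (force intro: centre_in_ball[THEN iffD2])
  ultimately obtain D where D: "D \<subseteq> frontier \<Omega>" "finite D" "frontier \<Omega> \<subseteq> (\<Union>y\<in>D. ball y (d y / 2))"
    using compactE_image[of "frontier \<Omega>" "frontier \<Omega>" "\<lambda>y. ball y (d y / 2)"] by (metis open_ball)
  define \<delta> where "\<delta> = Min (insert 1 ((\<lambda>y. d y / 2) ` D))"
  have \<delta>: "\<delta> > 0" unfolding \<delta>_def using D d(1) by (subst Min_gr_iff) auto
  have \<delta>le: "\<delta> \<le> d y / 2" if "y \<in> D" for y unfolding \<delta>_def using D that by (intro Min_le) auto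
  have "AE x in lborel. \<forall>y\<in>D. x \<in> ball y (d y) \<longrightarrow> \<bar>v x\<bar> \<le> \<eta>"
    using D d(2) by (intro AE_finite_allI) auto
  hence "AE x in lborel. (\<exists>y\<in>frontier \<Omega>. dist x y < \<delta>) \<longrightarrow> \<bar>v x\<bar> \<le> \<eta>"
  proof eventually_elim
    case (elim x)
    show ?case
    proof
      assume "\<exists>y\<in>frontier \<Omega>. dist x y < \<delta>"
      then obtain y where y: "y \<in> frontier \<Omega>" "dist x y < \<delta>" by blast
      then obtain z where z: "z \<in> D" "y \<in> ball z (d z / 2)" using D(3) by blast
      have "dist z x < d z" using dist_triangle[of z x y] y(2) z(2) \<delta>le[OF z(1)] by (simp add: dist_commute)
      hence "x \<in> ball z (d z)" by simp
      thus "\<bar>v x\<bar> \<le> \<eta>" using elim z(1) by blast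
    qed
  qed
  thus ?thesis using \<delta> by blast
qed

lemma frontier_near:
  assumes "x \<in> \<Omega>" "x + h \<notin> \<Omega>"
  obtains y where "y \<in> frontier \<Omega>" "dist x y \<le> norm h" "dist (x + h) y \<le> norm h"
proof -
  have "closed_segment x (x + h) \<inter> frontier \<Omega> \<noteq> {}"
    using assms by (intro connected_Int_frontier) auto
  then obtain y where y: "y \<in> closed_segment x (x + h)" "y \<in> frontier \<Omega>" by blast
  show thesis
    using that[OF y(2)] dist_in_closed_segment[OF y(1)] by (simp add: dist_norm norm_minus_commute)
qed

text \<open>If exactly one of x and x + h lies in \<Omega>, the segment between them meets the
  boundary, and boundary decay bounds the difference; if neither does, it vanishes. This is the
  level k0 of \<open>translation_bound\<close>, and continuity of translations in L^p controls the
  rest.\<close>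

lemma weak_solution_modulus:
  assumes cone: "exterior_cone_condition \<Omega>"
    and v: "weak_solution v g" and g[measurable]: "g \<in> borel_measurable borel" and gM: "\<And>x. \<bar>g x\<bar> \<le> Mg" and \<eta>: "\<eta> > 0"
  shows "\<exists>\<delta>>0. \<forall>h. norm h < \<delta> \<longrightarrow> (AE x in lborel. \<bar>v (x + h) - v x\<bar> \<le> \<eta>)"
proof -
  have L: "Lp_data g" using bounded_Lp_data[OF g gM] .
  obtain C where C: "C > 0" and tr: "\<And>v g h k0 \<eta>. weak_solution v g \<Longrightarrow> Lp_data g \<Longrightarrow> Lp_data (\<lambda>x. g (x + h) - g x) \<Longrightarrow> \<eta> > 0 \<Longrightarrow>
     AE x in lborel. \<not> (x \<in> \<Omega> \<and> x + h \<in> \<Omega>) \<longrightarrow> \<bar>v (x + h) - v x\<bar> \<le> k0 \<Longrightarrow>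
     AE x in lborel. \<bar>v (x + h) - v x\<bar> \<le> k0 + C * (data_norm (\<lambda>x. g (x + h) - g x) + \<eta>)"
    by (rule translation_bound) blast
  obtain \<delta>1 where \<delta>1: "\<delta>1 > 0" and bd: "AE x in lborel. (\<exists>y\<in>frontier \<Omega>. dist x y < \<delta>1) \<longrightarrow> \<bar>v x\<bar> \<le> \<eta> / 2"
    using uniform_boundary_decay[OF cone v g gM, of "\<eta> / 2"] \<eta> by auto
  obtain \<delta>2 where \<delta>2: "\<delta>2 > 0" and dn: "\<And>h. norm h < \<delta>2 \<Longrightarrow> data_norm (\<lambda>x. g (x + h) - g x) \<le> \<eta> / (4 * C)"
    using data_norm_translation[OF g gM, of "\<eta> / (4 * C)"] \<eta> C by auto
  have vE: "v \<in> energy_space \<Omega> s" using v by (simp add: weak_solution_def)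
  show ?thesis
  proof (intro exI[of _ "min \<delta>1 \<delta>2"] conjI allI impI)
    show "0 < min \<delta>1 \<delta>2" using \<delta>1 \<delta>2 by simp
    fix h :: 'a assume h: "norm h < min \<delta>1 \<delta>2"
    have Lh: "Lp_data (\<lambda>x. g (x + h) - g x)"
    proof (rule bounded_Lp_data[where M = "2 * Mg"])
      show "\<bar>g (x + h) - g x\<bar> \<le> 2 * Mg" for x using gM[of x] gM[of "x + h"] by linarith
    qed simp
    have off: "AE x in lborel. \<not> (x \<in> \<Omega> \<and> x + h \<in> \<Omega>) \<longrightarrow> \<bar>v (x + h) - v x\<bar> \<le> \<eta> / 2"
      using bd AE_lborel_shift[OF bd, of h] energy_spaceD(2)[OF vE] AE_lborel_shift[OF energy_spaceD(2)[OF vE], of h]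
    proof eventually_elim
      case (elim x)
      show ?case
      proof
        assume n: "\<not> (x \<in> \<Omega> \<and> x + h \<in> \<Omega>)"
        consider "x \<in> \<Omega>" "x + h \<notin> \<Omega>" | "x \<notin> \<Omega>" "x + h \<in> \<Omega>" | "x \<notin> \<Omega>" "x + h \<notin> \<Omega>" using n by blast
        thus "\<bar>v (x + h) - v x\<bar> \<le> \<eta> / 2"
        proof cases
          case 1
          obtain y where "y \<in> frontier \<Omega>" "dist x y \<le> norm h" using frontier_near[OF 1] .
          hence "\<exists>y\<in>frontier \<Omega>. dist x y < \<delta>1" using h by force
          thus ?thesis using elim 1 by simp
        next
          case 2
          have "(x + h) + (- h) \<notin> \<Omega>" using 2 by simp
          from frontier_near[OF 2(2) this] obtain y where "y \<in> frontier \<Omega>" "dist (x + h) y \<le> norm (- h)" .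
          hence "\<exists>y\<in>frontier \<Omega>. dist (x + h) y < \<delta>1" using h by force
          thus ?thesis using elim 2 by simp
        next
          case 3
          thus ?thesis using elim \<eta> by simp
        qed
      qed
    qed
    have "AE x in lborel. \<bar>v (x + h) - v x\<bar> \<le> \<eta> / 2 + C * (data_norm (\<lambda>x. g (x + h) - g x) + \<eta> / (4 * C))"
      by (rule tr[OF v L Lh _ off]) (use \<eta> C in simp)
    moreover have "\<eta> / 2 + C * (data_norm (\<lambda>x. g (x + h) - g x) + \<eta> / (4 * C)) \<le> \<eta>"
    proof -
      have "C * (data_norm (\<lambda>x. g (x + h) - g x) + \<eta> / (4 * C)) \<le> C * (\<eta> / (4 * C) + \<eta> / (4 * C))"
        using dn[of h] h C by (intro mult_left_mono add_mono) auto
      also have "\<dots> = \<eta> / 2" using C by (simp add: field_simps)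
      finally show ?thesis by simp
    qed
    ultimately show "AE x in lborel. \<bar>v (x + h) - v x\<bar> \<le> \<eta>" by (elim eventually_mono) simp
  qed
qed

text \<open>The source of admissible test functions. The almost everywhere statements become
  pointwise for the continuous representative, on the boundary by decay and off the closure because
  its complement is open.\<close>

lemma continuous_weak_solution:
  assumes cone: "exterior_cone_condition \<Omega>" and g: "g \<in> borel_measurable borel" and gM: "\<And>x. \<bar>g x\<bar> \<le> Mg"
  obtains v where "weak_solution v g" "continuous_on UNIV v" "\<And>x. x \<notin> \<Omega> \<Longrightarrow> v x = 0"
proof -
  have L: "Lp_data g" using bounded_Lp_data[OF g gM] .
  obtain u where u: "weak_solution u g" using weak_solution_ex[OF L] .
  have uE: "u \<in> energy_space \<Omega> s" using u by (simp add: weak_solution_def)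
  note [measurable] = energy_spaceD(1)[OF uE]
  obtain M where M: "AE x in lborel. \<bar>u x\<bar> \<le> M" using weak_solution_bounded[OF u L] by blast
  obtain v where cv: "continuous_on UNIV v" and uv: "AE x in lborel. u x = v x"
    using continuous_representative[OF energy_spaceD(1)[OF uE] M weak_solution_modulus[OF cone u g gM]] by blast
  have [measurable]: "v \<in> borel_measurable borel" using cv by (rule borel_measurable_continuous_onI)
  have vE: "v \<in> energy_space \<Omega> s" by (rule energy_space_cong[OF uE _ uv]) simp
  have v: "weak_solution v g"
    unfolding weak_solution_def
  proof (intro conjI ballI vE)
    fix \<phi> assume \<phi>: "\<phi> \<in> energy_space \<Omega> s"
    have "energy s v \<phi> = energy s u \<phi>"
      using uv energy_spaceD(1)[OF \<phi>] by (intro energy_cong) (auto elim!: eventually_mono)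
    thus "energy s v \<phi> = (\<integral>x. g x * \<phi> x \<partial>lborel)" using u \<phi> by (simp add: weak_solution_def)
  qed
  have cabs: "continuous_on UNIV (\<lambda>x. \<bar>v x\<bar>)" using cv by (intro continuous_intros)
  have "v x = 0" if x: "x \<notin> \<Omega>" for x
  proof (cases "x \<in> closure \<Omega>")
    case True
    hence f: "x \<in> frontier \<Omega>" using x open_domain by (simp add: frontier_def interior_open)
    have "\<bar>v x\<bar> \<le> 0"
    proof (rule field_le_epsilon)
      fix \<eta> :: real assume "0 < \<eta>"
      then obtain \<delta> where "\<delta> > 0" "AE y in lborel. y \<in> ball x \<delta> \<longrightarrow> \<bar>v y\<bar> \<le> \<eta>"
        using boundary_decay[OF cone f v g gM] by blast
      hence "\<bar>v x\<bar> \<le> \<eta>" by (intro AE_continuous_le[OF cabs open_ball]) auto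
      thus "\<bar>v x\<bar> \<le> 0 + \<eta>" by simp
    qed
    thus ?thesis by simp
  next
    case False
    have "AE y in lborel. y \<in> - closure \<Omega> \<longrightarrow> \<bar>v y\<bar> \<le> 0"
      using energy_spaceD(2)[OF vE] by eventually_elim (use closure_subset[of \<Omega>] in auto)
    hence "\<bar>v x\<bar> \<le> 0" using False by (intro AE_continuous_le[OF cabs, of "- closure \<Omega>"]) auto
    thus ?thesis by simp
  qed
  with v cv show thesis by (rule that)
qed

end

section \<open>Regularity by duality\<close>

lemma pair_convolution_integrable:
  fixes \<psi> k :: "'a::euclidean_space \<Rightarrow> real"
  assumes \<psi>: "integrable lborel \<psi>" and k: "integrable lborel k"
  shows "integrable (lborel \<Otimes>\<^sub>M lborel) (\<lambda>(x, y). \<psi> x * k (x - y))"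
    and "(\<integral>(x, y). \<psi> x * k (x - y) \<partial>(lborel \<Otimes>\<^sub>M lborel)) = (\<integral>x. \<psi> x \<partial>lborel) * (\<integral>h. k h \<partial>lborel)"
proof -
  have [measurable]: "\<psi> \<in> borel_measurable borel" "k \<in> borel_measurable borel" using \<psi> k by auto
  have eq: "(\<integral>y. norm (\<psi> x * k (x - y)) \<partial>lborel) = norm (\<psi> x) * (\<integral>h. norm (k h) \<partial>lborel)" for x
    using integral_lborel_reflect(1)[of "\<lambda>h. norm (k h)" x] by (simp add: abs_mult)
  show i: "integrable (lborel \<Otimes>\<^sub>M lborel) (\<lambda>(x, y). \<psi> x * k (x - y))"
  proof (rule lborel_pair.Fubini_integrable)
    show "integrable lborel (\<lambda>x. \<integral>y. norm (case (x, y) of (x, y) \<Rightarrow> \<psi> x * k (x - y)) \<partial>lborel)"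
      unfolding prod.case eq using \<psi> by simp
    show "AE x in lborel. integrable lborel (\<lambda>y. case (x, y) of (x, y) \<Rightarrow> \<psi> x * k (x - y))"
      using integral_lborel_reflect(2)[of k] k by simp
  qed simp
  have "(\<integral>(x, y). \<psi> x * k (x - y) \<partial>(lborel \<Otimes>\<^sub>M lborel)) = (\<integral>x. \<integral>y. \<psi> x * k (x - y) \<partial>lborel \<partial>lborel)"
    by (rule lborel_pair.integral_fst[OF i, symmetric])
  also have "\<dots> = (\<integral>x. \<psi> x * (\<integral>h. k h \<partial>lborel) \<partial>lborel)"
    using integral_lborel_reflect(1)[of k] by simp
  finally show "(\<integral>(x, y). \<psi> x * k (x - y) \<partial>(lborel \<Otimes>\<^sub>M lborel)) = (\<integral>x. \<psi> x \<partial>lborel) * (\<integral>h. k h \<partial>lborel)" by simp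
qed

lemma pair_convolution_integrable':
  fixes \<psi> k :: "'a::euclidean_space \<Rightarrow> real"
  assumes \<psi>: "integrable lborel \<psi>" and k: "integrable lborel k" and sym: "\<And>h. k (- h) = k h"
  shows "integrable (lborel \<Otimes>\<^sub>M lborel) (\<lambda>(x, y). \<psi> y * k (x - y))"
    and "(\<integral>(x, y). \<psi> y * k (x - y) \<partial>(lborel \<Otimes>\<^sub>M lborel)) = (\<integral>x. \<psi> x \<partial>lborel) * (\<integral>h. k h \<partial>lborel)"
proof -
  have e: "k (y - x) = k (x - y)" for x y using sym[of "x - y"] by simp
  note i = pair_convolution_integrable[OF \<psi> k]
  show "integrable (lborel \<Otimes>\<^sub>M lborel) (\<lambda>(x, y). \<psi> y * k (x - y))"
    using lborel_pair.integrable_product_swap[OF i(1)] by (simp add: e)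
  have "(\<integral>(x, y). \<psi> y * k (x - y) \<partial>(lborel \<Otimes>\<^sub>M lborel)) = (\<integral>(x, y). \<psi> x * k (x - y) \<partial>(lborel \<Otimes>\<^sub>M lborel))"
    using lborel_pair.integral_product_swap[OF borel_measurable_integrable[OF i(1)]] by (simp add: e)
  thus "(\<integral>(x, y). \<psi> y * k (x - y) \<partial>(lborel \<Otimes>\<^sub>M lborel)) = (\<integral>x. \<psi> x \<partial>lborel) * (\<integral>h. k h \<partial>lborel)"
    using i(2) by simp
qed

lemma powr_abs_diff_le:
  fixes a b q :: real
  assumes "q > 0"
  shows "\<bar>a - b\<bar> powr q \<le> 2 powr q * (\<bar>a\<bar> powr q + \<bar>b\<bar> powr q)"
proof -
  have "\<bar>a - b\<bar> powr q \<le> (2 * max \<bar>a\<bar> \<bar>b\<bar>) powr q" using assms by (intro powr_mono2) auto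
  also have "\<dots> = 2 powr q * max \<bar>a\<bar> \<bar>b\<bar> powr q" by (simp add: powr_mult)
  also have "max \<bar>a\<bar> \<bar>b\<bar> powr q \<le> \<bar>a\<bar> powr q + \<bar>b\<bar> powr q" by (auto simp: max_def)
  finally show ?thesis by (simp add: mult_left_mono)
qed

context fractional_domain
begin

text \<open>The truncated kernel \<open>F n\<close> is the extremal element in the duality between \<open>L\<^sup>p\<close> and
  \<open>L\<^sup>p'\<close> on pairs of points. Testing \<open>\<xi>\<close> against the associated datum \<open>g\<close> bounds the
  truncated seminorm by the sup norm of the solution, which Stampacchia's method controls by
  the \<open>L\<^sup>p\<close> norm of \<open>F n\<close>.\<close>

lemma dual_seminorm:
  fixes \<xi> :: "'a \<Rightarrow> real" and t p' K :: real
  assumes cone: "exterior_cone_condition \<Omega>" and t: "0 < t" "t < s" and p': "p' = p / (p - 1)"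
    and \<xi>m[measurable]: "\<xi> \<in> borel_measurable borel" and \<xi>0: "\<And>x. x \<notin> \<Omega> \<Longrightarrow> \<xi> x = 0"
    and \<xi>p: "integrable lborel (\<lambda>x. \<bar>\<xi> x\<bar> powr p')" and K: "K \<ge> 0"
    and bd: "\<And>v g m Mg. weak_solution v g \<Longrightarrow> g \<in> borel_measurable borel \<Longrightarrow> (\<And>x. \<bar>g x\<bar> \<le> Mg) \<Longrightarrow>
        continuous_on UNIV v \<Longrightarrow> (\<And>x. x \<notin> \<Omega> \<Longrightarrow> v x = 0) \<Longrightarrow> (\<And>x. \<bar>v x\<bar> \<le> m) \<Longrightarrow>
        \<bar>\<integral>x. \<xi> x * g x \<partial>lborel\<bar> \<le> K * m"
  shows "(\<integral>\<^sup>+z. ennreal (case z of (x, y) \<Rightarrow> \<bar>\<xi> x - \<xi> y\<bar> powr p' / norm (x - y) powr (real DIM('a) + t * p')) \<partial>(lborel \<Otimes>\<^sub>M lborel)) < \<infinity>"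
proof -
  let ?LL = "lborel \<Otimes>\<^sub>M (lborel :: 'a measure)"
  let ?N = "real DIM('a)"
  have p'1: "p' > 1" "1 / p' = 1 - 1 / p" "p * (p' - 1) = p'" using p by (auto simp: p' field_simps)
  \<comment> \<open>The weight for which the power p' of |D| is the integrand of the seminorm of
    order t.\<close>
  define c where "c = ?N / p' + t"
  have cp: "c * p' = ?N + t * p'" using p'1 by (simp add: c_def field_simps)
  have c0: "c > 0" using t p'1 by (simp add: c_def add_pos_pos)
  \<comment> \<open>The exponent left over when the energy weight of order s is paid for with the
    weight \<open>c\<close> and Hoelder's exponent p/(p-2); it is positive because t < s.\<close>
  define b where "b = 2 * (s - t) * p / (p - 2)"
  have b: "b > 0" using t p by (simp add: b_def)
  define \<kappa> where "\<kappa> h = indicat_real (cball 0 1) h * norm h powr (b - ?N)" for h :: 'a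
  have [measurable]: "cball (0::'a) 1 \<in> sets borel" "ball (0::'a) 1 \<in> sets borel" by auto
  have \<kappa>m[measurable]: "\<kappa> \<in> borel_measurable borel" unfolding \<kappa>_def by measurable
  have \<kappa>i: "integrable lborel \<kappa>"
  proof (rule integrableI_nonneg)
    have "(\<integral>\<^sup>+h. ennreal (\<kappa> h) \<partial>lborel) = (\<integral>\<^sup>+h. indicator (cball 0 1) h * ennreal (norm h powr (b - ?N)) \<partial>(lborel :: 'a measure))"
      by (intro nn_integral_cong) (auto simp: \<kappa>_def indicator_def)
    thus "(\<integral>\<^sup>+h. ennreal (\<kappa> h) \<partial>lborel) < \<infinity>" using near_kernel_finite[OF b, where 'a='a] by simp
  qed (auto simp: \<kappa>_def)
  define \<kappa>b where "\<kappa>b = (\<integral>h. \<kappa> h \<partial>lborel)"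
  have \<kappa>0: "\<kappa> h \<ge> 0" "\<kappa> (- h) = \<kappa> h" for h by (auto simp: \<kappa>_def indicator_def)
  have \<kappa>b: "\<kappa>b \<ge> 0" unfolding \<kappa>b_def using \<kappa>0 by (intro integral_nonneg_AE) auto
  define \<beta> where "\<beta> h = indicat_real (ball 0 1) h" for h :: 'a
  have [measurable]: "\<beta> \<in> borel_measurable borel" unfolding \<beta>_def by measurable
  have \<beta>i: "integrable lborel \<beta>" unfolding \<beta>_def
    using emeasure_lborel_ball_finite[of "0::'a" 1] by (intro integrable_real_indicator) auto
  have \<beta>0: "\<beta> h \<ge> 0" "\<beta> (- h) = \<beta> h" for h by (auto simp: \<beta>_def indicator_def)
  define \<beta>b where "\<beta>b = (\<integral>h. \<beta> h \<partial>lborel)"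
  have \<beta>b: "\<beta>b \<ge> 0" unfolding \<beta>b_def using \<beta>0 by (intro integral_nonneg_AE) auto
  have \<Omega>i: "integrable lborel (indicat_real \<Omega>)" using domain_finite by simp
  have \<xi>i: "integrable lborel \<xi>"
  proof (rule Bochner_Integration.integrable_bound)
    show "integrable lborel (\<lambda>x. indicat_real \<Omega> x + \<bar>\<xi> x\<bar> powr p')" using \<xi>p \<Omega>i by simp
    show "AE x in lborel. norm (\<xi> x) \<le> norm (indicat_real \<Omega> x + \<bar>\<xi> x\<bar> powr p')"
    proof (intro AE_I2)
      fix x
      have "\<bar>\<xi> x\<bar> \<le> indicat_real \<Omega> x + \<bar>\<xi> x\<bar> powr p'"
      proof (cases "x \<in> \<Omega>")
        case True
        show ?thesis
        proof (cases "\<bar>\<xi> x\<bar> \<le> 1")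
          case False
          hence "\<bar>\<xi> x\<bar> powr 1 \<le> \<bar>\<xi> x\<bar> powr p'" using p'1 by (intro powr_mono) auto
          thus ?thesis using False True by simp
        qed (use True in \<open>simp add: add_increasing2\<close>)
      qed (simp add: \<xi>0)
      thus "norm (\<xi> x) \<le> norm (indicat_real \<Omega> x + \<bar>\<xi> x\<bar> powr p')" by simp
    qed
  qed simp
  define D where "D = (\<lambda>(x, y). (\<xi> x - \<xi> y) / norm (x - y) powr c)"
  have Dm[measurable]: "D \<in> borel_measurable ?LL" unfolding D_def by measurable
  \<comment> \<open>The distance from the diagonal keeps the kernel bounded; distances below 1 and
    contact with \<Omega> give the set finite measure.\<close>
  define X where "X n = {z :: 'a \<times> 'a. 1 / real (Suc n) < norm (fst z - snd z) \<and> norm (fst z - snd z) < 1 \<and> (fst z \<in> \<Omega> \<or> snd z \<in> \<Omega>)}" for n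
  have Xm[measurable]: "X n \<in> sets ?LL" for n
  proof -
    have "X n = {z \<in> space ?LL. 1 / real (Suc n) < norm (fst z - snd z) \<and> norm (fst z - snd z) < 1 \<and> (fst z \<in> \<Omega> \<or> snd z \<in> \<Omega>)}"
      by (simp add: X_def space_pair_measure)
    also have "\<dots> \<in> sets ?LL" by measurable
    finally show ?thesis .
  qed
  \<comment> \<open>The extremal function sgn D |D|^(p'-1), truncated in height as well. Since
    p(p'-1) = p', its p-th power is the truncated seminorm integrand.\<close>
  define F where "F n z = indicat_real (X n) z * sgn (D z) * (min \<bar>D z\<bar> (real (Suc n))) powr (p' - 1)" for n z
  have Fm[measurable]: "F n \<in> borel_measurable ?LL" for n unfolding F_def by measurable
  have Fpow: "\<bar>F n z\<bar> powr p = indicat_real (X n) z * (min \<bar>D z\<bar> (real (Suc n))) powr p'" for n z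
  proof (cases "D z = 0")
    case False
    have a1: "((min \<bar>D z\<bar> (real (Suc n))) powr (p' - 1)) powr p = (min \<bar>D z\<bar> (real (Suc n))) powr p'"
      unfolding powr_powr using p'1(3) by (simp add: mult.commute)
    have a2: "\<bar>F n z\<bar> = indicat_real (X n) z * (min \<bar>D z\<bar> (real (Suc n))) powr (p' - 1)"
      using False by (simp add: F_def abs_mult abs_sgn_eq)
    show ?thesis
    proof (cases "z \<in> X n")
      case True
      thus ?thesis unfolding a2 using a1 by (simp only: indicator_simps mult_1_left)
    next
      case False
      thus ?thesis by (simp add: F_def)
    qed
  qed (simp add: F_def)
  have Fle: "\<bar>F n z\<bar> \<le> real (Suc n) powr (p' - 1)" for n z
  proof -
    have "(min \<bar>D z\<bar> (real (Suc n))) powr (p' - 1) \<le> real (Suc n) powr (p' - 1)"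
      using p'1 by (intro powr_mono2) auto
    moreover have "\<bar>F n z\<bar> \<le> (min \<bar>D z\<bar> (real (Suc n))) powr (p' - 1)"
      by (cases "z \<in> X n") (simp_all add: F_def abs_mult abs_sgn_eq)
    ultimately show ?thesis by linarith
  qed
  have Fanti: "F n (y, x) = - F n (x, y)" for n x y
  proof -
    have "D (y, x) = - D (x, y)" by (simp add: D_def norm_minus_commute minus_divide_left)
    moreover have "(y, x) \<in> X n \<longleftrightarrow> (x, y) \<in> X n" by (auto simp: X_def norm_minus_commute)
    ultimately show ?thesis by (simp add: F_def indicator_def sgn_minus)
  qed
  \<comment> \<open>An inequality rather than an equality, because the height is cut in F but not in
    D.\<close>
  have DF: "\<bar>F n z\<bar> powr p \<le> D z * F n z" for n z
  proof (cases "z \<in> X n \<and> D z \<noteq> 0")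
    case True
    let ?m = "min \<bar>D z\<bar> (real (Suc n))"
    have "?m powr p' = ?m powr 1 * ?m powr (p' - 1)" by (simp only: powr_add[symmetric]) simp
    also have "\<dots> \<le> \<bar>D z\<bar> * ?m powr (p' - 1)" by (intro mult_right_mono) auto
    also have "\<dots> = D z * F n z" using True by (simp add: F_def sgn_if)
    finally show ?thesis unfolding Fpow using True by simp
  qed (auto simp: Fpow F_def)
  obtain D0 where D0: "D0 > 0" and sup: "\<And>v B. v \<in> energy_space \<Omega> s \<Longrightarrow> B > 0 \<Longrightarrow>
     (\<And>\<phi> A. \<phi> \<in> energy_space \<Omega> s \<Longrightarrow> A \<in> sets borel \<Longrightarrow> A \<subseteq> \<Omega> \<Longrightarrow> AE x in lborel. x \<notin> A \<longrightarrow> \<phi> x = 0 \<Longrightarrow>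
         \<bar>energy s v \<phi>\<bar> \<le> B * measure lborel A powr \<gamma> * sqrt (energy s \<phi> \<phi>)) \<Longrightarrow>
     AE x in lborel. \<bar>v x\<bar> \<le> D0 * B" by (rule sup_bound) blast
  define C where "C = K * D0 * (2 * \<kappa>b) powr \<gamma>"
  have C: "C \<ge> 0" using K D0 by (simp add: C_def)
  define I where "I n = (\<integral>z. \<bar>F n z\<bar> powr p \<partial>?LL)" for n
  have I0: "I n \<ge> 0" for n unfolding I_def by (intro integral_nonneg_AE) auto
  have FI: "integrable ?LL (\<lambda>z. \<bar>F n z\<bar> powr p)" for n
  proof (rule Bochner_Integration.integrable_bound)
    let ?M = "(real (Suc n) powr (p' - 1)) powr p"
    show "integrable ?LL (\<lambda>z. ?M * ((case z of (x, y) \<Rightarrow> indicat_real \<Omega> x * \<beta> (x - y)) + (case z of (x, y) \<Rightarrow> indicat_real \<Omega> y * \<beta> (x - y))))"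
      using pair_convolution_integrable(1)[OF \<Omega>i \<beta>i] pair_convolution_integrable'(1)[OF \<Omega>i \<beta>i \<beta>0(2)] by simp
    show "AE z in ?LL. norm (\<bar>F n z\<bar> powr p) \<le> norm (?M * ((case z of (x, y) \<Rightarrow> indicat_real \<Omega> x * \<beta> (x - y)) + (case z of (x, y) \<Rightarrow> indicat_real \<Omega> y * \<beta> (x - y))))"
    proof (intro AE_I2)
      fix z :: "'a \<times> 'a"
      obtain x y where z: "z = (x, y)" by (cases z)
      have "\<bar>F n z\<bar> powr p \<le> ?M * (indicat_real \<Omega> x * \<beta> (x - y) + indicat_real \<Omega> y * \<beta> (x - y))"
      proof (cases "z \<in> X n")
        case True
        have "\<bar>F n z\<bar> powr p \<le> ?M" using Fle[of n z] p by (intro powr_mono2) auto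
        also have "?M = ?M * 1" by simp
        also have "\<dots> \<le> ?M * (indicat_real \<Omega> x * \<beta> (x - y) + indicat_real \<Omega> y * \<beta> (x - y))"
          using True by (intro mult_left_mono) (auto simp: X_def z \<beta>_def indicator_def)
        finally show ?thesis .
      next
        case False
        thus ?thesis using \<beta>0(1)[of "x - y"] by (simp add: F_def)
      qed
      thus "norm (\<bar>F n z\<bar> powr p) \<le> norm (?M * ((case z of (x, y) \<Rightarrow> indicat_real \<Omega> x * \<beta> (x - y)) + (case z of (x, y) \<Rightarrow> indicat_real \<Omega> y * \<beta> (x - y))))"
        by (simp add: z)
    qed
  qed simp
  have main: "I n \<le> C powr p'" for n
  proof -
    define f where "f x y = F n (x, y) / norm (x - y) powr c" for x y
    have fm[measurable]: "(\<lambda>(x, y). f x y) \<in> borel_measurable ?LL"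
    proof -
      have "(\<lambda>z. F n z / norm (fst z - snd z) powr c) \<in> borel_measurable ?LL" by measurable
      thus ?thesis by (simp add: f_def case_prod_beta)
    qed
    define b' where "b' = real (Suc n) powr (p' - 1) * real (Suc n) powr c"
    have b': "b' \<ge> 0" by (simp add: b'_def)
    have fle: "\<bar>f x y\<bar> \<le> b' * \<beta> (x - y)" for x y
    proof (cases "(x, y) \<in> X n")
      case True
      hence n: "1 / real (Suc n) < norm (x - y)" "norm (x - y) < 1" by (auto simp: X_def)
      have "1 / norm (x - y) powr c = (1 / norm (x - y)) powr c" by (simp add: powr_divide)
      also have "\<dots> \<le> real (Suc n) powr c"
      proof (rule powr_mono2)
        have "norm (x - y) > 0" using n(1) by (meson less_trans zero_less_divide_1_iff of_nat_0_less_iff zero_less_Suc)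
        thus "1 / norm (x - y) \<le> real (Suc n)" using n(1) by (simp add: field_simps)
      qed (use c0 in auto)
      finally have k: "1 / norm (x - y) powr c \<le> real (Suc n) powr c" .
      have "\<bar>f x y\<bar> = \<bar>F n (x, y)\<bar> * (1 / norm (x - y) powr c)" by (simp add: f_def abs_divide)
      also have "\<dots> \<le> b'" unfolding b'_def using Fle k by (intro mult_mono) auto
      finally show ?thesis using n(2) by (simp add: \<beta>_def)
    next
      case False
      thus ?thesis using b' \<beta>0(1)[of "x - y"] by (simp add: f_def F_def)
    qed
    have fanti: "f y x = - f x y" for x y by (simp add: f_def Fanti[of n x y] norm_minus_commute)
    \<comment> \<open>The fractional divergence of F. The factor 2 comes from the antisymmetry of f:
      integrating \<psi> against g tests f with the differences of \<psi>.\<close>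
    define g where "g x = 2 * (\<integral>y. f x y \<partial>lborel)" for x
    have gm[measurable]: "g \<in> borel_measurable borel"
      unfolding g_def using fm by measurable
    have gle: "\<bar>g x\<bar> \<le> 2 * (b' * \<beta>b)" for x
    proof -
      have \<beta>x: "integrable lborel (\<lambda>y. \<beta> (x - y))" "(\<integral>y. \<beta> (x - y) \<partial>lborel) = \<beta>b"
        using integral_lborel_reflect[of \<beta> x] \<beta>i by (simp_all add: \<beta>b_def)
      have "\<bar>\<integral>y. f x y \<partial>lborel\<bar> \<le> (\<integral>y. \<bar>f x y\<bar> \<partial>lborel)" by (rule integral_abs_bound)
      also have "\<dots> \<le> (\<integral>y. b' * \<beta> (x - y) \<partial>lborel)"
      proof (rule integral_mono')
        show "integrable lborel (\<lambda>y. b' * \<beta> (x - y))" using \<beta>x by simp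
        show "\<bar>f x y\<bar> \<le> b' * \<beta> (x - y)" for y by (rule fle)
        show "0 \<le> b' * \<beta> (x - y)" for y using b' \<beta>0(1) by simp
      qed
      also have "\<dots> = b' * \<beta>b" using \<beta>x by simp
      finally show ?thesis by (simp add: g_def abs_mult)
    qed
    have pairing: "integrable ?LL (\<lambda>(x, y). (\<psi> x - \<psi> y) * f x y)"
      "(\<integral>x. \<psi> x * g x \<partial>lborel) = (\<integral>(x, y). (\<psi> x - \<psi> y) * f x y \<partial>?LL)" if \<psi>: "integrable lborel \<psi>" for \<psi>
    proof -
      have [measurable]: "\<psi> \<in> borel_measurable borel" using \<psi> by auto
      have i1: "integrable ?LL (\<lambda>(x, y). \<psi> x * f x y)"
      proof (rule Bochner_Integration.integrable_bound)
        show "integrable ?LL (\<lambda>z. b' * (case z of (x, y) \<Rightarrow> \<psi> x * \<beta> (x - y)))"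
          using pair_convolution_integrable(1)[OF \<psi> \<beta>i] by simp
        show "(\<lambda>(x, y). \<psi> x * f x y) \<in> borel_measurable ?LL"
        proof -
          have "(\<lambda>z. \<psi> (fst z) * (case z of (x, y) \<Rightarrow> f x y)) \<in> borel_measurable ?LL" by measurable
          thus ?thesis by (simp add: case_prod_beta)
        qed
        show "AE z in ?LL. norm (case z of (x, y) \<Rightarrow> \<psi> x * f x y) \<le> norm (b' * (case z of (x, y) \<Rightarrow> \<psi> x * \<beta> (x - y)))"
        proof (intro AE_I2)
          fix z :: "'a \<times> 'a"
          obtain x y where z: "z = (x, y)" by (cases z)
          have "\<bar>\<psi> x\<bar> * \<bar>f x y\<bar> \<le> \<bar>\<psi> x\<bar> * (b' * \<beta> (x - y))" using fle[of x y] by (rule mult_left_mono) simp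
          thus "norm (case z of (x, y) \<Rightarrow> \<psi> x * f x y) \<le> norm (b' * (case z of (x, y) \<Rightarrow> \<psi> x * \<beta> (x - y)))"
            using b' \<beta>0(1)[of "x - y"] by (simp add: z abs_mult mult_ac)
        qed
      qed
      have i2: "integrable ?LL (\<lambda>(x, y). \<psi> y * f y x)" and e2: "(\<integral>(x, y). \<psi> y * f y x \<partial>?LL) = (\<integral>(x, y). \<psi> x * f x y \<partial>?LL)"
        using lborel_pair.integrable_product_swap[OF i1] lborel_pair.integral_product_swap[OF borel_measurable_integrable[OF i1]] by simp_all
      have eq: "(case z of (x, y) \<Rightarrow> (\<psi> x - \<psi> y) * f x y) = (case z of (x, y) \<Rightarrow> \<psi> x * f x y) + (case z of (x, y) \<Rightarrow> \<psi> y * f y x)" for z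
      proof (cases z)
        case (Pair x y)
        show ?thesis by (simp add: Pair fanti[of x y] algebra_simps)
      qed
      show "integrable ?LL (\<lambda>(x, y). (\<psi> x - \<psi> y) * f x y)" unfolding eq using i1 i2 by simp
      have "(\<integral>(x, y). (\<psi> x - \<psi> y) * f x y \<partial>?LL) = 2 * (\<integral>(x, y). \<psi> x * f x y \<partial>?LL)"
        unfolding eq using i1 i2 e2 by simp
      also have "(\<integral>(x, y). \<psi> x * f x y \<partial>?LL) = (\<integral>x. \<integral>y. \<psi> x * f x y \<partial>lborel \<partial>lborel)"
        by (rule lborel_pair.integral_fst[OF i1, symmetric])
      also have "\<dots> = (\<integral>x. \<psi> x * (\<integral>y. f x y \<partial>lborel) \<partial>lborel)" by simp
      also have "2 * \<dots> = (\<integral>x. \<psi> x * g x \<partial>lborel)"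
        by (subst Bochner_Integration.integral_mult_right_zero[symmetric]) (simp add: g_def mult_ac)
      finally show "(\<integral>x. \<psi> x * g x \<partial>lborel) = (\<integral>(x, y). (\<psi> x - \<psi> y) * f x y \<partial>?LL)" by simp
    qed
    have low: "I n \<le> (\<integral>x. \<xi> x * g x \<partial>lborel)"
    proof -
      have eq: "D z * F n z = (case z of (x, y) \<Rightarrow> (\<xi> x - \<xi> y) * f x y)" for z
        by (cases z) (simp add: D_def f_def)
      show ?thesis unfolding pairing(2)[OF \<xi>i] I_def eq[symmetric]
        using FI[of n] pairing(1)[OF \<xi>i] DF unfolding eq[symmetric] by (intro integral_mono) auto
    qed
    obtain v where v: "weak_solution v g" and vc: "continuous_on UNIV v" and v0: "\<And>x. x \<notin> \<Omega> \<Longrightarrow> v x = 0"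
      using continuous_weak_solution[OF cone gm gle] by blast
    have vE: "v \<in> energy_space \<Omega> s" using v by (simp add: weak_solution_def)
    \<comment> \<open>Cauchy-Schwarz separates the energy of \<phi> from q, which lives on pairs
      meeting A. Hoelder then splits the square of q into the L^p norm of F and an integrable kernel
      over such pairs; the latter yields the power \<gamma> of the measure of A.\<close>
    have test: "\<bar>energy s v \<phi>\<bar> \<le> I n powr (1 / p) * (2 * \<kappa>b) powr \<gamma> * measure lborel A powr \<gamma> * sqrt (energy s \<phi> \<phi>)"
      if \<phi>: "\<phi> \<in> energy_space \<Omega> s" and A[measurable]: "A \<in> sets borel" and sub: "A \<subseteq> \<Omega>" and off: "AE x in lborel. x \<notin> A \<longrightarrow> \<phi> x = 0" for \<phi> A
    proof -
      note [measurable] = energy_spaceD(1)[OF \<phi>]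
      have Ai: "integrable lborel (indicat_real A)" using subset_domain_finite(1)[OF sub] by simp
      have \<phi>i: "integrable lborel \<phi>"
      proof (rule Bochner_Integration.integrable_bound)
        show "integrable lborel (\<lambda>x. indicat_real \<Omega> x + (\<phi> x)\<^sup>2)" using energy_space_L2[OF \<phi>] \<Omega>i by simp
        show "AE x in lborel. norm (\<phi> x) \<le> norm (indicat_real \<Omega> x + (\<phi> x)\<^sup>2)"
          using energy_spaceD(2)[OF \<phi>]
        proof eventually_elim
          case (elim x)
          have "2 * \<bar>\<phi> x\<bar> \<le> 1 + (\<phi> x)\<^sup>2" using sum_squares_bound[of 1 "\<bar>\<phi> x\<bar>"] by simp
          hence "\<bar>\<phi> x\<bar> \<le> 1 + (\<phi> x)\<^sup>2" by linarith
          thus ?case using elim by (cases "x \<in> \<Omega>") auto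
        qed
      qed simp
      define SA where "SA = {z :: 'a \<times> 'a. fst z \<in> A \<or> snd z \<in> A}"
      have SAm[measurable]: "SA \<in> sets ?LL"
      proof -
        have "SA = (A \<times> UNIV) \<union> (UNIV \<times> A)" by (auto simp: SA_def)
        thus ?thesis by simp
      qed
      \<comment> \<open>The exponent of |x - y| that remains when F with weight c is paired with the
        difference quotient in the energy.\<close>
      define d where "d = ?N / 2 + s - c"
      define h where "h z = indicat_real SA z * indicat_real (X n) z * norm (fst z - snd z) powr (d + d)" for z :: "'a \<times> 'a"
      define q where "q z = indicat_real SA z * F n z * norm (fst z - snd z) powr d" for z
      have hm[measurable]: "h \<in> borel_measurable ?LL" unfolding h_def by measurable
      have qm[measurable]: "q \<in> borel_measurable ?LL" unfolding q_def by measurable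
      have h0: "h z \<ge> 0" for z by (simp add: h_def)
      have q2: "(q z)\<^sup>2 = (F n z)\<^sup>2 * h z" for z
      proof -
        have sq: "(norm (fst z - snd z) powr d)\<^sup>2 = norm (fst z - snd z) powr (d + d)" by (simp only: power2_eq_square powr_add)
        show ?thesis
        proof (cases "z \<in> X n")
          case True
          have "(indicat_real SA z)\<^sup>2 = indicat_real SA z" by (simp add: indicator_def)
          thus ?thesis using True unfolding q_def h_def power_mult_distrib sq by simp
        next
          case False
          thus ?thesis by (simp add: q_def F_def)
        qed
      qed
      have ex: "p / 2 > 1" "p / (p - 2) > 1" "1 / (p / 2) + 1 / (p / (p - 2)) = 1" using p by (auto simp: field_simps)
      have e1: "((F n z)\<^sup>2) powr (p / 2) = \<bar>F n z\<bar> powr p" for z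
      proof -
        have "(F n z)\<^sup>2 powr (p / 2) = (\<bar>F n z\<bar> powr 2) powr (p / 2)" by simp
        also have "\<dots> = \<bar>F n z\<bar> powr p" unfolding powr_powr by simp
        finally show ?thesis .
      qed
      have dd: "(d + d) * (p / (p - 2)) = b - ?N"
      proof -
        have gen: "(N / 2 + s - (N * (1 - u) + t)) + (N / 2 + s - (N * (1 - u) + t)) = 2 * (s - t) - N * (1 - 2 * u)" for N u :: real
          by (simp add: algebra_simps)
        have "?N / p' = ?N * (1 - 1 / p)" unfolding p'1(2)[symmetric] by simp
        hence "d + d = 2 * (s - t) - ?N * (1 - 2 * (1 / p))" unfolding d_def c_def by (simp only: gen)
        hence "d + d = 2 * (s - t) - ?N * (1 - 2 / p)" by simp
        hence "(d + d) * (p / (p - 2)) = b - ?N * ((1 - 2 / p) * (p / (p - 2)))"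
        proof -
          have "b = 2 * (s - t) * (p / (p - 2))" by (simp add: b_def)
          moreover have "(A - N * B) * E = A * E - N * (B * E)" for A B E N :: real by (simp add: algebra_simps)
          ultimately show ?thesis using \<open>d + d = 2 * (s - t) - ?N * (1 - 2 / p)\<close> by (simp only:)
        qed
        also have "(1 - 2 / p) * (p / (p - 2)) = 1" using p by (simp add: field_simps)
        finally show ?thesis by simp
      qed
      have e2: "h z powr (p / (p - 2)) = indicat_real SA z * indicat_real (X n) z * norm (fst z - snd z) powr (b - ?N)" for z
        unfolding h_def using dd by (simp add: indicator_def powr_powr)
      have hb: "h z powr (p / (p - 2)) \<le> (case z of (x, y) \<Rightarrow> indicat_real A x * \<kappa> (x - y)) + (case z of (x, y) \<Rightarrow> indicat_real A y * \<kappa> (x - y))" for z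
      proof (cases "z \<in> X n \<and> z \<in> SA")
        case True
        obtain x y where z: "z = (x, y)" by (cases z)
        have "x - y \<in> cball 0 1" using True by (simp add: X_def z)
        thus ?thesis unfolding e2 using True by (auto simp: z \<kappa>_def SA_def indicator_def)
      next
        case False
        hence "h z powr (p / (p - 2)) = 0" unfolding e2 by auto
        thus ?thesis using \<kappa>0(1) by (simp add: case_prod_beta)
      qed
      have AK: "integrable ?LL (\<lambda>z. (case z of (x, y) \<Rightarrow> indicat_real A x * \<kappa> (x - y)) + (case z of (x, y) \<Rightarrow> indicat_real A y * \<kappa> (x - y)))"
        "(\<integral>z. (case z of (x, y) \<Rightarrow> indicat_real A x * \<kappa> (x - y)) + (case z of (x, y) \<Rightarrow> indicat_real A y * \<kappa> (x - y)) \<partial>?LL) = 2 * \<kappa>b * measure lborel A"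
        using pair_convolution_integrable[OF Ai \<kappa>i] pair_convolution_integrable'[OF Ai \<kappa>i \<kappa>0(2)] by (simp_all add: \<kappa>b_def)
      have i2: "integrable ?LL (\<lambda>z. h z powr (p / (p - 2)))"
        by (rule Bochner_Integration.integrable_bound[OF AK(1)])
           (use hb in \<open>auto intro!: AE_I2 order_trans[OF _ abs_ge_self]\<close>)
      have i1: "integrable ?LL (\<lambda>z. ((F n z)\<^sup>2) powr (p / 2))" unfolding e1 by (rule FI)
      note H = Hoelder_inequality[OF _ _ _ h0 ex i1 i2, unfolded e1 q2[symmetric]]
      have qi: "integrable ?LL (\<lambda>z. (q z)\<^sup>2)" by (rule H(1)) simp_all
      have "(\<integral>z. (q z)\<^sup>2 \<partial>?LL) \<le> I n powr (1 / (p / 2)) * (\<integral>z. h z powr (p / (p - 2)) \<partial>?LL) powr (1 / (p / (p - 2)))"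
        unfolding I_def by (rule H(2)) simp_all
      also have "\<dots> \<le> I n powr (1 / (p / 2)) * (2 * \<kappa>b * measure lborel A) powr (1 / (p / (p - 2)))"
      proof (intro mult_left_mono powr_mono2)
        show "(\<integral>z. h z powr (p / (p - 2)) \<partial>?LL) \<le> 2 * \<kappa>b * measure lborel A"
          unfolding AK(2)[symmetric] by (rule integral_mono[OF i2 AK(1) hb])
      qed (use p in \<open>auto intro!: integral_nonneg_AE\<close>)
      also have "\<dots> = (I n powr (1 / p) * (2 * \<kappa>b * measure lborel A) powr \<gamma>)\<^sup>2"
      proof -
        have "1 / (p / 2) = 1 / p + 1 / p" "1 / (p / (p - 2)) = \<gamma> + \<gamma>" using p by (auto simp: \<gamma>_def field_simps)
        thus ?thesis by (simp only: power_mult_distrib power2_eq_square powr_add mult_ac)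
      qed
      finally have "sqrt (\<integral>z. (q z)\<^sup>2 \<partial>?LL) \<le> sqrt ((I n powr (1 / p) * (2 * \<kappa>b * measure lborel A) powr \<gamma>)\<^sup>2)"
        by (rule real_sqrt_le_mono)
      also have "\<dots> = I n powr (1 / p) * (2 * \<kappa>b * measure lborel A) powr \<gamma>" by simp
      also have "(2 * \<kappa>b * measure lborel A) powr \<gamma> = (2 * \<kappa>b) powr \<gamma> * measure lborel A powr \<gamma>"
        by (rule powr_mult)
      finally have n1: "sqrt (\<integral>z. (q z)\<^sup>2 \<partial>?LL) \<le> I n powr (1 / p) * ((2 * \<kappa>b) powr \<gamma> * measure lborel A powr \<gamma>)" .
      have ae: "AE z in ?LL. (case z of (x, y) \<Rightarrow> (\<phi> x - \<phi> y) * f x y) = q z * gag s \<phi> z"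
        using AE_lborel_pair(1)[OF off, where 'b='a] AE_lborel_pair(2)[OF off, where 'b='a]
      proof eventually_elim
        case (elim z)
        obtain x y where z: "z = (x, y)" by (cases z)
        show ?case
        proof (cases "z \<in> SA \<and> x \<noteq> y")
          case True
          have "norm (x - y) powr d = norm (x - y) powr (?N / 2 + s) / norm (x - y) powr c"
            unfolding d_def by (rule powr_diff)
          thus ?thesis using True by (simp add: z q_def f_def gag_def)
        next
          case False
          thus ?thesis using elim by (auto simp: z q_def gag_def SA_def)
        qed
      qed
      have "energy s v \<phi> = (\<integral>x. \<phi> x * g x \<partial>lborel)" using v \<phi> by (simp add: weak_solution_def mult.commute)
      also have "\<dots> = (\<integral>(x, y). (\<phi> x - \<phi> y) * f x y \<partial>?LL)" by (rule pairing(2)[OF \<phi>i])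
      also have "\<dots> = (\<integral>z. q z * gag s \<phi> z \<partial>?LL)"
        using ae borel_measurable_integrable[OF pairing(1)[OF \<phi>i]] by (intro integral_cong_AE) auto
      also have "\<bar>\<dots>\<bar> \<le> sqrt (\<integral>z. (q z)\<^sup>2 \<partial>?LL) * sqrt (\<integral>z. (gag s \<phi> z)\<^sup>2 \<partial>?LL)"
        by (rule L2_Cauchy_Schwarz[OF _ _ qi energy_spaceD(3)[OF \<phi>]]) simp_all
      also have "(\<integral>z. (gag s \<phi> z)\<^sup>2 \<partial>?LL) = energy s \<phi> \<phi>" by (simp add: energy_def power2_eq_square)
      also have "sqrt (\<integral>z. (q z)\<^sup>2 \<partial>?LL) * sqrt (energy s \<phi> \<phi>) \<le> (I n powr (1 / p) * ((2 * \<kappa>b) powr \<gamma> * measure lborel A powr \<gamma>)) * sqrt (energy s \<phi> \<phi>)"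
        by (rule mult_right_mono[OF n1]) (simp add: energy_nonneg)
      finally show ?thesis by (simp only: mult.assoc)
    qed
    \<comment> \<open>The positive \<eta> is required because \<open>I n\<close> may vanish while
      \<open>sup_bound\<close> asks for a positive constant; it is sent to 0 next.\<close>
    have le: "I n \<le> K * (D0 * (I n powr (1 / p) * (2 * \<kappa>b) powr \<gamma> + \<eta>))" if \<eta>: "\<eta> > 0" for \<eta>
    proof -
      let ?B = "I n powr (1 / p) * (2 * \<kappa>b) powr \<gamma> + \<eta>"
      have B: "?B > 0" using \<eta> by (intro add_nonneg_pos) auto
      have "AE x in lborel. \<bar>v x\<bar> \<le> D0 * ?B"
      proof (rule sup[OF vE B])
        fix \<phi> A assume A: "\<phi> \<in> energy_space \<Omega> s" "A \<in> sets borel" "A \<subseteq> \<Omega>" "AE x in lborel. x \<notin> A \<longrightarrow> \<phi> x = 0"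
        have "\<bar>energy s v \<phi>\<bar> \<le> I n powr (1 / p) * (2 * \<kappa>b) powr \<gamma> * measure lborel A powr \<gamma> * sqrt (energy s \<phi> \<phi>)"
          by (rule test[OF A])
        also have "\<dots> \<le> ?B * measure lborel A powr \<gamma> * sqrt (energy s \<phi> \<phi>)"
          using \<eta> by (intro mult_right_mono) (auto simp: energy_nonneg)
        finally show "\<bar>energy s v \<phi>\<bar> \<le> ?B * measure lborel A powr \<gamma> * sqrt (energy s \<phi> \<phi>)" .
      qed
      hence vb: "\<bar>v x\<bar> \<le> D0 * ?B" for x
        using vc by (intro AE_continuous_le[of "\<lambda>x. \<bar>v x\<bar>" UNIV]) (auto intro!: continuous_intros)
      have "\<bar>\<integral>x. \<xi> x * g x \<partial>lborel\<bar> \<le> K * (D0 * ?B)" by (rule bd[OF v gm gle vc v0 vb])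
      thus ?thesis using low by linarith
    qed
    have le': "I n \<le> C * I n powr (1 / p)"
    proof (rule field_le_epsilon)
      fix \<epsilon> :: real assume \<epsilon>: "0 < \<epsilon>"
      define \<eta> where "\<eta> = \<epsilon> / (K * D0 + 1)"
      have KD: "K * D0 + 1 > 0" using K D0 by (simp add: add_nonneg_pos)
      have \<eta>: "\<eta> > 0" using \<epsilon> KD by (simp add: \<eta>_def)
      have "K * D0 * \<eta> \<le> (K * D0 + 1) * \<eta>" using \<eta> by (intro mult_right_mono) auto
      also have "\<dots> = \<epsilon>" using KD by (simp add: \<eta>_def)
      finally have "K * D0 * \<eta> \<le> \<epsilon>" .
      moreover have "K * (D0 * (I n powr (1 / p) * (2 * \<kappa>b) powr \<gamma> + \<eta>)) = C * I n powr (1 / p) + K * D0 * \<eta>"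
        by (simp add: C_def algebra_simps)
      ultimately show "I n \<le> C * I n powr (1 / p) + \<epsilon>" using le[OF \<eta>] by linarith
    qed
    show "I n \<le> C powr p'"
    proof (cases "I n = 0")
      case False
      hence I: "I n > 0" using I0[of n] by simp
      \<comment> \<open>Absorption: \<open>I n\<close> is finite by truncation, so a power of it may
        be cancelled, leaving a bound independent of n.\<close>
      have "I n = I n powr (1 / p') * I n powr (1 / p)"
        using I p'1(2) by (simp add: powr_add[symmetric])
      hence "I n powr (1 / p') * I n powr (1 / p) \<le> C * I n powr (1 / p)" using le' by simp
      hence "I n powr (1 / p') \<le> C" using I by (subst (asm) mult_le_cancel_right_pos) auto
      hence "(I n powr (1 / p')) powr p' \<le> C powr p'" using p'1 by (intro powr_mono2) auto
      moreover have "(I n powr (1 / p')) powr p' = I n" using I p'1(1) by (simp add: powr_powr)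
      ultimately show ?thesis by simp
    qed simp
  qed
  define Y where "Y = {z :: 'a \<times> 'a. norm (fst z - snd z) < 1}"
  have Ym[measurable]: "Y \<in> sets ?LL"
  proof -
    have "Y = {z \<in> space ?LL. norm (fst z - snd z) < 1}" by (simp add: Y_def space_pair_measure)
    also have "\<dots> \<in> sets ?LL" by measurable
    finally show ?thesis .
  qed
  \<comment> \<open>At each fixed pair the truncations eventually become inactive, so Fatou carries
    the uniform bound over to the full seminorm at distances below 1.\<close>
  have near: "(\<integral>\<^sup>+z. ennreal (indicat_real Y z * \<bar>D z\<bar> powr p') \<partial>?LL) \<le> ennreal (C powr p')"
  proof -
    have "(\<integral>\<^sup>+z. ennreal (indicat_real Y z * \<bar>D z\<bar> powr p') \<partial>?LL) = (\<integral>\<^sup>+z. liminf (\<lambda>n. ennreal (\<bar>F n z\<bar> powr p)) \<partial>?LL)"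
    proof (intro nn_integral_cong)
      fix z :: "'a \<times> 'a"
      obtain x y where z: "z = (x, y)" by (cases z)
      have "\<forall>\<^sub>F n in sequentially. \<bar>F n z\<bar> powr p = indicat_real Y z * \<bar>D z\<bar> powr p'"
      proof (cases "z \<in> Y \<and> D z \<noteq> 0")
        case True
        have "x \<noteq> y" using True by (auto simp: z D_def)
        hence "norm (x - y) > 0" by simp
        then obtain n1 where n1: "1 / real (Suc n1) < norm (x - y)" using nat_approx_posE by blast
        obtain n2 where n2: "\<bar>D z\<bar> \<le> real n2" using real_arch_simple by blast
        have om: "x \<in> \<Omega> \<or> y \<in> \<Omega>"
        proof (rule ccontr)
          assume "\<not> (x \<in> \<Omega> \<or> y \<in> \<Omega>)"
          hence "\<xi> x = 0" "\<xi> y = 0" using \<xi>0 by blast+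
          thus False using True by (simp add: z D_def)
        qed
        show ?thesis
          using eventually_ge_at_top[of "max n1 n2"]
        proof eventually_elim
          case (elim n)
          have "1 / real (Suc n) \<le> 1 / real (Suc n1)" using elim by (intro divide_left_mono) auto
          hence "z \<in> X n" using n1 om True by (simp add: X_def Y_def z)
          moreover have "min \<bar>D z\<bar> (real (Suc n)) = \<bar>D z\<bar>" using n2 elim by (intro min_absorb1) auto
          ultimately show ?case unfolding Fpow using True by simp
        qed
      next
        case False
        have "\<bar>F n z\<bar> powr p = indicat_real Y z * \<bar>D z\<bar> powr p'" for n
          using False by (auto simp: F_def X_def Y_def indicator_def)
        thus ?thesis by simp
      qed
      hence "(\<lambda>n. ennreal (\<bar>F n z\<bar> powr p)) \<longlonglongrightarrow> ennreal (indicat_real Y z * \<bar>D z\<bar> powr p')"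
        by (intro tendsto_eventually) (auto elim!: eventually_mono)
      thus "ennreal (indicat_real Y z * \<bar>D z\<bar> powr p') = liminf (\<lambda>n. ennreal (\<bar>F n z\<bar> powr p))"
        by (intro lim_imp_Liminf[symmetric]) simp_all
    qed
    also have "\<dots> \<le> liminf (\<lambda>n. \<integral>\<^sup>+z. ennreal (\<bar>F n z\<bar> powr p) \<partial>?LL)"
      by (rule nn_integral_liminf) simp
    also have "\<dots> \<le> ennreal (C powr p')"
    proof (rule Liminf_le)
      show "\<forall>\<^sub>F n in sequentially. (\<integral>\<^sup>+z. ennreal (\<bar>F n z\<bar> powr p) \<partial>?LL) \<le> ennreal (C powr p')"
        using FI main by (intro always_eventually allI) (simp add: nn_integral_eq_integral I_def ennreal_leI)
    qed simp
    finally show ?thesis .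
  qed
  \<comment> \<open>Distances at least 1 require no duality: there the kernel is integrable and the
    L^p' norm of \<xi> suffices.\<close>
  define k where "k h = indicat_real (- ball 0 1) h * norm h powr (- (t * p') - ?N)" for h :: 'a
  have [measurable]: "- ball (0::'a) 1 \<in> sets borel" by auto
  have [measurable]: "k \<in> borel_measurable borel" unfolding k_def by measurable
  have ki: "integrable lborel k"
  proof (rule integrableI_nonneg)
    have "(\<integral>\<^sup>+h. ennreal (k h) \<partial>lborel) = (\<integral>\<^sup>+h. indicator (- ball 0 1) h * ennreal (norm h powr (- (t * p') - ?N)) \<partial>(lborel :: 'a measure))"
      by (intro nn_integral_cong) (auto simp: k_def indicator_def)
    moreover have "t * p' > 0" using t p'1 by simp
    ultimately show "(\<integral>\<^sup>+h. ennreal (k h) \<partial>lborel) < \<infinity>" using far_kernel_finite[of "t * p'", where 'a='a] by simp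
  qed (auto simp: k_def)
  have ksym: "k (- h) = k h" for h by (auto simp: k_def indicator_def)
  define T where "T z = 2 powr p' * ((case z of (x, y) \<Rightarrow> \<bar>\<xi> x\<bar> powr p' * k (x - y)) + (case z of (x, y) \<Rightarrow> \<bar>\<xi> y\<bar> powr p' * k (x - y)))" for z
  have Ti: "integrable ?LL T" unfolding T_def
    using pair_convolution_integrable(1)[OF \<xi>p ki] pair_convolution_integrable'(1)[OF \<xi>p ki ksym] by simp
  have Dpow: "(case z of (x, y) \<Rightarrow> \<bar>\<xi> x - \<xi> y\<bar> powr p' / norm (x - y) powr (?N + t * p')) = \<bar>D z\<bar> powr p'" for z
    unfolding cp[symmetric] by (cases z) (simp add: D_def abs_divide powr_divide powr_powr)
  have split: "ennreal (\<bar>D z\<bar> powr p') \<le> ennreal (indicat_real Y z * \<bar>D z\<bar> powr p') + ennreal (T z)" for z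
  proof (cases "z \<in> Y")
    case True
    thus ?thesis by simp
  next
    case False
    obtain x y where z: "z = (x, y)" by (cases z)
    have far: "x - y \<in> - ball 0 1" using False by (simp add: Y_def z)
    have "\<bar>D z\<bar> powr p' = \<bar>\<xi> x - \<xi> y\<bar> powr p' * (1 / norm (x - y) powr (?N + t * p'))"
      using Dpow[of z] by (simp add: z)
    also have "1 / norm (x - y) powr (?N + t * p') = k (x - y)"
      using far inverse_powr_kernel[of "x - y" ?N "t * p'"] by (simp add: k_def)
    also have "\<bar>\<xi> x - \<xi> y\<bar> powr p' * k (x - y) \<le> (2 powr p' * (\<bar>\<xi> x\<bar> powr p' + \<bar>\<xi> y\<bar> powr p')) * k (x - y)"
      using p'1 by (intro mult_right_mono powr_abs_diff_le) (auto simp: k_def)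
    also have "\<dots> = T z" by (simp add: T_def z algebra_simps)
    finally have "ennreal (\<bar>D z\<bar> powr p') \<le> ennreal (T z)" by (rule ennreal_leI)
    thus ?thesis by (rule add_increasing[rotated]) simp
  qed
  have "(\<integral>\<^sup>+z. ennreal (\<bar>D z\<bar> powr p') \<partial>?LL) \<le> (\<integral>\<^sup>+z. ennreal (indicat_real Y z * \<bar>D z\<bar> powr p') + ennreal (T z) \<partial>?LL)"
    by (intro nn_integral_mono split)
  also have "\<dots> = (\<integral>\<^sup>+z. ennreal (indicat_real Y z * \<bar>D z\<bar> powr p') \<partial>?LL) + (\<integral>\<^sup>+z. ennreal (T z) \<partial>?LL)"
    using Ti by (intro nn_integral_add) auto
  also have "\<dots> < \<infinity>"
  proof -
    have "(\<integral>\<^sup>+z. ennreal (T z) \<partial>?LL) \<le> (\<integral>\<^sup>+z. ennreal (norm (T z)) \<partial>?LL)" by (intro nn_integral_mono ennreal_leI) simp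
    also have "\<dots> < \<infinity>" using Ti by (simp add: integrable_iff_bounded)
    finally show ?thesis using near by (auto simp: ennreal_add_less_top intro: le_less_trans)
  qed
  finally show ?thesis unfolding Dpow .
qed

end

section \<open>The adjoint state\<close>

lemma lebesgue_measurable_cong_AE:
  fixes f g :: "'a::euclidean_space \<Rightarrow> real"
  assumes g: "g \<in> borel_measurable lebesgue" and ae: "AE x in lebesgue. f x = g x"
  shows "f \<in> borel_measurable lebesgue"
proof (rule measurableI)
  fix A :: "real set" assume A: "A \<in> sets borel"
  have "g -` A \<in> sets lebesgue" using measurable_sets[OF g A] by simp
  moreover have "AE x in lebesgue. x \<in> g -` A \<longleftrightarrow> x \<in> f -` A" using ae by eventually_elim simp
  ultimately show "f -` A \<inter> space lebesgue \<in> sets lebesgue"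
    using completion.in_sets_AE[of "g -` A" "f -` A" lborel] by simp
qed simp

text \<open>The weak formulation iterates integrals over \<open>lebesgue\<close>, while
  \<open>energy\<close> is an integral over the product of Borel measures. The exchange is made
  first in the inner variable, for almost every x, and then in the outer one.\<close>

lemma lebesgue_double_integral:
  fixes v \<phi> \<phi>' :: "'a::euclidean_space \<Rightarrow> real"
  assumes v[measurable]: "v \<in> borel_measurable borel" and \<phi>[measurable]: "\<phi> \<in> borel_measurable lebesgue"
    and \<phi>'[measurable]: "\<phi>' \<in> borel_measurable borel" and ae: "AE x in lborel. \<phi> x = \<phi>' x"
    and int: "integrable (lborel \<Otimes>\<^sub>M lborel) (\<lambda>z. gag s v z * gag s \<phi>' z)"
  shows "(\<integral>x. \<integral>y. (v x - v y) * (\<phi> x - \<phi> y) / norm (x - y) powr (real DIM('a) + 2 * s) \<partial>lebesgue \<partial>lebesgue) = energy s v \<phi>'"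
proof -
  let ?c = "real DIM('a) + 2 * s"
  have vl: "v \<in> borel_measurable lebesgue" by (rule measurable_completion) simp
  have ael: "AE x in lebesgue. \<phi> x = \<phi>' x" using ae by (rule AE_completion)
  define J where "J x = (\<integral>y. gag s v (x, y) * gag s \<phi>' (x, y) \<partial>lborel)" for x
  have Jm[measurable]: "J \<in> borel_measurable borel" unfolding J_def by measurable
  have inner: "(\<integral>y. (v x - v y) * (\<phi> x - \<phi> y) / norm (x - y) powr ?c \<partial>lebesgue) = J x" if x: "\<phi> x = \<phi>' x" for x
  proof -
    have m: "(\<lambda>y. (v x - v y) * (\<phi>' x - \<phi>' y) / norm (x - y) powr ?c) \<in> borel_measurable lborel" by measurable
    have aey: "AE y in lebesgue. (v x - v y) * (\<phi> x - \<phi> y) / norm (x - y) powr ?c = (v x - v y) * (\<phi>' x - \<phi>' y) / norm (x - y) powr ?c"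
      using ael by eventually_elim (simp add: x)
    have ml: "(\<lambda>y. (v x - v y) * (\<phi>' x - \<phi>' y) / norm (x - y) powr ?c) \<in> borel_measurable lebesgue"
      by (rule measurable_completion[OF m])
    have "(\<integral>y. (v x - v y) * (\<phi> x - \<phi> y) / norm (x - y) powr ?c \<partial>lebesgue) = (\<integral>y. (v x - v y) * (\<phi>' x - \<phi>' y) / norm (x - y) powr ?c \<partial>lebesgue)"
      by (rule integral_cong_AE[OF lebesgue_measurable_cong_AE[OF ml aey] ml aey])
    also have "\<dots> = (\<integral>y. (v x - v y) * (\<phi>' x - \<phi>' y) / norm (x - y) powr ?c \<partial>lborel)"
      by (rule integral_completion[OF m])
    finally show ?thesis by (simp add: J_def gag_mult)
  qed
  have aeJ: "AE x in lebesgue. (\<integral>y. (v x - v y) * (\<phi> x - \<phi> y) / norm (x - y) powr ?c \<partial>lebesgue) = J x"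
    using ael by eventually_elim (rule inner)
  have Jl: "J \<in> borel_measurable lebesgue" by (rule measurable_completion) simp
  have "(\<integral>x. \<integral>y. (v x - v y) * (\<phi> x - \<phi> y) / norm (x - y) powr ?c \<partial>lebesgue \<partial>lebesgue) = (\<integral>x. J x \<partial>lebesgue)"
    by (rule integral_cong_AE[OF lebesgue_measurable_cong_AE[OF Jl aeJ] Jl aeJ])
  also have "\<dots> = (\<integral>x. J x \<partial>lborel)" by (rule integral_completion) simp
  also have "\<dots> = energy s v \<phi>'"
  proof -
    have e: "(\<lambda>(x, y). gag s v (x, y) * gag s \<phi>' (x, y)) = (\<lambda>z. gag s v z * gag s \<phi>' z)" by auto
    have "integrable (lborel \<Otimes>\<^sub>M lborel) (\<lambda>(x, y). gag s v (x, y) * gag s \<phi>' (x, y))" unfolding e by (rule int)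
    from lborel_pair.integral_fst[OF this] show ?thesis unfolding e J_def energy_def .
  qed
  finally show ?thesis .
qed

lemma double_nn_integral_lebesgue:
  fixes u u' :: "'a::euclidean_space \<Rightarrow> real"
  assumes [measurable]: "u' \<in> borel_measurable borel" and ae: "AE x in lborel. u x = u' x"
  shows "(\<integral>\<^sup>+x. \<integral>\<^sup>+y. ennreal (\<bar>u x - u y\<bar> powr q / norm (x - y) powr r) \<partial>lebesgue \<partial>lebesgue)
    = (\<integral>\<^sup>+z. ennreal (case z of (x, y) \<Rightarrow> \<bar>u' x - u' y\<bar> powr q / norm (x - y) powr r) \<partial>(lborel \<Otimes>\<^sub>M lborel))"
proof -
  have "(\<integral>\<^sup>+x. \<integral>\<^sup>+y. ennreal (\<bar>u x - u y\<bar> powr q / norm (x - y) powr r) \<partial>lebesgue \<partial>lebesgue)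
     = (\<integral>\<^sup>+x. \<integral>\<^sup>+y. ennreal (\<bar>u x - u y\<bar> powr q / norm (x - y) powr r) \<partial>lborel \<partial>lborel)"
    by (simp add: nn_integral_completion)
  also have "\<dots> = (\<integral>\<^sup>+x. \<integral>\<^sup>+y. ennreal (\<bar>u' x - u' y\<bar> powr q / norm (x - y) powr r) \<partial>lborel \<partial>lborel)"
  proof (rule nn_integral_cong_AE, use ae in eventually_elim)
    fix x assume x: "u x = u' x"
    show "(\<integral>\<^sup>+y. ennreal (\<bar>u x - u y\<bar> powr q / norm (x - y) powr r) \<partial>lborel) = (\<integral>\<^sup>+y. ennreal (\<bar>u' x - u' y\<bar> powr q / norm (x - y) powr r) \<partial>lborel)"
      by (rule nn_integral_cong_AE, use ae in eventually_elim) (simp add: x)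
  qed
  also have "\<dots> = (\<integral>\<^sup>+z. ennreal (case z of (x, y) \<Rightarrow> \<bar>u' x - u' y\<bar> powr q / norm (x - y) powr r) \<partial>(lborel \<Otimes>\<^sub>M lborel))"
  proof -
    have m: "(\<lambda>(x, y). \<bar>u' x - u' y\<bar> powr q / norm (x - y) powr r) \<in> borel_measurable (lborel \<Otimes>\<^sub>M lborel)" by measurable
    have "(\<lambda>z. ennreal (case z of (x, y) \<Rightarrow> \<bar>u' x - u' y\<bar> powr q / norm (x - y) powr r)) \<in> borel_measurable (lborel \<Otimes>\<^sub>M lborel)"
      by (rule measurable_compose[OF m measurable_ennreal])
    from lborel.nn_integral_fst[OF this] show ?thesis by (simp only: prod.case)
  qed
  finally show ?thesis .
qed

lemma gag_square:
  "(case z of (x, y) \<Rightarrow> \<bar>u x - u y\<bar> powr 2 / norm (x - y) powr (real DIM('a::euclidean_space) + s * 2)) = (gag s u (z :: 'a \<times> 'a))\<^sup>2"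
proof (cases z)
  case (Pair x y)
  have "\<bar>u x - u y\<bar> powr 2 = (u x - u y) * (u x - u y)" by (simp add: power2_eq_square)
  thus ?thesis by (simp only: Pair prod.case power2_eq_square gag_mult mult.commute[of s 2])
qed

section \<open>Pairing with the multiplier measure\<close>

lemma integral_le_sup_times_mass:
  fixes v :: "'b \<Rightarrow> real"
  assumes mass: "emeasure M (space M) \<le> ennreal c" and v: "\<And>x. \<bar>v x\<bar> \<le> m" and c: "c \<ge> 0" and m: "m \<ge> 0"
  shows "\<bar>\<integral>x. v x \<partial>M\<bar> \<le> m * c"
proof (cases "integrable M v")
  case True
  have fin: "emeasure M (space M) < \<infinity>" using mass by (rule order_le_less_trans) simp
  interpret finite_measure M using fin by (intro finite_measureI) auto
  have "\<bar>\<integral>x. v x \<partial>M\<bar> \<le> (\<integral>x. \<bar>v x\<bar> \<partial>M)" by (rule integral_abs_bound)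
  also have "\<dots> \<le> (\<integral>x. m \<partial>M)" using True v by (intro integral_mono) auto
  also have "\<dots> = m * measure M (space M)" by simp
  also have "\<dots> \<le> m * c"
    using mass c m by (intro mult_left_mono) (simp_all add: emeasure_eq_measure)
  finally show ?thesis .
next
  \<comment> \<open>A function that is not integrable has Bochner integral 0 by convention.\<close>
  case False
  thus ?thesis using c m by (simp add: not_integrable_integral_eq)
qed

lemma signed_measure_empty:
  fixes \<Omega> :: "'a::euclidean_space set"
  assumes "\<mu> \<in> signed_measures \<Omega>"
  shows "\<mu> {} = 0"
proof -
  have "(\<lambda>n. \<mu> (A n)) sums \<mu> (\<Union>n. A n)"
    if "range A \<subseteq> sets (restrict_space borel \<Omega>)" "disjoint_family A" for A :: "nat \<Rightarrow> 'a set"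
    using assms that by (simp add: signed_measures_def)
  from this[of "\<lambda>_. {}"] have "(\<lambda>n::nat. \<mu> {}) sums \<mu> {}" by (simp add: disjoint_family_on_def)
  hence "(\<lambda>n::nat. \<mu> {}) \<longlonglongrightarrow> 0" by (intro summable_LIMSEQ_zero) (rule sums_summable)
  thus ?thesis by (simp add: LIMSEQ_const_iff)
qed

lemma signed_measure_mono:
  assumes \<mu>: "\<mu> \<in> signed_measures \<Omega>" and pos: "nonneg_measure \<Omega> \<mu>" and \<Omega>: "\<Omega> \<in> sets borel"
    and B: "B \<in> sets (restrict_space borel \<Omega>)"
  shows "\<mu> B \<le> \<mu> \<Omega>"
proof -
  let ?S = "sets (restrict_space borel \<Omega>)"
  have \<Omega>S: "\<Omega> \<in> ?S" using \<Omega> by (auto simp: sets_restrict_space)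
  have BS: "B \<subseteq> \<Omega>" using B by (auto simp: sets_restrict_space)
  have C: "\<Omega> - B \<in> ?S" using \<Omega>S B by blast
  \<comment> \<open>Finite additivity is extracted from countable additivity by padding with empty
    sets.\<close>
  define A where "A n = (if n = 0 then B else if n = Suc 0 then \<Omega> - B else {})" for n :: nat
  have "range A \<subseteq> ?S" using B C by (auto simp: A_def)
  moreover have "disjoint_family A" by (auto simp: disjoint_family_on_def A_def)
  ultimately have "(\<lambda>n. \<mu> (A n)) sums \<mu> (\<Union>n. A n)" using \<mu> unfolding signed_measures_def by blast
  moreover have "(\<Union>n. A n) = \<Omega>"
  proof
    show "(\<Union>n. A n) \<subseteq> \<Omega>" using BS by (auto simp: A_def split: if_splits)
    show "\<Omega> \<subseteq> (\<Union>n. A n)"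
    proof
      fix x assume "x \<in> \<Omega>"
      hence "x \<in> A 0 \<or> x \<in> A (Suc 0)" by (simp add: A_def)
      thus "x \<in> (\<Union>n. A n)" by blast
    qed
  qed
  moreover have "(\<lambda>n. \<mu> (A n)) sums (\<Sum>n\<in>{0, Suc 0}. \<mu> (A n))"
    by (rule sums_finite) (auto simp: A_def signed_measure_empty[OF \<mu>])
  ultimately have "\<mu> \<Omega> = (\<Sum>n\<in>{0, Suc 0}. \<mu> (A n))" by (metis sums_unique2)
  also have "\<dots> = \<mu> B + \<mu> (\<Omega> - B)" by (simp add: A_def)
  finally show ?thesis using pos C by (simp add: nonneg_measure_def)
qed

text \<open>\<open>measure_of\<close> evaluates on each set either to the prescribed supremum or to
  0, and both are at most c.\<close>

lemma positive_part_mass: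
  assumes "\<And>B. B \<in> sets (restrict_space borel \<Omega>) \<Longrightarrow> \<nu> B \<le> c"
  shows "emeasure (positive_part \<Omega> \<nu>) (space (positive_part \<Omega> \<nu>)) \<le> ennreal c"
proof -
  have "(SUP B\<in>{B \<in> sets (restrict_space borel \<Omega>). B \<subseteq> A}. ennreal (\<nu> B)) \<le> ennreal c" for A
    using assms by (intro SUP_least ennreal_leI) auto
  thus ?thesis unfolding positive_part_def emeasure_measure_of_conv by simp
qed

text \<open>Each of the two Jordan parts is bounded crudely by the total mass, hence the factor 2.
  The application asks only for some constant multiple of the sup norm.\<close>

lemma signed_integral_bound:
  assumes \<mu>: "\<mu> \<in> signed_measures \<Omega>" and pos: "nonneg_measure \<Omega> \<mu>" and \<Omega>: "\<Omega> \<in> sets borel"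
    and v: "\<And>x. \<bar>v x\<bar> \<le> m"
  shows "\<bar>signed_integral \<Omega> \<mu> v\<bar> \<le> 2 * \<mu> \<Omega> * m"
proof -
  have m: "m \<ge> 0" using v[of undefined] by linarith
  have "\<Omega> \<in> sets (restrict_space borel \<Omega>)" using \<Omega> by (auto simp: sets_restrict_space)
  hence c: "\<mu> \<Omega> \<ge> 0" using pos by (simp add: nonneg_measure_def)
  have 1: "\<bar>\<integral>x. v x \<partial>positive_part \<Omega> \<mu>\<bar> \<le> m * \<mu> \<Omega>"
    by (rule integral_le_sup_times_mass[OF positive_part_mass v c m]) (rule signed_measure_mono[OF \<mu> pos \<Omega>])
  have 2: "\<bar>\<integral>x. v x \<partial>positive_part \<Omega> (\<lambda>A. - \<mu> A)\<bar> \<le> m * \<mu> \<Omega>"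
  proof (rule integral_le_sup_times_mass[OF positive_part_mass v c m])
    fix B assume "B \<in> sets (restrict_space borel \<Omega>)"
    thus "- \<mu> B \<le> \<mu> \<Omega>" using pos c by (force simp: nonneg_measure_def)
  qed
  show ?thesis using 1 2 unfolding signed_integral_def by (simp add: mult.commute)
qed

lemma frac_const_pos:
  assumes "0 < s" "s < 1" "N \<ge> 0"
  shows "frac_const N s > 0"
proof -
  have "Gamma ((2 * s + N) / 2) > 0" "Gamma (1 - s) > 0" using assms by (intro Gamma_real_pos; simp)+
  thus ?thesis using assms by (simp add: frac_const_def)
qed

context fractional_domain
begin

text \<open>The datum absorbs the factor that \<open>energy\<close> omits. Test functions in the
  definition are merely Lebesgue measurable and are replaced by Borel representatives, which lie in
  the energy space.\<close>

lemma weak_solution_is_frac_laplacian: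
  assumes v: "weak_solution v g" and g: "g \<in> borel_measurable borel" and gM: "\<And>x. \<bar>g x\<bar> \<le> M"
  shows "is_frac_laplacian \<Omega> s p v (\<lambda>x. frac_const (real DIM('a)) s / 2 * g x)"
proof -
  let ?C = "frac_const (real DIM('a)) s"
  note [measurable] = g
  have C: "?C > 0" using s by (intro frac_const_pos) auto
  have vE: "v \<in> energy_space \<Omega> s" using v by (simp add: weak_solution_def)
  note vm[measurable] = energy_spaceD(1)[OF vE]
  have \<Omega>l: "\<Omega> \<inter> space lebesgue \<in> sets lebesgue" by simp
  have "v \<in> frac_sobolev_0 \<Omega> s 2"
  proof -
    have vl: "v \<in> borel_measurable lebesgue" by (rule measurable_completion) simp
    have "integrable lebesgue (\<lambda>x. \<bar>v x\<bar> powr 2)"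
      using energy_space_L2[OF vE] by (subst integrable_completion) simp_all
    hence L: "v \<in> Lp lebesgue 2" using vl by (simp add: Lp_def)
    have "(\<integral>\<^sup>+z. ennreal ((gag s v z)\<^sup>2) \<partial>(lborel \<Otimes>\<^sub>M lborel)) < \<infinity>"
      using energy_spaceD(3)[OF vE] by (simp add: integrable_iff_bounded)
    hence "(\<integral>\<^sup>+x. \<integral>\<^sup>+y. ennreal (\<bar>v x - v y\<bar> powr 2 / norm (x - y) powr (real DIM('a) + s * 2)) \<partial>lebesgue \<partial>lebesgue) < \<infinity>"
      by (subst double_nn_integral_lebesgue[OF vm]) (simp_all only: gag_square AE_I2)
    thus ?thesis using L AE_completion[OF energy_spaceD(2)[OF vE]] by (simp add: frac_sobolev_0_def frac_sobolev_def)
  qed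
  moreover have "(\<lambda>x. ?C / 2 * g x) \<in> Lp (lebesgue_on \<Omega>) p"
  proof -
    have m: "(\<lambda>x. ?C / 2 * g x) \<in> borel_measurable (lebesgue_on \<Omega>)"
      by (rule measurable_restrict_space1, rule measurable_completion) simp
    have gM': "\<bar>?C / 2 * g x\<bar> \<le> ?C / 2 * M" for x using gM[of x] C by (simp add: abs_mult)
    have "Lp_data (\<lambda>x. ?C / 2 * g x)" by (rule bounded_Lp_data[OF _ gM']) simp
    hence "integrable lborel (\<lambda>x. indicat_real \<Omega> x *\<^sub>R \<bar>?C / 2 * g x\<bar> powr p)" by (simp add: Lp_data_def)
    hence "integrable lebesgue (\<lambda>x. indicat_real \<Omega> x *\<^sub>R \<bar>?C / 2 * g x\<bar> powr p)"
      by (subst integrable_completion) simp_all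
    thus ?thesis using m by (simp add: Lp_def integrable_restrict_space[OF \<Omega>l])
  qed
  moreover have "?C / 2 * (\<integral>x. \<integral>y. (v x - v y) * (\<phi> x - \<phi> y) / norm (x - y) powr (real DIM('a) + 2 * s) \<partial>lebesgue \<partial>lebesgue)
      = (\<integral>x. ?C / 2 * g x * \<phi> x \<partial>lebesgue_on \<Omega>)" if \<phi>: "\<phi> \<in> frac_sobolev_0 \<Omega> s 2" for \<phi>
  proof -
    have \<phi>m: "\<phi> \<in> borel_measurable lebesgue" using \<phi> by (simp add: frac_sobolev_0_def frac_sobolev_def Lp_def)
    obtain \<phi>' where \<phi>'b: "\<phi>' \<in> borel_measurable lborel" and ae: "AE x in lborel. \<phi> x = \<phi>' x"
      using completion_ex_borel_measurable_real[OF \<phi>m] by blast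
    hence \<phi>'m[measurable]: "\<phi>' \<in> borel_measurable borel" by simp
    have "AE x in lborel. x \<notin> \<Omega> \<longrightarrow> \<phi> x = 0"
      using \<phi> by (simp add: frac_sobolev_0_def AE_completion_iff)
    hence off: "AE x in lborel. x \<notin> \<Omega> \<longrightarrow> \<phi>' x = 0" using ae by eventually_elim auto
    have "(\<integral>\<^sup>+z. ennreal ((gag s \<phi>' z)\<^sup>2) \<partial>(lborel \<Otimes>\<^sub>M lborel)) < \<infinity>"
      using \<phi> double_nn_integral_lebesgue[OF \<phi>'m ae, of 2 "real DIM('a) + s * 2"]
      by (simp only: frac_sobolev_0_def frac_sobolev_def gag_square mem_Collect_eq)
    hence "integrable (lborel \<Otimes>\<^sub>M lborel) (\<lambda>z. (gag s \<phi>' z)\<^sup>2)" by (intro integrableI_nonneg) simp_all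
    hence \<phi>'E: "\<phi>' \<in> energy_space \<Omega> s" using off by (simp add: energy_space_def)
    have m: "(\<lambda>x. ?C / 2 * g x * \<phi>' x) \<in> borel_measurable lborel" by measurable
    have ml: "(\<lambda>x. ?C / 2 * g x * \<phi>' x) \<in> borel_measurable lebesgue" by (rule measurable_completion[OF m])
    have aeg: "AE x in lebesgue. indicat_real \<Omega> x *\<^sub>R (?C / 2 * g x * \<phi> x) = ?C / 2 * g x * \<phi>' x"
      using AE_completion[OF ae] AE_completion[OF off] by eventually_elim (auto simp: indicator_def)
    have "(\<integral>x. ?C / 2 * g x * \<phi> x \<partial>lebesgue_on \<Omega>) = (\<integral>x. indicat_real \<Omega> x *\<^sub>R (?C / 2 * g x * \<phi> x) \<partial>lebesgue)"
      by (rule integral_restrict_space[OF \<Omega>l])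
    also have "\<dots> = (\<integral>x. ?C / 2 * g x * \<phi>' x \<partial>lebesgue)"
      by (rule integral_cong_AE[OF lebesgue_measurable_cong_AE[OF ml aeg] ml aeg])
    also have "\<dots> = (\<integral>x. ?C / 2 * g x * \<phi>' x \<partial>lborel)" by (rule integral_completion[OF m])
    also have "\<dots> = ?C / 2 * (\<integral>x. g x * \<phi>' x \<partial>lborel)"
      by (simp only: mult.assoc Bochner_Integration.integral_mult_right_zero)
    also have "(\<integral>x. g x * \<phi>' x \<partial>lborel) = energy s v \<phi>'" using v \<phi>'E by (simp add: weak_solution_def)
    finally show ?thesis
      unfolding lebesgue_double_integral[OF vm \<phi>m \<phi>'m ae energy_space_integrable[OF vE \<phi>'E]] by simp
  qed
  ultimately show ?thesis by (simp add: is_frac_laplacian_def)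
qed

text \<open>On the right of the adjoint equation the continuous state meets only an integrable
  function and a finite measure, so its sup norm controls both terms; this is the duality hypothesis
  of \<open>dual_seminorm\<close>.\<close>

lemma adjoint_regularity:
  fixes \<xi> j :: "'a \<Rightarrow> real" and \<mu> :: "'a set \<Rightarrow> real" and t p' :: real
  assumes cone: "exterior_cone_condition \<Omega>" and t: "0 < t" "t < s" and p': "p' = p / (p - 1)"
    and \<mu>: "\<mu> \<in> signed_measures \<Omega>" "nonneg_measure \<Omega> \<mu>" and \<xi>: "\<xi> \<in> Lp (lebesgue_on \<Omega>) p'"
    and j: "j \<in> Lp (lebesgue_on \<Omega>) 2"
    and adjoint: "\<And>v g. v \<in> state_space \<Omega> s p \<Longrightarrow> is_frac_laplacian \<Omega> s p v g \<Longrightarrow>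
      (\<integral>x. \<xi> x * g x \<partial>lebesgue_on \<Omega>) = (\<integral>x. j x * v x \<partial>lebesgue_on \<Omega>) + signed_integral \<Omega> \<mu> v"
  shows "(\<lambda>x. if x \<in> \<Omega> then \<xi> x else 0) \<in> frac_sobolev_0 \<Omega> t p'"
proof -
  let ?C = "frac_const (real DIM('a)) s"
  let ?\<xi> = "\<lambda>x. if x \<in> \<Omega> then \<xi> x else 0"
  have C: "?C > 0" using s by (intro frac_const_pos) auto
  have p'1: "p' > 1" using p by (simp add: p')
  have \<Omega>l: "\<Omega> \<inter> space lebesgue \<in> sets lebesgue" by simp
  have \<xi>eq: "?\<xi> x = indicat_real \<Omega> x *\<^sub>R \<xi> x" for x by (simp add: indicator_def)
  have \<xi>m: "?\<xi> \<in> borel_measurable lebesgue"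
    using \<xi> unfolding \<xi>eq by (simp add: Lp_def borel_measurable_restrict_space_iff[OF \<Omega>l])
  have \<xi>p: "integrable lebesgue (\<lambda>x. \<bar>?\<xi> x\<bar> powr p')"
  proof -
    have "integrable lebesgue (\<lambda>x. indicat_real \<Omega> x *\<^sub>R \<bar>\<xi> x\<bar> powr p')"
      using \<xi> by (simp add: Lp_def integrable_restrict_space[OF \<Omega>l])
    moreover have "(\<lambda>x. indicat_real \<Omega> x *\<^sub>R \<bar>\<xi> x\<bar> powr p') = (\<lambda>x. \<bar>?\<xi> x\<bar> powr p')"
      by (auto simp: indicator_def)
    ultimately show ?thesis by simp
  qed
  obtain \<zeta>0 where \<zeta>0: "\<zeta>0 \<in> borel_measurable lborel" and ae0: "AE x in lborel. ?\<xi> x = \<zeta>0 x"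
    using completion_ex_borel_measurable_real[OF \<xi>m] by blast
  \<comment> \<open>A Borel representative that vanishes at every point outside \<Omega>, not merely
    almost everywhere.\<close>
  define \<zeta> where "\<zeta> x = indicat_real \<Omega> x * \<zeta>0 x" for x
  have \<zeta>m[measurable]: "\<zeta> \<in> borel_measurable borel" unfolding \<zeta>_def using \<zeta>0 by simp
  have ae: "AE x in lborel. ?\<xi> x = \<zeta> x" using ae0 by eventually_elim (auto simp: \<zeta>_def indicator_def)
  have ael: "AE x in lebesgue. ?\<xi> x = \<zeta> x" by (rule AE_completion[OF ae])
  have \<zeta>p: "integrable lborel (\<lambda>x. \<bar>\<zeta> x\<bar> powr p')"
  proof -
    have m: "(\<lambda>x. \<bar>\<zeta> x\<bar> powr p') \<in> borel_measurable lborel" by measurable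
    have "integrable lebesgue (\<lambda>x. \<bar>\<zeta> x\<bar> powr p')"
      by (rule integrable_cong_AE_imp[OF \<xi>p measurable_completion[OF m]]) (use ael in \<open>auto elim!: eventually_mono\<close>)
    thus ?thesis by (simp only: integrable_completion[OF m])
  qed
  have ji: "integrable (lebesgue_on \<Omega>) (\<lambda>x. \<bar>j x\<bar>)"
  proof (rule Bochner_Integration.integrable_bound)
    have jm: "j \<in> borel_measurable (lebesgue_on \<Omega>)" using j by (simp add: Lp_def)
    show "(\<lambda>x. \<bar>j x\<bar>) \<in> borel_measurable (lebesgue_on \<Omega>)" using jm by measurable
    have "emeasure (lebesgue_on \<Omega>) (space (lebesgue_on \<Omega>)) = emeasure lborel \<Omega>"
      by (subst emeasure_restrict_space) simp_all
    hence "integrable (lebesgue_on \<Omega>) (\<lambda>x. 1 :: real)"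
      using domain_finite by (intro finite_measure.integrable_const finite_measureI) auto
    thus "integrable (lebesgue_on \<Omega>) (\<lambda>x. 1 + \<bar>j x\<bar> powr 2)" using j by (simp add: Lp_def)
    show "AE x in lebesgue_on \<Omega>. norm \<bar>j x\<bar> \<le> norm (1 + \<bar>j x\<bar> powr 2)"
    proof (intro AE_I2)
      fix x
      have "2 * \<bar>j x\<bar> \<le> 1 + (j x)\<^sup>2" using sum_squares_bound[of 1 "\<bar>j x\<bar>"] by simp
      hence "\<bar>j x\<bar> \<le> 1 + (j x)\<^sup>2" by linarith
      thus "norm \<bar>j x\<bar> \<le> norm (1 + \<bar>j x\<bar> powr 2)" by simp
    qed
  qed
  define J1 where "J1 = (\<integral>x. \<bar>j x\<bar> \<partial>lebesgue_on \<Omega>)"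
  have J1: "J1 \<ge> 0" by (simp add: J1_def)
  have "\<Omega> \<in> sets (restrict_space borel \<Omega>)" by (auto simp: sets_restrict_space)
  hence \<mu>0: "\<mu> \<Omega> \<ge> 0" using \<mu>(2) by (simp add: nonneg_measure_def)
  \<comment> \<open>The mass of j plus the bound for the signed integral; \<open>2 / ?C\<close>
    undoes the normalisation of the datum.\<close>
  define K where "K = 2 / ?C * (J1 + 2 * \<mu> \<Omega>)"
  have K: "K \<ge> 0" using C J1 \<mu>0 by (simp add: K_def)
  have "(\<integral>\<^sup>+z. ennreal (case z of (x, y) \<Rightarrow> \<bar>\<zeta> x - \<zeta> y\<bar> powr p' / norm (x - y) powr (real DIM('a) + t * p')) \<partial>(lborel \<Otimes>\<^sub>M lborel)) < \<infinity>"
  proof (rule dual_seminorm[OF cone t p' \<zeta>m _ \<zeta>p K])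
    show "\<zeta> x = 0" if "x \<notin> \<Omega>" for x using that by (simp add: \<zeta>_def)
    fix v g :: "'a \<Rightarrow> real" and m Mg :: real
    assume v: "weak_solution v g" and g[measurable]: "g \<in> borel_measurable borel" and gM: "\<And>x. \<bar>g x\<bar> \<le> Mg"
      and vc: "continuous_on UNIV v" and v0: "\<And>x. x \<notin> \<Omega> \<Longrightarrow> v x = 0" and vm: "\<And>x. \<bar>v x\<bar> \<le> m"
    have m0: "m \<ge> 0" using vm[of 0] by linarith
    note fl = weak_solution_is_frac_laplacian[OF v g gM]
    have "v \<in> state_space \<Omega> s p"
    proof -
      have "v \<in> C0 \<Omega>" using vc v0 by (auto simp: C0_def intro: continuous_on_subset)
      thus ?thesis using fl unfolding state_space_def is_frac_laplacian_def by blast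
    qed
    from adjoint[OF this fl]
    have eq: "(\<integral>x. \<xi> x * (?C / 2 * g x) \<partial>lebesgue_on \<Omega>) = (\<integral>x. j x * v x \<partial>lebesgue_on \<Omega>) + signed_integral \<Omega> \<mu> v" .
    have "(\<integral>x. \<xi> x * (?C / 2 * g x) \<partial>lebesgue_on \<Omega>) = ?C / 2 * (\<integral>x. \<zeta> x * g x \<partial>lborel)"
    proof -
      have bm: "(\<lambda>x. ?C / 2 * (\<zeta> x * g x)) \<in> borel_measurable lborel" by measurable
      have ml: "(\<lambda>x. ?C / 2 * (\<zeta> x * g x)) \<in> borel_measurable lebesgue" by (rule measurable_completion[OF bm])
      have aeq: "AE x in lebesgue. indicat_real \<Omega> x *\<^sub>R (\<xi> x * (?C / 2 * g x)) = ?C / 2 * (\<zeta> x * g x)"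
        using ael by eventually_elim (auto simp: indicator_def \<zeta>_def)
      have "(\<integral>x. \<xi> x * (?C / 2 * g x) \<partial>lebesgue_on \<Omega>) = (\<integral>x. indicat_real \<Omega> x *\<^sub>R (\<xi> x * (?C / 2 * g x)) \<partial>lebesgue)"
        by (rule integral_restrict_space[OF \<Omega>l])
      also have "\<dots> = (\<integral>x. ?C / 2 * (\<zeta> x * g x) \<partial>lebesgue)"
        by (rule integral_cong_AE[OF lebesgue_measurable_cong_AE[OF ml aeq] ml aeq])
      also have "\<dots> = (\<integral>x. ?C / 2 * (\<zeta> x * g x) \<partial>lborel)" by (rule integral_completion[OF bm])
      finally show ?thesis by simp
    qed
    hence "?C / 2 * (\<integral>x. \<zeta> x * g x \<partial>lborel) = (\<integral>x. j x * v x \<partial>lebesgue_on \<Omega>) + signed_integral \<Omega> \<mu> v" using eq by simp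
    hence "\<bar>?C / 2 * (\<integral>x. \<zeta> x * g x \<partial>lborel)\<bar> \<le> \<bar>\<integral>x. j x * v x \<partial>lebesgue_on \<Omega>\<bar> + \<bar>signed_integral \<Omega> \<mu> v\<bar>" by linarith
    also have "\<bar>\<integral>x. j x * v x \<partial>lebesgue_on \<Omega>\<bar> \<le> m * J1"
    proof -
      have "\<bar>\<integral>x. j x * v x \<partial>lebesgue_on \<Omega>\<bar> \<le> (\<integral>x. \<bar>j x * v x\<bar> \<partial>lebesgue_on \<Omega>)" by (rule integral_abs_bound)
      also have "\<dots> \<le> (\<integral>x. m * \<bar>j x\<bar> \<partial>lebesgue_on \<Omega>)"
      proof (rule integral_mono')
        show "integrable (lebesgue_on \<Omega>) (\<lambda>x. m * \<bar>j x\<bar>)" using ji by simp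
        show "\<bar>j x * v x\<bar> \<le> m * \<bar>j x\<bar>" for x using mult_right_mono[OF vm[of x], of "\<bar>j x\<bar>"] by (simp add: abs_mult mult.commute)
        show "0 \<le> m * \<bar>j x\<bar>" for x using m0 by simp
      qed
      finally show ?thesis by (simp add: J1_def)
    qed
    also have "\<bar>signed_integral \<Omega> \<mu> v\<bar> \<le> 2 * \<mu> \<Omega> * m" by (rule signed_integral_bound[OF \<mu> domain_borel vm])
    finally have "?C / 2 * \<bar>\<integral>x. \<zeta> x * g x \<partial>lborel\<bar> \<le> m * J1 + 2 * \<mu> \<Omega> * m" using C by (simp add: abs_mult)
    hence "2 / ?C * (?C / 2 * \<bar>\<integral>x. \<zeta> x * g x \<partial>lborel\<bar>) \<le> 2 / ?C * (m * J1 + 2 * \<mu> \<Omega> * m)"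
      using C by (intro mult_left_mono) auto
    also have "2 / ?C * (?C / 2 * \<bar>\<integral>x. \<zeta> x * g x \<partial>lborel\<bar>) = \<bar>\<integral>x. \<zeta> x * g x \<partial>lborel\<bar>" using C by simp
    also have "2 / ?C * (m * J1 + 2 * \<mu> \<Omega> * m) = K * m"
    proof -
      have "m * J1 + 2 * \<mu> \<Omega> * m = (J1 + 2 * \<mu> \<Omega>) * m" by (simp add: algebra_simps)
      thus ?thesis by (simp only: K_def mult.assoc)
    qed
    finally show "\<bar>\<integral>x. \<zeta> x * g x \<partial>lborel\<bar> \<le> K * m" .
  qed
  hence "(\<integral>\<^sup>+x. \<integral>\<^sup>+y. ennreal (\<bar>?\<xi> x - ?\<xi> y\<bar> powr p' / norm (x - y) powr (real DIM('a) + t * p')) \<partial>lebesgue \<partial>lebesgue) < \<infinity>"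
    by (subst double_nn_integral_lebesgue[OF \<zeta>m ae])
  thus ?thesis using \<xi>m \<xi>p by (simp add: frac_sobolev_0_def frac_sobolev_def Lp_def)
qed

end

theorem corollary6p6:
  fixes \<Omega> :: "(real ^ 'n) set"
    and s t p p' :: real
    and Zad :: "(real ^ 'n \<Rightarrow> real) set"
    and ub u_hat z_hat ubar zbar \<xi> :: "real ^ 'n \<Rightarrow> real"
    and J :: "(real ^ 'n \<Rightarrow> real) \<Rightarrow> (real ^ 'n \<Rightarrow> real) \<Rightarrow> real"
    and Ju Jz :: "(real ^ 'n \<Rightarrow> real) \<Rightarrow> (real ^ 'n \<Rightarrow> real) \<Rightarrow> (real ^ 'n \<Rightarrow> real)"
    and \<mu> :: "(real ^ 'n) set \<Rightarrow> real"
  assumes dom: "bounded_lipschitz_domain \<Omega>" "exterior_cone_condition \<Omega>"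
    and ts: "0 < t" "t < s" "s < 1"
    and p: "2 < real CARD('n) / s" "real CARD('n) / s < p"
    and p': "p' = p / (p - 1)" "1 < p'" "p' < 2" "1 / p' < t" "t < 1"
    and Zad: "Zad \<subseteq> Lp (lebesgue_on \<Omega>) p" "Zad \<noteq> {}"
      "Lp_closed (lebesgue_on \<Omega>) p Zad" "fun_convex Zad"
    and ub: "continuous_on (closure \<Omega>) ub"
    and J: "C1_functional \<Omega> p J Ju Jz"
    and slater: "z_hat \<in> Zad" "u_hat \<in> state_space \<Omega> s p" "is_frac_laplacian \<Omega> s p u_hat z_hat"
      "\<forall>x\<in>closure \<Omega>. u_hat x < ub x"
    and solution: "is_arg_min (\<lambda>(u, z). J u z)
      (\<lambda>(u, z). u \<in> state_space \<Omega> s p \<and> z \<in> Lp (lebesgue_on \<Omega>) p \<and>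
         is_frac_laplacian \<Omega> s p u z \<and> u \<in> admissible_states \<Omega> ub \<and> z \<in> Zad) (ubar, zbar)"
    and multipliers: "\<mu> \<in> signed_measures \<Omega>" "\<xi> \<in> Lp (lebesgue_on \<Omega>) p'"
    and adjoint: "\<forall>v\<in>state_space \<Omega> s p. \<forall>g. is_frac_laplacian \<Omega> s p v g \<longrightarrow>
      (\<integral>x. \<xi> x * g x \<partial>lebesgue_on \<Omega>)
        = (\<integral>x. Ju ubar zbar x * v x \<partial>lebesgue_on \<Omega>) + signed_integral \<Omega> \<mu> v"
    and variational: "\<forall>z\<in>Zad.
      0 \<le> (\<integral>x. (\<xi> x + Jz ubar zbar x) * (z x - zbar x) \<partial>lebesgue_on \<Omega>)"
    and complementarity: "nonneg_measure \<Omega> \<mu>" "\<forall>x\<in>\<Omega>. ubar x \<le> ub x"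
      "signed_integral \<Omega> \<mu> (\<lambda>x. ub x - ubar x) = 0"
  shows "(\<lambda>x. if x \<in> \<Omega> then \<xi> x else 0) \<in> frac_sobolev_0 \<Omega> t p'"
proof -
  have s: "0 < s" using ts by simp
  interpret fractional_domain \<Omega> s p
  proof
    show "open \<Omega>" "bounded \<Omega>" using dom by (auto simp: bounded_lipschitz_domain_def)
    show "0 < s" "s < 1" using ts by auto
    show "2 < p" using p by linarith
    show "real DIM(real ^ 'n) < p * s" using p(2) s by (simp add: pos_divide_less_eq)
  qed
  have ubar: "ubar \<in> state_space \<Omega> s p" and zbar: "zbar \<in> Lp (lebesgue_on \<Omega>) p"
    using solution by (auto simp: is_arg_min_def)
  \<comment> \<open>The derivative \<open>Ju\<close> is known to be square integrable only at
    arguments of the right classes, so the optimal state is first restricted to \<Omega>.\<close>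
  have "ubar \<in> Lp lebesgue 2" using ubar by (simp add: state_space_def frac_sobolev_0_def frac_sobolev_def)
  hence ubm: "ubar \<in> borel_measurable lebesgue" and ubi: "integrable lebesgue (\<lambda>x. \<bar>ubar x\<bar> powr 2)"
    by (auto simp: Lp_def)
  have "integrable lebesgue (\<lambda>x. indicat_real \<Omega> x *\<^sub>R \<bar>ubar x\<bar> powr 2)"
    using ubi by (intro integrable_mult_indicator) simp_all
  hence "ubar \<in> Lp (lebesgue_on \<Omega>) 2"
    using measurable_restrict_space1[OF ubm] by (simp add: Lp_def integrable_restrict_space)
  hence "Ju ubar zbar \<in> Lp (lebesgue_on \<Omega>) 2"
    using J zbar unfolding C1_functional_def by blast
  thus ?thesis
    using adjoint by (intro adjoint_regularity[OF dom(2) ts(1,2) p'(1) multipliers(1) complementarity(1) multipliers(2)]) auto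
qed

end
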